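(* There is an algorithm that, given a graph $G$ on $n$ vertices and a positive integer $k$, decides whether $G$ admits a partial Grundy coloring using at least $k$ colors, in time $2^{\mathcal{O}(k^5)}\cdot n^{\mathcal{O}(1)}$.
   Context: All graphs are finite, simple and undirected. For a positive integer $k'$, a partial Grundy coloring of $G$ using $k'$ colors is a proper coloring $c:V(G)\to[k']$ (adjacent vertices receive different colors) such that for every $i\in[k']$ there is a vertex $v$ with $c(v)=i$ which, for every $j\in[i-1]$, has a neighbor $u$ with $c(u)=j$. "$G$ admits a partial Grundy coloring using at least $k$ colors" means such a coloring exists for some $k'\ge k$. (Equivalently, there is an ordering of $V(G)$ and a greedy coloring in which each vertex receives some already-used color not present on its already-colored neighbors whenever such a color exists, and a new color otherwise, that uses at least $k$ colors.) This decision problem is called Partial Grundy Coloring. *)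

theory Defs
  imports "Graph_Theory.Pair_Digraph"
begin

section \<open>Partial Grundy colorings\<close>

text \<open>
  Finite simple undirected graphs are those satisfying \<^const>\<open>pair_graph\<close>: an undirected
  edge between \<open>u\<close> and \<open>v\<close> is the pair of arcs \<open>(u, v)\<close> and \<open>(v, u)\<close>.
\<close>

definition partial_grundy_coloring ::
    "'a pair_pre_digraph \<Rightarrow> nat \<Rightarrow> ('a \<Rightarrow> nat) \<Rightarrow> bool" where
  "partial_grundy_coloring G k' c \<longleftrightarrow>
     0 < k' \<and>
     (\<forall>v\<in>pverts G. c v \<in> {1..k'}) \<and>
     (\<forall>u v. (u, v) \<in> parcs G \<longrightarrow> c u \<noteq> c v) \<and>
     (\<forall>i\<in>{1..k'}. \<exists>v\<in>pverts G. c v = i \<and>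
        (\<forall>j\<in>{1..i - 1}. \<exists>u\<in>pverts G. (v, u) \<in> parcs G \<and> c u = j))"

definition admits_partial_grundy :: "'a pair_pre_digraph \<Rightarrow> nat \<Rightarrow> bool" where
  "admits_partial_grundy G k \<longleftrightarrow> (\<exists>k'\<ge>k. \<exists>c. partial_grundy_coloring G k' c)"


section \<open>Algorithms and their running time\<close>

text \<open>
  Algorithms are deterministic programs for a uniform-cost random access machine, written as
  structured programs.  A program text mentions finitely many variables and arrays, which hold
  natural numbers.  The only arithmetic is addition and truncated subtraction: multiplication at
  unit cost would make the machine stronger than polynomial time, whereas with addition the bit
  length of the numbers grows by at most a constant per step, so that running times agree with
  those of Turing machines up to a polynomial.
\<close>

type_synonym vname = string
type_synonym aname = string

datatype aexp =
    Const nat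
  | Var vname
  | Read aname aexp
  | Plus aexp aexp
  | Monus aexp aexp

datatype com =
    Skip
  | Assign vname aexp
  | Write aname aexp aexp
  | Seq com com
  | If aexp com com
  | While aexp com

type_synonym state = "(vname \<Rightarrow> nat) \<times> (aname \<Rightarrow> nat \<Rightarrow> nat)"

fun aval :: "aexp \<Rightarrow> state \<Rightarrow> nat" where
  "aval (Const m) s = m"
| "aval (Var x) s = fst s x"
| "aval (Read a e) s = snd s a (aval e s)"
| "aval (Plus e1 e2) s = aval e1 s + aval e2 s"
| "aval (Monus e1 e2) s = aval e1 s - aval e2 s"

fun acost :: "aexp \<Rightarrow> nat" where
  "acost (Const m) = 1"
| "acost (Var x) = 1"
| "acost (Read a e) = 1 + acost e"
| "acost (Plus e1 e2) = 1 + acost e1 + acost e2"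
| "acost (Monus e1 e2) = 1 + acost e1 + acost e2"

text \<open>
  \<open>exec P s t s'\<close>: started in state \<open>s\<close>, the program \<open>P\<close> halts in state \<open>s'\<close> after exactly \<open>t\<close>
  elementary steps.  Tests are true iff their value is nonzero.
\<close>

inductive exec :: "com \<Rightarrow> state \<Rightarrow> nat \<Rightarrow> state \<Rightarrow> bool" where
  Skip: "exec Skip s 1 s"
| Assign: "exec (Assign x e) (vs, as) (1 + acost e) (vs(x := aval e (vs, as)), as)"
| Write: "exec (Write a e1 e2) (vs, as) (1 + acost e1 + acost e2)
            (vs, as(a := (as a)(aval e1 (vs, as) := aval e2 (vs, as))))"
| Seq: "exec P s t s' \<Longrightarrow> exec Q s' t' s'' \<Longrightarrow> exec (Seq P Q) s (t + t') s''"
| IfTrue: "aval e s \<noteq> 0 \<Longrightarrow> exec P s t s' \<Longrightarrow> exec (If e P Q) s (1 + acost e + t) s'"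
| IfFalse: "aval e s = 0 \<Longrightarrow> exec Q s t s' \<Longrightarrow> exec (If e P Q) s (1 + acost e + t) s'"
| WhileTrue: "aval e s \<noteq> 0 \<Longrightarrow> exec P s t s' \<Longrightarrow> exec (While e P) s' t' s'' \<Longrightarrow>
    exec (While e P) s (1 + acost e + t + t') s''"
| WhileFalse: "aval e s = 0 \<Longrightarrow> exec (While e P) s (1 + acost e) s"

lemma exec_deterministic:
  "exec P s t s' \<Longrightarrow> exec P s u r \<Longrightarrow> u = t \<and> r = s'"
proof (induction arbitrary: u r rule: exec.induct)
  case (Skip s)
  from Skip.prems show ?case by cases simp
next
  case (Assign x e vs as)
  from Assign.prems show ?case by cases simp
next
  case (Write a e1 e2 vs as)
  from Write.prems show ?case by cases simp
next
  case (Seq P s t s' Q t' s'')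
  from Seq.prems obtain t1 s1 t2 where *: "exec P s t1 s1" "exec Q s1 t2 r" "u = t1 + t2"
    by cases simp
  from Seq.IH(1)[OF *(1)] Seq.IH(2) * show ?case by metis
next
  case (IfTrue e s P t s' Q)
  from IfTrue.prems IfTrue.hyps(1) obtain t1 where *: "exec P s t1 r" "u = 1 + acost e + t1"
    by cases simp_all
  from IfTrue.IH[OF *(1)] *(2) show ?case by simp
next
  case (IfFalse e s Q t s' P)
  from IfFalse.prems IfFalse.hyps(1) obtain t1 where *: "exec Q s t1 r" "u = 1 + acost e + t1"
    by cases simp_all
  from IfFalse.IH[OF *(1)] *(2) show ?case by simp
next
  case (WhileTrue e s P t s' t' s'')
  from WhileTrue.prems WhileTrue.hyps(1) obtain t1 s1 t2 where
    *: "exec P s t1 s1" "exec (While e P) s1 t2 r" "u = 1 + acost e + t1 + t2"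
    by cases simp_all
  from WhileTrue.IH(1)[OF *(1)] WhileTrue.IH(2) * show ?case by metis
next
  case (WhileFalse e s P)
  from WhileFalse.prems WhileFalse.hyps show ?case by cases simp_all
qed


section \<open>Instances\<close>

text \<open>
  An input graph has vertex set \<open>{..<n}\<close> and is given by its adjacency matrix, stored row by row.
  All memory not used for the input is initially zero.
\<close>

definition input_state :: "nat pair_pre_digraph \<Rightarrow> nat \<Rightarrow> nat \<Rightarrow> state" where
  "input_state G n k =
     ((\<lambda>_. 0)(''n'' := n, ''k'' := k),
      (\<lambda>_ _. 0)(''adj'' := (\<lambda>i. if i < n * n \<and> (i div n, i mod n) \<in> parcs G then 1 else 0)))"

definition accepting :: "state \<Rightarrow> bool" where
  "accepting s \<longleftrightarrow> fst s ''result'' = 1"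

definition rejecting :: "state \<Rightarrow> bool" where
  "rejecting s \<longleftrightarrow> fst s ''result'' = 0"

definition decides_partial_grundy_within :: "com \<Rightarrow> (nat \<Rightarrow> nat \<Rightarrow> nat) \<Rightarrow> bool" where
  "decides_partial_grundy_within P T \<longleftrightarrow>
     (\<forall>G n k. pair_graph G \<longrightarrow> pverts G = {..<n} \<longrightarrow> 0 < k \<longrightarrow>
        (\<exists>t s'. exec P (input_state G n k) t s' \<and> t \<le> T n k \<and>
           (if admits_partial_grundy G k then accepting s' else rejecting s')))"

end

theory Submission
  imports Defs
begin

text \<open>
  A partial Grundy coloring with at least \<open>k\<close> colors exists iff there is a certificate of at most
  \<open>k\<^sup>2\<close> vertices \<open>x i j\<close> (\<open>x i j\<close> has color \<open>j\<close>, and \<open>x i i\<close> is adjacent to \<open>x i j\<close> for \<open>j < i\<close>); the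
  other vertices can then be colored greedily.

  If there is no certificate, then every family of vertices whose neighborhoods pairwise differ in more
  than \<open>d = 2 ^ (11 * k\<^sup>2)\<close> places has at most \<open>2 ^ (35 * k ^ 3)\<close> members.  Indeed, every large set contains
  a large set \<open>X\<close> such that each vertex is adjacent to all or to only a tiny fraction of \<open>X\<close>, since otherwise
  repeated splitting yields a half graph, hence a certificate.  Applied to the family, this gives many
  stars \<open>a\<^sub>i\<close> with large leaf sets \<open>B\<^sub>i\<close> such that \<open>B\<^sub>i\<close> misses all later centers; applied to the \<open>B\<^sub>i\<close>, it makes
  any two of them complete to each other or sparsely joined.  By Ramsey's theorem there is
  a clique of size \<open>k\<close> or there are \<open>k\<close> stars whose leaves can be chosen independent.

  Hence, unless the answer is yes, a greedy maximal separated family gives \<open>2 ^ O(k ^ 3)\<close> classes of vertices with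
  almost equal neighborhoods.  Two large classes are almost complete or almost anticomplete
  to each other, with at most \<open>3 * d\<close> exceptions per vertex.  Fix a certificate and link two of its
  vertices, in large classes, if they form an exceptional pair.  A linked component is determined by its root
  and, for each other vertex, its index among the exceptions of its parent.  Recording also the index of
  the parent among the exceptions of the child makes the map from roots to copies of any given vertex
  injective, so few roots are spoiled by the rest of the certificate, and by
  exchange one may assume that each root is among the first few admissible ones.  The certificate is thus
  described by \<open>O(k\<^sup>2)\<close> numbers of \<open>O(k ^ 3)\<close> bits, and the algorithm tries all \<open>2 ^ O(k ^ 5)\<close> descriptions.
\<close>

section \<open>Functions computable in polynomial time relative to a budget\<close>

type_synonym inst = "nat \<times> nat \<times> (nat \<Rightarrow> nat)"

definition order_of :: "inst \<Rightarrow> nat" where "order_of I = fst I"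
definition colors_of :: "inst \<Rightarrow> nat" where "colors_of I = fst (snd I)"
definition matrix_of :: "inst \<Rightarrow> nat \<Rightarrow> nat" where "matrix_of I = snd (snd I)"

text \<open>
  The number of descriptions to be tried is itself polynomial in this quantity, so that a single notion of
  polynomial time covers both the exponential enumeration and the polynomial work per description.
\<close>

definition budget :: "inst \<Rightarrow> nat" where
  "budget I = 2 ^ (colors_of I ^ 5) * (order_of I + 2)"

text \<open>Strings of \<open>v\<close> of different lengths form an unlimited supply of variable
  names that avoids the input variables \<open>n\<close> and \<open>k\<close>.\<close>

definition reg :: "nat \<Rightarrow> vname" where "reg i = replicate (Suc i) (CHR ''v'')"

lemma reg_inj [simp]: "reg i = reg j \<longleftrightarrow> i = j"
  by (auto simp: reg_def dest: arg_cong[where f = length])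

lemma reg_neq [simp]:
  "reg i \<noteq> ''n''" "''n'' \<noteq> reg i" "reg i \<noteq> ''k''" "''k'' \<noteq> reg i"
  by (auto simp: reg_def)

text \<open>Positivity of the number of colors is carried along because \<open>poly_bounded\<close>
  bounds loops for such instances only.\<close>

definition loaded :: "('x \<Rightarrow> inst) \<Rightarrow> nat list \<Rightarrow> ('x \<Rightarrow> nat) list \<Rightarrow> 'x \<Rightarrow> state \<Rightarrow> bool" where
  "loaded \<iota> ps es x s \<longleftrightarrow> 0 < colors_of (\<iota> x) \<and>
     fst s ''n'' = order_of (\<iota> x) \<and> fst s ''k'' = colors_of (\<iota> x) \<and> snd s ''adj'' = matrix_of (\<iota> x) \<and>
     list_all2 (\<lambda>p e. fst s (reg p) = e x) ps es"

text \<open>All arrays stay unchanged, so compound data must be coded in single numbers held by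
  variables. Code placed at \<open>l\<close> may overwrite the registers from \<open>l\<close>
  on.\<close>

definition preserved :: "nat \<Rightarrow> state \<Rightarrow> state \<Rightarrow> bool" where
  "preserved l s s' \<longleftrightarrow> snd s' = snd s \<and> fst s' ''n'' = fst s ''n'' \<and> fst s' ''k'' = fst s ''k'' \<and>
     (\<forall>j<l. fst s' (reg j) = fst s (reg j))"

definition runs :: "com \<Rightarrow> inst \<Rightarrow> nat \<Rightarrow> state \<Rightarrow> state \<Rightarrow> bool" where
  "runs P I c s s' \<longleftrightarrow> (\<exists>t. exec P s t s' \<and> t \<le> budget I ^ c)"

text \<open>
  A context \<open>'x\<close> provides an instance by \<open>\<iota>\<close> and the values \<open>es\<close> of the variables in scope.
  Since \<open>ps\<close> and \<open>l\<close> are arbitrary, the code for \<open>f\<close> can be placed anywhere, which yields weakening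
  without a renaming argument.
\<close>

definition ptime :: "('x \<Rightarrow> inst) \<Rightarrow> ('x \<Rightarrow> nat) list \<Rightarrow> ('x \<Rightarrow> nat) \<Rightarrow> bool" where
  "ptime \<iota> es f \<longleftrightarrow> (\<forall>ps l. (\<forall>p\<in>set ps. p < l) \<longrightarrow>
     (\<exists>P c. \<forall>x s. loaded \<iota> ps es x s \<longrightarrow>
        (\<exists>s'. runs P (\<iota> x) c s s' \<and> fst s' (reg l) = f x \<and> preserved l s s')))"

section \<open>Bounds by powers of the budget\<close>

lemma budget_ge: "2 \<le> budget I"
  using one_le_power[of "2::nat" "colors_of I ^ 5"] mult_le_mono[of 1 "2 ^ (colors_of I ^ 5)" 2 "order_of I + 2"]
  by (simp add: budget_def)

lemma budget_mono: "a \<le> b \<Longrightarrow> budget I ^ a \<le> budget I ^ b"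
  using budget_ge[of I] by (intro power_increasing) auto

lemma budget_ge_pow: "2 ^ c \<le> budget I ^ c"
  by (rule power_mono[OF budget_ge]) simp

text \<open>The budget is at least 2, so one more factor of it absorbs the doubling.\<close>

lemma budget_add: "a \<le> budget I ^ c \<Longrightarrow> b \<le> budget I ^ d \<Longrightarrow> a + b \<le> budget I ^ Suc (max c d)"
proof -
  assume "a \<le> budget I ^ c" "b \<le> budget I ^ d"
  moreover have "budget I ^ c \<le> budget I ^ max c d" "budget I ^ d \<le> budget I ^ max c d"
    by (auto intro: budget_mono)
  ultimately have "a + b \<le> 2 * budget I ^ max c d" by linarith
  also have "\<dots> \<le> budget I * budget I ^ max c d" using budget_ge by (intro mult_right_mono) auto
  finally show ?thesis by simp
qed

lemma budget_mult: "a \<le> budget I ^ c \<Longrightarrow> b \<le> budget I ^ d \<Longrightarrow> a * b \<le> budget I ^ (c + d)"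
  by (simp add: power_add mult_le_mono)

lemma budget_const: "a \<le> budget I ^ a"
  using budget_ge_pow[of a I] less_exp[of a] by (meson le_trans less_imp_le)

section \<open>Costs of the program constructs\<close>

lemma runs_mono: "runs P I c s s' \<Longrightarrow> c \<le> d \<Longrightarrow> runs P I d s s'"
  unfolding runs_def using budget_mono le_trans by blast

lemma runs_Assign:
  "runs (Assign y e) I (1 + acost e) s ((fst s)(y := aval e s), snd s)"
  unfolding runs_def using exec.Assign[of y e "fst s" "snd s"] budget_const[of "1 + acost e" I]
  by fastforce

lemma runs_Seq: "runs P I c s s' \<Longrightarrow> runs Q I d s' s'' \<Longrightarrow> runs (Seq P Q) I (Suc (max c d)) s s''"
  unfolding runs_def by (meson exec.Seq budget_add)

lemma runs_If:
  assumes "aval e s \<noteq> 0 \<Longrightarrow> runs P I c s s'" "aval e s = 0 \<Longrightarrow> runs Q I c s s'"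
  shows "runs (If e P Q) I (Suc (max (1 + acost e) c)) s s'"
proof (cases "aval e s = 0")
  case True
  then obtain t where "exec Q s t s'" "t \<le> budget I ^ c" using assms unfolding runs_def by blast
  with True show ?thesis unfolding runs_def
    using exec.IfFalse[of e s Q t s' P] budget_add[OF budget_const[of "1 + acost e" I]] by blast
next
  case False
  then obtain t where "exec P s t s'" "t \<le> budget I ^ c" using assms unfolding runs_def by blast
  with False show ?thesis unfolding runs_def
    using exec.IfTrue[of e s P t s' Q] budget_add[OF budget_const[of "1 + acost e" I]] by blast
qed

text \<open>The invariant \<open>J\<close> is indexed by the number of completed rounds. As there
  are exactly \<open>N\<close> rounds, the cost is a product of two powers of the budget plus the
  constant cost of the tests.\<close>

lemma runs_While:
  assumes step: "\<And>i s. i < N \<Longrightarrow> J i s \<Longrightarrow> aval e s \<noteq> 0 \<and> (\<exists>s'. runs P I c s s' \<and> J (Suc i) s')"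
    and stop: "\<And>s. J N s \<Longrightarrow> aval e s = 0"
    and init: "J 0 s" and N: "N \<le> budget I ^ d"
  shows "\<exists>s'. runs (While e P) I (d + acost e + c + 5) s s' \<and> J N s'"
proof -
  \<comment> \<open>The induction is on the number \<open>j\<close> of remaining rounds, because
    \<open>WhileTrue\<close> peels off the first round.\<close>
  have "\<exists>t s'. exec (While e P) s t s' \<and> t \<le> j * (1 + acost e + budget I ^ c) + (1 + acost e) \<and> J N s'"
    if "j \<le> N" "J (N - j) s" for j s
    using that
  proof (induction j arbitrary: s)
    case 0
    then show ?case using exec.WhileFalse[of e s P] stop[of s] by fastforce
  next
    case (Suc j)
    from step[of "N - Suc j" s] Suc.prems obtain s1 t where
      *: "aval e s \<noteq> 0" "exec P s t s1" "t \<le> budget I ^ c" "J (Suc (N - Suc j)) s1"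
      unfolding runs_def by auto
    then have "J (N - j) s1" using Suc.prems by (simp add: Suc_diff_Suc)
    then obtain t' s' where **: "exec (While e P) s1 t' s'"
      "t' \<le> j * (1 + acost e + budget I ^ c) + (1 + acost e)" "J N s'"
      using Suc.IH[of s1] Suc.prems by auto
    have "exec (While e P) s (1 + acost e + t + t') s'" by (rule exec.WhileTrue[OF *(1,2) **(1)])
    then show ?case using *(3) **(2,3) by fastforce
  qed
  from this[of N s] init obtain t s' where
    "exec (While e P) s t s'" "t \<le> N * (1 + acost e + budget I ^ c) + (1 + acost e)" "J N s'" by auto
  moreover have "N * (1 + acost e + budget I ^ c) + (1 + acost e) \<le> budget I ^ (d + acost e + c + 5)"
  proof -
    have "1 + acost e + budget I ^ c \<le> budget I ^ Suc (max (1 + acost e) c)"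
      by (rule budget_add[OF budget_const]) simp
    from budget_add[OF budget_mult[OF N this] budget_const[of "1 + acost e"]]
    show ?thesis by (rule le_trans) (rule budget_mono, simp)
  qed
  ultimately show ?thesis unfolding runs_def using le_trans by blast
qed

lemma preserved_trans: "preserved l s s' \<Longrightarrow> preserved l' s' s'' \<Longrightarrow> l \<le> l' \<Longrightarrow> preserved l s s''"
  by (simp add: preserved_def)

lemma preserved_upd: "l \<le> j \<Longrightarrow> preserved l s ((fst s)(reg j := a), snd s)"
  by (simp add: preserved_def)

lemma loaded_preserved:
  assumes "loaded \<iota> ps es x s" "preserved l s s'" "\<forall>p\<in>set ps. p < l"
  shows "loaded \<iota> ps es x s'"
  using assms unfolding loaded_def preserved_def
  by (auto simp: list_all2_conv_all_nth)

lemma ptime_E: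
  assumes "ptime \<iota> es f" "\<forall>p\<in>set ps. p < l"
  obtains P c where "\<And>x s. loaded \<iota> ps es x s \<Longrightarrow>
    \<exists>s'. runs P (\<iota> x) c s s' \<and> fst s' (reg l) = f x \<and> preserved l s s'"
  using assms unfolding ptime_def by metis

lemma ptime_aexp:
  assumes "\<And>ps. \<exists>e. \<forall>x s. loaded \<iota> ps es x s \<longrightarrow> aval e s = f x"
  shows "ptime \<iota> es f"
  unfolding ptime_def
proof (intro allI impI)
  fix ps and l :: nat assume "\<forall>p\<in>set ps. p < l"
  obtain e where e: "\<And>x s. loaded \<iota> ps es x s \<Longrightarrow> aval e s = f x" using assms[of ps] by blast
  have "runs (Assign (reg l) e) (\<iota> x) (1 + acost e) s ((fst s)(reg l := f x), snd s)"
    if "loaded \<iota> ps es x s" for x s using runs_Assign[of "reg l" e "\<iota> x" s] e[OF that] by simp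
  then show "\<exists>P c. \<forall>x s. loaded \<iota> ps es x s \<longrightarrow>
      (\<exists>s'. runs P (\<iota> x) c s s' \<and> fst s' (reg l) = f x \<and> preserved l s s')"
    using preserved_upd[of l l] by (intro exI[of _ "Assign (reg l) e"] exI[of _ "1 + acost e"]) fastforce
qed

lemma ptime_const: "ptime \<iota> es (\<lambda>x. a)"
  by (rule ptime_aexp) (auto intro: exI[of _ "Const a"])

lemma ptime_order: "ptime \<iota> es (\<lambda>x. order_of (\<iota> x))"
  by (rule ptime_aexp) (auto simp: loaded_def intro!: exI[of _ "Var ''n''"])

lemma ptime_colors: "ptime \<iota> es (\<lambda>x. colors_of (\<iota> x))"
  by (rule ptime_aexp) (auto simp: loaded_def intro!: exI[of _ "Var ''k''"])

lemma ptime_var: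
  assumes "f \<in> set es" shows "ptime \<iota> es f"
proof (rule ptime_aexp)
  fix ps
  obtain i where i: "i < length es" "es ! i = f" using assms by (auto simp: in_set_conv_nth)
  then have "aval (Var (reg (ps ! i))) s = f x" if "loaded \<iota> ps es x s" for x s
    using that by (auto simp: loaded_def list_all2_conv_all_nth)
  then show "\<exists>e. \<forall>x s. loaded \<iota> ps es x s \<longrightarrow> aval e s = f x" by blast
qed

text \<open>The first operand waits in register \<open>l\<close> while the second is computed in
  \<open>Suc l\<close>; code placed at \<open>Suc l\<close> cannot destroy it.\<close>

lemma ptime_binary_aexp:
  assumes f: "ptime \<iota> es f" and g: "ptime \<iota> es g"
    and h: "\<And>l s x. loaded \<iota> [l, Suc l] [f, g] x s \<Longrightarrow> aval (e l) s = h x"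
  shows "ptime \<iota> es h"
  unfolding ptime_def
proof (intro allI impI)
  fix ps and l :: nat assume ps: "\<forall>p\<in>set ps. p < l"
  then have ps': "\<forall>p\<in>set ps. p < Suc l" by auto
  obtain P c where P: "\<And>x s. loaded \<iota> ps es x s \<Longrightarrow>
    \<exists>s'. runs P (\<iota> x) c s s' \<and> fst s' (reg l) = f x \<and> preserved l s s'"
    using ptime_E[OF f ps] by blast
  obtain Q d where Q: "\<And>x s. loaded \<iota> ps es x s \<Longrightarrow>
    \<exists>s'. runs Q (\<iota> x) d s s' \<and> fst s' (reg (Suc l)) = g x \<and> preserved (Suc l) s s'"
    using ptime_E[OF g ps'] by blast
  let ?R = "Assign (reg l) (e l)"
  have "\<exists>s'. runs (Seq P (Seq Q ?R)) (\<iota> x) (Suc (max c (Suc (max d (1 + acost (e l)))))) s s' \<and>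
      fst s' (reg l) = h x \<and> preserved l s s'" if ld: "loaded \<iota> ps es x s" for x s
  proof -
    obtain s1 where s1: "runs P (\<iota> x) c s s1" "fst s1 (reg l) = f x" "preserved l s s1"
      using P[OF ld] by blast
    have l1: "loaded \<iota> ps es x s1" by (rule loaded_preserved[OF ld s1(3) ps])
    obtain s2 where s2: "runs Q (\<iota> x) d s1 s2" "fst s2 (reg (Suc l)) = g x" "preserved (Suc l) s1 s2"
      using Q[OF l1] by blast
    have "loaded \<iota> ps es x s2" by (rule loaded_preserved[OF l1 s2(3) ps'])
    moreover have "fst s2 (reg l) = f x" using s1(2) s2(3) by (simp add: preserved_def)
    ultimately have "loaded \<iota> [l, Suc l] [f, g] x s2" using s2(2) by (simp add: loaded_def)
    then have e: "aval (e l) s2 = h x" by (rule h)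
    have "preserved l s s2" using s1(3) s2(3) by (rule preserved_trans) simp
    then have "preserved l s ((fst s2)(reg l := h x), snd s2)"
      by (rule preserved_trans[OF _ preserved_upd[of l l]]) auto
    then show ?thesis
      using runs_Seq[OF s1(1) runs_Seq[OF s2(1) runs_Assign[of "reg l" "e l" "\<iota> x" s2]]]
      by (intro exI[of _ "((fst s2)(reg l := h x), snd s2)"]) (auto simp: e)
  qed
  then show "\<exists>P c. \<forall>x s. loaded \<iota> ps es x s \<longrightarrow>
      (\<exists>s'. runs P (\<iota> x) c s s' \<and> fst s' (reg l) = h x \<and> preserved l s s')" by blast
qed

lemma ptime_plus: "ptime \<iota> es f \<Longrightarrow> ptime \<iota> es g \<Longrightarrow> ptime \<iota> es (\<lambda>x. f x + g x)"
  by (rule ptime_binary_aexp[where f = f and g = g and e = "\<lambda>l. Plus (Var (reg l)) (Var (reg (Suc l)))"])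
    (auto simp: loaded_def)

lemma ptime_minus: "ptime \<iota> es f \<Longrightarrow> ptime \<iota> es g \<Longrightarrow> ptime \<iota> es (\<lambda>x. f x - g x)"
  by (rule ptime_binary_aexp[where f = f and g = g and e = "\<lambda>l. Monus (Var (reg l)) (Var (reg (Suc l)))"])
    (auto simp: loaded_def)

lemma ptime_matrix: "ptime \<iota> es f \<Longrightarrow> ptime \<iota> es (\<lambda>x. matrix_of (\<iota> x) (f x))"
  by (rule ptime_binary_aexp[where e = "\<lambda>l. Read ''adj'' (Var (reg l))" and f = f and g = f])
    (auto simp: loaded_def)

lemma ptime_if:
  assumes b: "ptime \<iota> es b" and f: "ptime \<iota> es f" and g: "ptime \<iota> es g"
  shows "ptime \<iota> es (\<lambda>x. if b x \<noteq> 0 then f x else g x)"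
  unfolding ptime_def
proof (intro allI impI)
  fix ps and l :: nat assume ps: "\<forall>p\<in>set ps. p < l"
  obtain B c where B: "\<And>x s. loaded \<iota> ps es x s \<Longrightarrow>
    \<exists>s'. runs B (\<iota> x) c s s' \<and> fst s' (reg l) = b x \<and> preserved l s s'"
    using ptime_E[OF b ps] by blast
  obtain P d where P: "\<And>x s. loaded \<iota> ps es x s \<Longrightarrow>
    \<exists>s'. runs P (\<iota> x) d s s' \<and> fst s' (reg l) = f x \<and> preserved l s s'"
    using ptime_E[OF f ps] by blast
  obtain Q d' where Q: "\<And>x s. loaded \<iota> ps es x s \<Longrightarrow>
    \<exists>s'. runs Q (\<iota> x) d' s s' \<and> fst s' (reg l) = g x \<and> preserved l s s'"
    using ptime_E[OF g ps] by blast
  let ?e = "Var (reg l)"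
  have "\<exists>s'. runs (Seq B (If ?e P Q)) (\<iota> x) (Suc (max c (Suc (max (1 + acost ?e) (max d d'))))) s s' \<and>
      fst s' (reg l) = (if b x \<noteq> 0 then f x else g x) \<and> preserved l s s'" if ld: "loaded \<iota> ps es x s" for x s
  proof -
    obtain s1 where s1: "runs B (\<iota> x) c s s1" "fst s1 (reg l) = b x" "preserved l s s1"
      using B[OF ld] by blast
    have l1: "loaded \<iota> ps es x s1" by (rule loaded_preserved[OF ld s1(3) ps])
    have "\<exists>s'. (if b x \<noteq> 0 then runs P (\<iota> x) d s1 s' else runs Q (\<iota> x) d' s1 s') \<and>
        fst s' (reg l) = (if b x \<noteq> 0 then f x else g x) \<and> preserved l s1 s'"
      using P[OF l1] Q[OF l1] by (cases "b x = 0") auto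
    then obtain s2 where s2: "if b x \<noteq> 0 then runs P (\<iota> x) d s1 s2 else runs Q (\<iota> x) d' s1 s2"
        "fst s2 (reg l) = (if b x \<noteq> 0 then f x else g x)" "preserved l s1 s2" by blast
    have "runs (If ?e P Q) (\<iota> x) (Suc (max (1 + acost ?e) (max d d'))) s1 s2"
      by (rule runs_If) (use s1(2) s2(1) in \<open>auto split: if_splits elim: runs_mono\<close>)
    then show ?thesis using runs_Seq[OF s1(1)] s2 preserved_trans[OF s1(3) s2(3)] by blast
  qed
  then show "\<exists>P c. \<forall>x s. loaded \<iota> ps es x s \<longrightarrow>
      (\<exists>s'. runs P (\<iota> x) c s s' \<and> fst s' (reg l) = (if b x \<noteq> 0 then f x else g x) \<and> preserved l s s')"
    by blast
qed

text \<open>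
  Loop bounds are functions of the instance alone, because \<open>ptime\<close> quantifies over all contexts, including values of
  loop variables that never occur in a run.
\<close>

definition poly_bounded :: "(inst \<Rightarrow> nat) \<Rightarrow> bool" where
  "poly_bounded N \<longleftrightarrow> (\<exists>d. \<forall>I. 0 < colors_of I \<longrightarrow> N I \<le> budget I ^ d)"

lemma ptime_rec:
  assumes N: "ptime \<iota> es (\<lambda>x. N (\<iota> x))" and bd: "poly_bounded N" and f: "ptime \<iota> es f"
    and g: "ptime (\<lambda>y. \<iota> (fst y)) ((\<lambda>y. fst (snd y)) # (\<lambda>y. snd (snd y)) # map (\<lambda>e y. e (fst y)) es)
              (\<lambda>y. g (fst y) (fst (snd y)) (snd (snd y)))"
  shows "ptime \<iota> es (\<lambda>x. rec_nat (f x) (g x) (N (\<iota> x)))"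
  unfolding ptime_def
proof (intro allI impI)
  fix ps and l :: nat assume ps: "\<forall>p\<in>set ps. p < l"
  then have ps1: "\<forall>p\<in>set ps. p < Suc l" and ps2: "\<forall>p\<in>set ((l + 2) # Suc l # ps). p < l + 3" by auto
  obtain P c where P: "\<And>x s. loaded \<iota> ps es x s \<Longrightarrow>
    \<exists>s'. runs P (\<iota> x) c s s' \<and> fst s' (reg l) = N (\<iota> x) \<and> preserved l s s'"
    using ptime_E[OF N ps] by blast
  obtain Q c' where Q: "\<And>x s. loaded \<iota> ps es x s \<Longrightarrow>
    \<exists>s'. runs Q (\<iota> x) c' s s' \<and> fst s' (reg (Suc l)) = f x \<and> preserved (Suc l) s s'"
    using ptime_E[OF f ps1] by blast
  obtain B b where B: "\<And>y s. loaded (\<lambda>y. \<iota> (fst y)) ((l + 2) # Suc l # ps)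
      ((\<lambda>y. fst (snd y)) # (\<lambda>y. snd (snd y)) # map (\<lambda>e y. e (fst y)) es) y s \<Longrightarrow>
    \<exists>s'. runs B (\<iota> (fst y)) b s s' \<and> fst s' (reg (l + 3)) = g (fst y) (fst (snd y)) (snd (snd y)) \<and>
      preserved (l + 3) s s'"
    using ptime_E[OF g ps2] by blast
  obtain d where d: "\<And>I. 0 < colors_of I \<Longrightarrow> N I \<le> budget I ^ d" using bd by (auto simp: poly_bounded_def)
  let ?r = "\<lambda>x i. rec_nat (f x) (g x) i"
  let ?A = "Assign (reg (l + 2)) (Const 0)"
  let ?e = "Monus (Var (reg l)) (Var (reg (l + 2)))"
  let ?C = "Assign (reg (Suc l)) (Var (reg (l + 3)))"
  let ?D = "Assign (reg (l + 2)) (Plus (Var (reg (l + 2))) (Const 1))"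
  let ?w = "While ?e (Seq B (Seq ?C ?D))"
  let ?F = "Assign (reg l) (Var (reg (Suc l)))"
  define cb where "cb = Suc (max b (Suc (max 2 4)))"
  define cw where "cw = d + acost ?e + cb + 5"
  have main: "\<exists>s'. runs (Seq P (Seq Q (Seq ?A (Seq ?w ?F)))) (\<iota> x)
       (Suc (max c (Suc (max c' (Suc (max 2 (Suc (max cw 2)))))))) s s' \<and>
      fst s' (reg l) = ?r x (N (\<iota> x)) \<and> preserved l s s'" if ld: "loaded \<iota> ps es x s" for x s
  proof -
    obtain s1 where s1: "runs P (\<iota> x) c s s1" "fst s1 (reg l) = N (\<iota> x)" "preserved l s s1"
      using P[OF ld] by blast
    have l1: "loaded \<iota> ps es x s1" by (rule loaded_preserved[OF ld s1(3) ps])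
    obtain s2 where s2: "runs Q (\<iota> x) c' s1 s2" "fst s2 (reg (Suc l)) = f x" "preserved (Suc l) s1 s2"
      using Q[OF l1] by blast
    have l2: "loaded \<iota> ps es x s2" by (rule loaded_preserved[OF l1 s2(3) ps1])
    define s3 where "s3 = ((fst s2)(reg (l + 2) := 0), snd s2)"
    have s3: "runs ?A (\<iota> x) 2 s2 s3" using runs_Assign[of "reg (l + 2)" "Const 0" "\<iota> x" s2] by (simp add: s3_def numeral_2_eq_2)
    \<comment> \<open>Register \<open>l\<close> holds the bound, \<open>Suc l\<close> the
      accumulator and \<open>l + 2\<close> the counter; the body delivers its result in
      \<open>l + 3\<close>.\<close>
    define J where "J = (\<lambda>i s'. fst s' (reg l) = N (\<iota> x) \<and> fst s' (reg (Suc l)) = ?r x i \<and>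
       fst s' (reg (l + 2)) = i \<and> preserved l s s')"
    have i0: "J 0 s3" using s1 s2 unfolding J_def s3_def preserved_def by simp
    have "\<exists>s'. runs ?w (\<iota> x) (d + acost ?e + cb + 5) s3 s' \<and> J (N (\<iota> x)) s'"
    proof (rule runs_While[where J = J, OF _ _ i0])
      show "N (\<iota> x) \<le> budget (\<iota> x) ^ d" using d ld by (simp add: loaded_def)
      show "aval ?e s' = 0" if "J (N (\<iota> x)) s'" for s' using that by (simp add: J_def)
      fix i s' assume i: "i < N (\<iota> x)" and iv: "J i s'"
      have "preserved l s s'" using iv by (simp add: J_def)
      then have "loaded \<iota> ps es x s'" using loaded_preserved[OF ld _ ps] by blast
      then have "loaded (\<lambda>y. \<iota> (fst y)) ((l + 2) # Suc l # ps)
        ((\<lambda>y. fst (snd y)) # (\<lambda>y. snd (snd y)) # map (\<lambda>e y. e (fst y)) es) (x, i, ?r x i) s'"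
        using iv by (simp add: loaded_def J_def list_all2_map2)
      from B[OF this] obtain s4 where s4: "runs B (\<iota> x) b s' s4" "fst s4 (reg (l + 3)) = g x i (?r x i)"
        "preserved (l + 3) s' s4" by auto
      define s5 where "s5 = ((fst s4)(reg (Suc l) := g x i (?r x i)), snd s4)"
      have s5: "runs ?C (\<iota> x) 2 s4 s5"
        using runs_Assign[of "reg (Suc l)" "Var (reg (l + 3))" "\<iota> x" s4] s4(2) by (simp add: s5_def numeral_2_eq_2)
      define s6 where "s6 = ((fst s5)(reg (l + 2) := Suc i), snd s5)"
      have "fst s5 (reg (l + 2)) = i" using s4(3) iv by (simp add: s5_def J_def preserved_def)
      then have s6: "runs ?D (\<iota> x) 4 s5 s6"
        using runs_Assign[of "reg (l + 2)" "Plus (Var (reg (l + 2))) (Const 1)" "\<iota> x" s5]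
        by (simp add: s6_def numeral_eq_Suc)
      have "J (Suc i) s6" using s4 iv unfolding J_def s6_def s5_def preserved_def by simp
      moreover have "runs (Seq B (Seq ?C ?D)) (\<iota> x) cb s' s6"
        unfolding cb_def by (rule runs_Seq[OF s4(1) runs_Seq[OF s5 s6]])
      moreover have "aval ?e s' \<noteq> 0" using i iv by (simp add: J_def)
      ultimately show "aval ?e s' \<noteq> 0 \<and> (\<exists>s''. runs (Seq B (Seq ?C ?D)) (\<iota> x) cb s' s'' \<and> J (Suc i) s'')"
        by blast
    qed
    then obtain s7 where s7: "runs ?w (\<iota> x) cw s3 s7" "J (N (\<iota> x)) s7" unfolding cw_def by blast
    define s8 where "s8 = ((fst s7)(reg l := ?r x (N (\<iota> x))), snd s7)"
    have s8: "runs ?F (\<iota> x) 2 s7 s8"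
      using runs_Assign[of "reg l" "Var (reg (Suc l))" "\<iota> x" s7] s7(2) by (simp add: s8_def J_def numeral_2_eq_2)
    have "preserved l s s8" using s7(2) unfolding J_def s8_def preserved_def by simp
    then show ?thesis
      using runs_Seq[OF s1(1) runs_Seq[OF s2(1) runs_Seq[OF s3 runs_Seq[OF s7(1) s8]]]]
      by (intro exI[of _ s8]) (simp add: s8_def)
  qed
  then show "\<exists>P c. \<forall>x s. loaded \<iota> ps es x s \<longrightarrow>
      (\<exists>s'. runs P (\<iota> x) c s s' \<and> fst s' (reg l) = ?r x (N (\<iota> x)) \<and> preserved l s s')"
    by blast
qed

lemma ptime_pullback:
  assumes "ptime \<iota> es f" shows "ptime (\<lambda>y. \<iota> (\<pi> y)) (map (\<lambda>e y. e (\<pi> y)) es) (\<lambda>y. f (\<pi> y))"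
  unfolding ptime_def
proof (intro allI impI)
  fix ps and l :: nat assume ps: "\<forall>p\<in>set ps. p < l"
  obtain P c where P: "\<And>x s. loaded \<iota> ps es x s \<Longrightarrow>
    \<exists>s'. runs P (\<iota> x) c s s' \<and> fst s' (reg l) = f x \<and> preserved l s s'"
    using ptime_E[OF assms ps] by blast
  have "loaded \<iota> ps es (\<pi> y) s" if "loaded (\<lambda>y. \<iota> (\<pi> y)) ps (map (\<lambda>e y. e (\<pi> y)) es) y s" for y s
    using that by (auto simp: loaded_def list_all2_map2)
  then show "\<exists>P c. \<forall>y s. loaded (\<lambda>y. \<iota> (\<pi> y)) ps (map (\<lambda>e y. e (\<pi> y)) es) y s \<longrightarrow>
      (\<exists>s'. runs P (\<iota> (\<pi> y)) c s s' \<and> fst s' (reg l) = f (\<pi> y) \<and> preserved l s s')"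
    using P by meson
qed

text \<open>Weakening and permutation of the context: each variable of \<open>es\<close> is looked
  up in the register where some position of \<open>es'\<close> keeps it.\<close>

lemma ptime_subset:
  assumes "ptime \<iota> es f" "set es \<subseteq> set es'" shows "ptime \<iota> es' f"
  unfolding ptime_def
proof (intro allI impI)
  fix ps and l :: nat assume ps: "\<forall>p\<in>set ps. p < l"
  show "\<exists>P c. \<forall>x s. loaded \<iota> ps es' x s \<longrightarrow>
      (\<exists>s'. runs P (\<iota> x) c s s' \<and> fst s' (reg l) = f x \<and> preserved l s s')"
  proof (cases "length ps = length es'")
    \<comment> \<open>With a wrong number of registers \<open>loaded\<close> never holds, so any
      program will do.\<close>
    case False
    then have "\<not> loaded \<iota> ps es' x s" for x s by (auto simp: loaded_def dest: list_all2_lengthD)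
    then show ?thesis by blast
  next
    case True
    have "\<forall>e\<in>set es. \<exists>i<length es'. es' ! i = e" using assms(2) by (auto simp: in_set_conv_nth subset_eq)
    then obtain h where h: "\<And>e. e \<in> set es \<Longrightarrow> h e < length es' \<and> es' ! h e = e" by metis
    let ?ps = "map (\<lambda>e. ps ! h e) es"
    have "\<forall>p\<in>set ?ps. p < l" using ps h True by auto
    from ptime_E[OF assms(1) this] obtain P c where P: "\<And>x s. loaded \<iota> ?ps es x s \<Longrightarrow>
      \<exists>s'. runs P (\<iota> x) c s s' \<and> fst s' (reg l) = f x \<and> preserved l s s'" by blast
    have "loaded \<iota> ?ps es x s" if "loaded \<iota> ps es' x s" for x s
      using that h True unfolding loaded_def list_all2_conv_all_nth by (auto simp: in_set_conv_nth)
        (metis nth_mem)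
    then show ?thesis using P by meson
  qed
qed

lemma poly_bounded_const: "poly_bounded (\<lambda>I. a)"
  unfolding poly_bounded_def using budget_const by blast

lemma poly_bounded_order: "poly_bounded order_of"
  unfolding poly_bounded_def
proof (intro exI[of _ 1] allI impI)
  fix I show "order_of I \<le> budget I ^ 1"
    using mult_le_mono[of 1 "2 ^ (colors_of I ^ 5)" "order_of I" "order_of I + 2"] by (simp add: budget_def)
qed

lemma poly_bounded_pow2: "poly_bounded (\<lambda>I. 2 ^ (c * colors_of I ^ 5))"
  unfolding poly_bounded_def
proof (intro exI[of _ c] allI impI)
  fix I
  have "(2::nat) ^ (colors_of I ^ 5) \<le> budget I" by (simp add: budget_def)
  from power_mono[OF this, of c] show "(2::nat) ^ (c * colors_of I ^ 5) \<le> budget I ^ c"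
    by (simp add: power_mult mult.commute[of c])
qed

lemma poly_bounded_colors: "poly_bounded colors_of"
  unfolding poly_bounded_def
proof (intro exI[of _ 1] allI impI)
  fix I :: inst assume "0 < colors_of I"
  then have "colors_of I \<le> colors_of I ^ 5" by (simp add: self_le_power)
  also have "\<dots> < 2 ^ (colors_of I ^ 5)" by (rule less_exp)
  also have "\<dots> \<le> budget I" by (simp add: budget_def)
  finally show "colors_of I \<le> budget I ^ 1" by simp
qed

lemma poly_bounded_plus: "poly_bounded f \<Longrightarrow> poly_bounded g \<Longrightarrow> poly_bounded (\<lambda>I. f I + g I)"
  unfolding poly_bounded_def using budget_add by meson

lemma poly_bounded_times: "poly_bounded f \<Longrightarrow> poly_bounded g \<Longrightarrow> poly_bounded (\<lambda>I. f I * g I)"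
  unfolding poly_bounded_def using budget_mult by meson

lemma poly_bounded_power: "poly_bounded f \<Longrightarrow> poly_bounded (\<lambda>I. f I ^ c)"
  by (induction c) (auto intro: poly_bounded_const poly_bounded_times)

lemmas poly_bounded_intros = poly_bounded_pow2 poly_bounded_const poly_bounded_order poly_bounded_colors
  poly_bounded_plus poly_bounded_times poly_bounded_power

section \<open>Tests, bounded quantifiers, sums and bit operations\<close>

definition ptest :: "('x \<Rightarrow> inst) \<Rightarrow> ('x \<Rightarrow> nat) list \<Rightarrow> ('x \<Rightarrow> bool) \<Rightarrow> bool" where
  "ptest \<iota> es P \<longleftrightarrow> ptime \<iota> es (\<lambda>x. of_bool (P x))"

abbreviation ext_ctx :: "('x \<Rightarrow> nat) list \<Rightarrow> ('x \<times> nat \<Rightarrow> nat) list" where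
  "ext_ctx es \<equiv> snd # map (\<lambda>e y. e (fst y)) es"

lemma ptime_ite:
  assumes "ptest \<iota> es P" "ptime \<iota> es f" "ptime \<iota> es g"
  shows "ptime \<iota> es (\<lambda>x. if P x then f x else g x)"
proof -
  have "(\<lambda>x. if P x then f x else g x) = (\<lambda>x. if of_bool (P x) \<noteq> (0::nat) then f x else g x)" by auto
  then show ?thesis using ptime_if[OF assms(1)[unfolded ptest_def] assms(2,3)] by simp
qed

lemma ptest_not: "ptest \<iota> es P \<Longrightarrow> ptest \<iota> es (\<lambda>x. \<not> P x)"
proof -
  assume "ptest \<iota> es P"
  then have "ptime \<iota> es (\<lambda>x. 1 - of_bool (P x))" unfolding ptest_def by (intro ptime_minus ptime_const)
  moreover have "(\<lambda>x. 1 - of_bool (P x) :: nat) = (\<lambda>x. of_bool (\<not> P x))" by auto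
  ultimately show ?thesis by (simp add: ptest_def)
qed

lemma ptest_conj: "ptest \<iota> es P \<Longrightarrow> ptest \<iota> es Q \<Longrightarrow> ptest \<iota> es (\<lambda>x. P x \<and> Q x)"
proof -
  assume "ptest \<iota> es P" "ptest \<iota> es Q"
  then have "ptime \<iota> es (\<lambda>x. if P x then of_bool (Q x) else 0)"
    by (intro ptime_ite ptime_const) (auto simp: ptest_def)
  moreover have "(\<lambda>x. if P x then of_bool (Q x) else (0::nat)) = (\<lambda>x. of_bool (P x \<and> Q x))" by auto
  ultimately show ?thesis by (simp add: ptest_def)
qed

lemma ptest_disj: "ptest \<iota> es P \<Longrightarrow> ptest \<iota> es Q \<Longrightarrow> ptest \<iota> es (\<lambda>x. P x \<or> Q x)"
  using ptest_not[OF ptest_conj[OF ptest_not ptest_not]] by fastforce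

lemma ptest_imp: "ptest \<iota> es P \<Longrightarrow> ptest \<iota> es Q \<Longrightarrow> ptest \<iota> es (\<lambda>x. P x \<longrightarrow> Q x)"
  using ptest_disj[OF ptest_not] by fastforce

lemma ptest_less: "ptime \<iota> es f \<Longrightarrow> ptime \<iota> es g \<Longrightarrow> ptest \<iota> es (\<lambda>x. f x < g x)"
proof -
  assume "ptime \<iota> es f" "ptime \<iota> es g"
  then have "ptime \<iota> es (\<lambda>x. if g x - f x \<noteq> 0 then 1 else 0)" by (intro ptime_if ptime_minus ptime_const)
  moreover have "(\<lambda>x. if g x - f x \<noteq> 0 then 1 else (0::nat)) = (\<lambda>x. of_bool (f x < g x))" by auto
  ultimately show ?thesis by (simp add: ptest_def)
qed

lemma ptest_le: "ptime \<iota> es f \<Longrightarrow> ptime \<iota> es g \<Longrightarrow> ptest \<iota> es (\<lambda>x. f x \<le> g x)"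
  using ptest_not[OF ptest_less[of \<iota> es g f]] by (simp add: not_less)

lemma ptest_eq: "ptime \<iota> es f \<Longrightarrow> ptime \<iota> es g \<Longrightarrow> ptest \<iota> es (\<lambda>x. f x = g x)"
  using ptest_conj[OF ptest_le ptest_le, of \<iota> es f g g f] by (simp add: eq_iff)

lemma ptest_iff: "ptest \<iota> es P \<Longrightarrow> ptest \<iota> es Q \<Longrightarrow> ptest \<iota> es (\<lambda>x. P x \<longleftrightarrow> Q x)"
  using ptest_conj[OF ptest_imp[of \<iota> es P Q] ptest_imp[of \<iota> es Q P]] by (simp add: iff_conv_conj_imp)

lemma ptime_extend: "ptime \<iota> es f \<Longrightarrow> ptime (\<lambda>y. \<iota> (fst y)) (ext_ctx es) (\<lambda>y. f (fst y))"
  by (rule ptime_subset[OF ptime_pullback]) auto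

lemma ptime_sum:
  assumes N: "ptime \<iota> es (\<lambda>x. N (\<iota> x))" and bd: "poly_bounded N"
    and h: "ptime (\<lambda>y. \<iota> (fst y)) (ext_ctx es) (\<lambda>y. h (fst y) (snd y))"
  shows "ptime \<iota> es (\<lambda>x. \<Sum>i<N (\<iota> x). h x i)"
proof -
  let ?es = "(\<lambda>y. fst (snd y)) # (\<lambda>y. snd (snd y)) # map (\<lambda>e y. e (fst y)) es"
  have "ptime (\<lambda>y. \<iota> (fst y)) ?es (\<lambda>y. h (fst y) (fst (snd y)))"
    using ptime_subset[OF ptime_pullback[OF h, of "\<lambda>y. (fst y, fst (snd y))"], of ?es] by auto
  then have "ptime (\<lambda>y. \<iota> (fst y)) ?es (\<lambda>y. snd (snd y) + h (fst y) (fst (snd y)))"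
    by (intro ptime_plus) (auto intro: ptime_var)
  from ptime_rec[OF N bd ptime_const[of _ _ 0], of "\<lambda>x i r. r + h x i", OF this]
  have "ptime \<iota> es (\<lambda>x. rec_nat 0 (\<lambda>i r. r + h x i) (N (\<iota> x)))" .
  moreover have "rec_nat 0 (\<lambda>i r. r + h x i) j = (\<Sum>i<j. h x i)" for x j by (induction j) auto
  ultimately show ?thesis by simp
qed

lemma ptime_card:
  assumes N: "ptime \<iota> es (\<lambda>x. N (\<iota> x))" and bd: "poly_bounded N"
    and h: "ptest (\<lambda>y. \<iota> (fst y)) (ext_ctx es) (\<lambda>y. P (fst y) (snd y))"
  shows "ptime \<iota> es (\<lambda>x. card {i. i < N (\<iota> x) \<and> P x i})"
proof -
  have "card {i. i < j \<and> P x i} = (\<Sum>i<j. of_bool (P x i))" for x j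
    by (simp add: sum_of_bool_eq lessThan_def Collect_conj_eq)
  then show ?thesis using ptime_sum[OF N bd h[unfolded ptest_def]] by simp
qed

lemma ptest_ex:
  assumes N: "ptime \<iota> es (\<lambda>x. N (\<iota> x))" and bd: "poly_bounded N"
    and h: "ptest (\<lambda>y. \<iota> (fst y)) (ext_ctx es) (\<lambda>y. P (fst y) (snd y))"
  shows "ptest \<iota> es (\<lambda>x. \<exists>i<N (\<iota> x). P x i)"
proof -
  have "(\<exists>i<N (\<iota> x). P x i) \<longleftrightarrow> 0 < card {i. i < N (\<iota> x) \<and> P x i}" for x
    by (auto simp: card_gt_0_iff)
  then show ?thesis using ptest_less[OF ptime_const[of _ _ 0] ptime_card[OF assms]] by simp
qed

lemma ptest_all:
  assumes N: "ptime \<iota> es (\<lambda>x. N (\<iota> x))" and bd: "poly_bounded N"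
    and h: "ptest (\<lambda>y. \<iota> (fst y)) (ext_ctx es) (\<lambda>y. P (fst y) (snd y))"
  shows "ptest \<iota> es (\<lambda>x. \<forall>i<N (\<iota> x). P x i)"
  using ptest_not[OF ptest_ex[OF N bd ptest_not[OF h]]] by simp

text \<open>Multiplication is repeated addition, so one factor must be a polynomially bounded
  function of the instance.\<close>

lemma ptime_times:
  assumes "ptime \<iota> es f" and N: "ptime \<iota> es (\<lambda>x. N (\<iota> x))" and bd: "poly_bounded N"
  shows "ptime \<iota> es (\<lambda>x. f x * N (\<iota> x))"
  using ptime_sum[OF N bd ptime_extend[OF assms(1)]] by (simp add: mult.commute)

lemma ptime_colors_power: "ptime \<iota> es (\<lambda>x. colors_of (\<iota> x) ^ c)"
proof (induction c)
  case (Suc c)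
  then show ?case using ptime_times[OF Suc ptime_colors poly_bounded_colors] by (simp add: mult.commute)
qed (simp add: ptime_const)

text \<open>The loop always makes \<open>N\<close> rounds and doubles only in the first
  \<open>g x\<close> of them; this is where the cap on the shift comes from.\<close>

lemma ptime_times_shift:
  assumes f: "ptime \<iota> es f" and g: "ptime \<iota> es g" and N: "ptime \<iota> es (\<lambda>x. N (\<iota> x))" and bd: "poly_bounded N"
  shows "ptime \<iota> es (\<lambda>x. f x * 2 ^ min (g x) (N (\<iota> x)))"
proof -
  let ?es = "(\<lambda>y. fst (snd y)) # (\<lambda>y. snd (snd y)) # map (\<lambda>e y. e (fst y)) es"
  have "ptime (\<lambda>y. \<iota> (fst y)) ?es (\<lambda>y. g (fst y))"
    using ptime_subset[OF ptime_pullback[OF g, of fst], of ?es] by auto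
  then have "ptime (\<lambda>y. \<iota> (fst y)) ?es
      (\<lambda>y. snd (snd y) + (if fst (snd y) < g (fst y) then snd (snd y) else 0))"
    by (intro ptime_plus ptime_ite ptest_less ptime_const) (auto intro: ptime_var)
  from ptime_rec[OF N bd f, of "\<lambda>x i r. r + (if i < g x then r else 0)", OF this]
  have "ptime \<iota> es (\<lambda>x. rec_nat (f x) (\<lambda>i r. r + (if i < g x then r else 0)) (N (\<iota> x)))" .
  moreover have "rec_nat (f x) (\<lambda>i r. r + (if i < g x then r else 0)) j = f x * 2 ^ min (g x) j" for x j
    by (induction j) (auto simp: min_def le_Suc_eq)
  ultimately show ?thesis by simp
qed

text \<open>Division without a division instruction: the bits of the quotient are found from the
  highest one down, and a bit is kept if the shifted candidate does not exceed
  \<open>S\<close>.\<close>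

lemma greedy_bits_quotient:
  fixes S j L :: nat
  defines "r \<equiv> rec_nat 0 (\<lambda>i q. if (q + 2 ^ min (L - Suc i) L) * 2 ^ min j L \<le> S
                 then q + 2 ^ min (L - Suc i) L else q)"
  assumes S: "S < 2 ^ L"
  shows "r L = S div 2 ^ j"
proof -
  let ?T = "S div 2 ^ min j L"
  have cond: "a * 2 ^ min j L \<le> S \<longleftrightarrow> a \<le> ?T" for a by (simp add: less_eq_div_iff_mult_less_eq)
  \<comment> \<open>After \<open>i\<close> rounds the quotient is known up to its lowest
    \<open>L - i\<close> bits.\<close>
  have "r i \<le> ?T \<and> ?T < r i + 2 ^ (L - i)" if "i \<le> L" for i
    using that
  proof (induction i)
    case 0
    have "?T \<le> S" by (rule div_le_dividend)
    with S have "?T < 2 ^ L" by (rule le_less_trans[rotated])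
    then show ?case by (simp add: r_def)
  next
    case (Suc i)
    then have IH: "r i \<le> ?T" "?T < r i + 2 ^ (L - i)" by auto
    have "(2::nat) ^ (L - i) = 2 ^ (L - Suc i) + 2 ^ (L - Suc i)"
      using Suc.prems by (simp add: Suc_diff_Suc flip: mult_2 power_Suc)
    moreover have "r (Suc i) = (if r i + 2 ^ (L - Suc i) \<le> ?T then r i + 2 ^ (L - Suc i) else r i)"
      by (simp add: r_def cond)
    ultimately show ?case using IH by auto
  qed
  from this[of L] have "r L = ?T" by simp
  also have "\<dots> = S div 2 ^ j"
  proof (cases "j \<le> L")
    \<comment> \<open>Here the shift is capped, but both quotients are 0.\<close>
    case False
    then have "S < 2 ^ j" using S power_increasing[of L j "2::nat"] by linarith
    then show ?thesis using False S by simp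
  qed simp
  finally show ?thesis .
qed

text \<open>
  Sets and vectors are coded as numbers of at most \<open>bits I\<close> binary digits. Larger arguments are mapped to
  junk (\<open>shr\<close> returns 0, \<open>shl\<close> caps the shift), which bounds the number of iterations for all arguments.
\<close>

definition bits :: "inst \<Rightarrow> nat" where
  "bits I = 280 * colors_of I ^ 5 + colors_of I ^ 2 * order_of I + order_of I"

definition shl :: "inst \<Rightarrow> nat \<Rightarrow> nat \<Rightarrow> nat" where "shl I y j = y * 2 ^ min j (bits I)"
definition shr :: "inst \<Rightarrow> nat \<Rightarrow> nat \<Rightarrow> nat" where
  "shr I S j = (if S < 2 ^ bits I then S div 2 ^ j else 0)"
text \<open>The \<open>w\<close> binary digits of \<open>S\<close> from position \<open>j\<close>
  on; the remainder modulo \<open>2 ^ w\<close> is obtained by subtracting the higher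
  digits.\<close>

definition slice :: "inst \<Rightarrow> nat \<Rightarrow> nat \<Rightarrow> nat \<Rightarrow> nat" where
  "slice I S j w = shr I S j - shl I (shr I S (j + w)) w"

lemma slice_eq:
  assumes "S < 2 ^ bits I" "w \<le> bits I"
  shows "slice I S j w = S div 2 ^ j mod 2 ^ w"
proof -
  have "S div 2 ^ (j + w) = S div 2 ^ j div 2 ^ w" by (simp add: power_add div_mult2_eq)
  then show ?thesis using assms by (simp add: slice_def shr_def shl_def min_def minus_div_mult_eq_mod)
qed

lemma poly_bounded_bits: "poly_bounded bits"
  unfolding bits_def by (intro poly_bounded_intros)

lemma ptime_bits: "ptime \<iota> es (\<lambda>x. bits (\<iota> x))"
proof -
  have "ptime \<iota> es (\<lambda>x. colors_of (\<iota> x) ^ 5 * 280 + colors_of (\<iota> x) ^ 2 * order_of (\<iota> x) + order_of (\<iota> x))"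
    using ptime_times[OF ptime_colors_power ptime_const poly_bounded_const] 
    by (intro ptime_plus ptime_times[where N = order_of] ptime_colors_power ptime_order poly_bounded_order) 
  then show ?thesis by (simp add: bits_def mult.commute)
qed

lemma ptime_shl: "ptime \<iota> es f \<Longrightarrow> ptime \<iota> es g \<Longrightarrow> ptime \<iota> es (\<lambda>x. shl (\<iota> x) (f x) (g x))"
  unfolding shl_def by (intro ptime_times_shift ptime_bits poly_bounded_bits)

lemma ptime_shr:
  assumes f: "ptime \<iota> es f" and g: "ptime \<iota> es g"
  shows "ptime \<iota> es (\<lambda>x. shr (\<iota> x) (f x) (g x))"
proof -
  let ?es = "(\<lambda>y. fst (snd y)) # (\<lambda>y. snd (snd y)) # map (\<lambda>e y. e (fst y)) es"
  let ?q = "\<lambda>x i q. q + shl (\<iota> x) 1 (bits (\<iota> x) - Suc i)"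
  let ?h = "\<lambda>x i q. if shl (\<iota> x) (?q x i q) (g x) \<le> f x then ?q x i q else q"
  have "ptime (\<lambda>y. \<iota> (fst y)) ?es (\<lambda>y. g (fst y))" "ptime (\<lambda>y. \<iota> (fst y)) ?es (\<lambda>y. f (fst y))"
    using ptime_subset[OF ptime_pullback[OF g, of fst], of ?es] ptime_subset[OF ptime_pullback[OF f, of fst], of ?es]
    by auto
  moreover have "ptime (\<lambda>y. \<iota> (fst y)) ?es (\<lambda>y. bits (\<iota> (fst y)) - (fst (snd y) + 1))"
    by (intro ptime_minus ptime_plus ptime_const ptime_bits) (auto intro: ptime_var)
  ultimately have "ptime (\<lambda>y. \<iota> (fst y)) ?es (\<lambda>y. ?h (fst y) (fst (snd y)) (snd (snd y)))"
    by (intro ptime_ite ptest_le ptime_shl ptime_plus ptime_const) (auto intro: ptime_var)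
  from ptime_rec[OF ptime_bits poly_bounded_bits ptime_const[of _ _ 0], where g = ?h, OF this]
  have "ptime \<iota> es (\<lambda>x. if f x < shl (\<iota> x) 1 (bits (\<iota> x)) then rec_nat 0 (?h x) (bits (\<iota> x)) else 0)"
    using f by (intro ptime_ite ptest_less ptime_shl ptime_const ptime_bits)
  moreover have "shr (\<iota> x) (f x) (g x) =
      (if f x < shl (\<iota> x) 1 (bits (\<iota> x)) then rec_nat 0 (?h x) (bits (\<iota> x)) else 0)" for x
    using greedy_bits_quotient[of "f x" "bits (\<iota> x)" "g x"]
    by (auto simp: shr_def shl_def cong: if_cong)
  ultimately show ?thesis by simp
qed

lemma ptime_slice: "ptime \<iota> es f \<Longrightarrow> ptime \<iota> es g \<Longrightarrow> ptime \<iota> es h \<Longrightarrow> ptime \<iota> es (\<lambda>x. slice (\<iota> x) (f x) (g x) (h x))"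
  unfolding slice_def by (intro ptime_minus ptime_shr ptime_shl ptime_plus)

section \<open>Certificates and homogeneous sets\<close>

locale sgraph =
  fixes V :: "'a set" and A :: "'a \<Rightarrow> 'a \<Rightarrow> bool"
  assumes finV: "finite V" and symA: "A u v \<Longrightarrow> A v u" and irrA: "\<not> A u u"
begin

text \<open>Columns are colors, counted from 0, and row \<open>i\<close> is a star with its center
  on the diagonal. A vertex may occur several times within a column.\<close>

definition witness :: "nat \<Rightarrow> (nat \<Rightarrow> nat \<Rightarrow> 'a) \<Rightarrow> bool" where
  "witness k x \<longleftrightarrow> (\<forall>i<k. \<forall>j<k. x i j \<in> V) \<and> (\<forall>i<k. \<forall>i'<k. \<forall>j<k. \<not> A (x i j) (x i' j)) \<and>
     (\<forall>i<k. \<forall>i'<k. \<forall>j<k. \<forall>j'<k. j \<noteq> j' \<longrightarrow> x i j \<noteq> x i' j') \<and> (\<forall>i<k. \<forall>j<i. A (x i i) (x i j))"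

text \<open>Only the entries below the diagonal are leaves; the rest of column \<open>j\<close>
  repeats the center \<open>v j\<close>, which fills the square without new conditions.\<close>

lemma witness_of_stars:
  assumes "\<And>j. j < k \<Longrightarrow> v j \<in> V" "\<And>i j. j < i \<Longrightarrow> i < k \<Longrightarrow> u i j \<in> V"
    and "\<And>i j. i < k \<Longrightarrow> j < k \<Longrightarrow> i \<noteq> j \<Longrightarrow> v i \<noteq> v j"
    and "\<And>i j. j < i \<Longrightarrow> i < k \<Longrightarrow> A (v i) (u i j)"
    and "\<And>i i' j. j < i \<Longrightarrow> i < k \<Longrightarrow> j < i' \<Longrightarrow> i' < k \<Longrightarrow> \<not> A (u i j) (u i' j)"
    and "\<And>i j. j < i \<Longrightarrow> i < k \<Longrightarrow> \<not> A (u i j) (v j)"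
    and "\<And>i i' j j'. j < i \<Longrightarrow> i < k \<Longrightarrow> j' < i' \<Longrightarrow> i' < k \<Longrightarrow> j \<noteq> j' \<Longrightarrow> u i j \<noteq> u i' j'"
    and "\<And>i j j'. j < i \<Longrightarrow> i < k \<Longrightarrow> j' < k \<Longrightarrow> j' \<noteq> j \<Longrightarrow> u i j \<noteq> v j'"
  shows "witness k (\<lambda>i j. if j < i then u i j else v j)"
  unfolding witness_def
proof (intro conjI allI impI)
  fix i j assume "i < k" "j < k"
  then show "(if j < i then u i j else v j) \<in> V" using assms(1,2) by auto
next
  fix i i' j assume "i < k" "i' < k" "j < k"
  then show "\<not> A (if j < i then u i j else v j) (if j < i' then u i' j else v j)"
    using assms(5)[of j i i'] assms(6)[of j i] assms(6)[of j i'] symA[of "v j" "u i' j"] irrA by auto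
next
  fix i i' j j' assume "i < k" "i' < k" "j < k" "j' < k" "j \<noteq> j'"
  then show "(if j < i then u i j else v j) \<noteq> (if j' < i' then u i' j' else v j')"
    using assms(3)[of j j'] assms(7)[of j i j' i'] assms(8)[of j i j'] assms(8)[of j' i' j] by auto
next
  fix i j assume "i < k" "j < i"
  then show "A (if i < i then u i i else v i) (if j < i then u i j else v j)" using assms(4) by simp
qed

definition homogeneous :: "nat \<Rightarrow> 'a set \<Rightarrow> bool" where
  "homogeneous e X \<longleftrightarrow> (\<forall>y\<in>V. X \<subseteq> Collect (A y) \<or> e * card (X \<inter> Collect (A y)) < card X)"

text \<open>A half graph: \<open>y j\<close> is adjacent to every later \<open>x i\<close> but not
  to \<open>x j\<close>. That each \<open>y i\<close> splits \<open>X\<close> separates it from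
  vertices that are uniform on \<open>X\<close>, which gives distinctness when a chain is extended
  at the front.\<close>

definition chain :: "nat \<Rightarrow> 'a set \<Rightarrow> (nat \<Rightarrow> 'a) \<Rightarrow> (nat \<Rightarrow> 'a) \<Rightarrow> bool" where
  "chain n X x y \<longleftrightarrow> (\<forall>i<n. x i \<in> X \<and> y i \<in> V \<and> \<not> A (y i) (x i)) \<and>
     (\<forall>i<n. (\<exists>z\<in>X. A (y i) z) \<and> (\<exists>z\<in>X. \<not> A (y i) z)) \<and>
     (\<forall>i<n. \<forall>j<i. A (y j) (x i) \<and> x i \<noteq> x j \<and> y i \<noteq> y j \<and> y i \<noteq> x j \<and> x i \<noteq> y j)"

lemma chain_Suc:
  assumes c: "chain n X2 x y" and X2: "X2 \<subseteq> X \<inter> Collect (A b)" "X2 \<subseteq> Collect (A a) \<or> X2 \<inter> Collect (A a) = {}"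
    and ab: "a \<in> X" "b \<in> V" "\<not> A b a" "\<exists>z\<in>X. A b z"
  shows "chain (Suc n) X (case_nat a x) (case_nat b y)"
proof -
  have 1: "x i \<in> X" "y i \<in> V" "\<not> A (y i) (x i)" "A b (x i)" "x i \<noteq> a" "x i \<noteq> b" if "i < n" for i
    using that c X2(1) ab(3) irrA unfolding chain_def by blast+
  have 2: "\<exists>z\<in>X2. A (y i) z" "\<exists>z\<in>X2. \<not> A (y i) z" if "i < n" for i
    using that c unfolding chain_def by blast+
  then have 3: "y i \<noteq> b" "y i \<noteq> a" if "i < n" for i
    using 2[OF that] X2 by blast+
  show ?thesis
    unfolding chain_def
  proof (intro conjI allI impI)
    fix i assume i: "i < Suc n"
    show "case_nat a x i \<in> X" "case_nat b y i \<in> V" "\<not> A (case_nat b y i) (case_nat a x i)"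
      using i 1 ab by (cases i; simp)+
    show "\<exists>z\<in>X. A (case_nat b y i) z" "\<exists>z\<in>X. \<not> A (case_nat b y i) z"
      using i 2 ab X2(1) by (cases i; force)+
    fix j assume "j < i"
    then obtain i' where i': "i = Suc i'" "i' < n" "j < Suc i'" using i by (cases i) auto
    show "A (case_nat b y j) (case_nat a x i)" "case_nat a x i \<noteq> case_nat a x j"
      "case_nat b y i \<noteq> case_nat b y j" "case_nat b y i \<noteq> case_nat a x j" "case_nat a x i \<noteq> case_nat b y j"
      using i' 1[of i'] 3[of i'] c unfolding chain_def by (cases j; simp)+
  qed
qed

text \<open>If \<open>X\<close> is not homogeneous, some \<open>b\<close> misses some
  \<open>a\<close> in \<open>X\<close> but sees at least a fraction \<open>1 / e\<close> of
  \<open>X\<close>. Passing to this part, and then to the majority side with respect to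
  \<open>a\<close>, costs a factor \<open>2 * e\<close> and makes \<open>a\<close>, \<open>b\<close>
  the first link of a chain.\<close>

lemma homogeneous_or_chain:
  assumes "X \<subseteq> V" "X \<noteq> {}" "0 < e"
  shows "(\<exists>X'\<subseteq>X. X' \<noteq> {} \<and> card X \<le> (2 * e) ^ n * card X' \<and> homogeneous e X') \<or> (\<exists>x y. chain n X x y)"
  using assms
proof (induction n arbitrary: X)
  case 0
  then show ?case by (auto simp: chain_def)
next
  case (Suc n)
  have finX: "finite X" using Suc.prems finV finite_subset by blast
  show ?case
  proof (cases "homogeneous e X")
    case True
    have "card X \<le> (2 * e) ^ Suc n * card X" using Suc.prems by simp
    then show ?thesis using True Suc.prems by blast
  next
    case False
    then obtain b where b: "b \<in> V" "\<not> X \<subseteq> Collect (A b)" "card X \<le> e * card (X \<inter> Collect (A b))"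
      unfolding homogeneous_def by (auto simp: not_less)
    then obtain a where a: "a \<in> X" "\<not> A b a" by auto
    define X1 where "X1 = X \<inter> Collect (A b)"
    have finX1: "finite X1" using finX by (simp add: X1_def)
    have c1: "card X1 = card (X1 \<inter> Collect (A a)) + card (X1 - Collect (A a))"
      using card_Int_Diff[OF finX1] by blast
    obtain X2 where X2: "X2 \<subseteq> X1" "card X1 \<le> 2 * card X2"
      "X2 \<subseteq> Collect (A a) \<or> X2 \<inter> Collect (A a) = {}"
    proof (cases "card (X1 - Collect (A a)) \<le> card (X1 \<inter> Collect (A a))")
      case True with c1 show ?thesis by (intro that[of "X1 \<inter> Collect (A a)"]) auto
    next
      case False with c1 show ?thesis by (intro that[of "X1 - Collect (A a)"]) auto
    qed
    have "card X \<le> e * card X1" using b by (simp add: X1_def)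
    also have "\<dots> \<le> e * (2 * card X2)" using X2(2) by simp
    finally have le: "card X \<le> 2 * e * card X2" by (simp add: ac_simps)
    moreover have "0 < card X" using Suc.prems finX by (simp add: card_gt_0_iff)
    ultimately have "X2 \<noteq> {}" by auto
    moreover have "X2 \<subseteq> V" using X2 Suc.prems by (auto simp: X1_def)
    ultimately consider X' where "X' \<subseteq> X2" "X' \<noteq> {}" "card X2 \<le> (2 * e) ^ n * card X'" "homogeneous e X'"
      | x y where "chain n X2 x y" using Suc.IH[of X2] Suc.prems by blast
    then show ?thesis
    proof cases
      case 1
      have "2 * e * card X2 \<le> 2 * e * ((2 * e) ^ n * card X')" using 1(3) by (rule mult_le_mono2)
      from order_trans[OF le this] have "card X \<le> (2 * e) ^ Suc n * card X'" by (simp only: power_Suc mult.assoc)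
      then show ?thesis using 1 X2(1) by (intro disjI1 exI[of _ X']) (auto simp: X1_def)
    next
      case 2
      have "\<exists>z\<in>X. A b z" using X2(1) \<open>X2 \<noteq> {}\<close> by (auto simp: X1_def)
      with chain_Suc[OF 2 _ X2(3) a(1) b(1) a(2)] X2(1) show ?thesis by (auto simp: X1_def)
    qed
  qed
qed

text \<open>The vertex \<open>y j\<close> serves as the common leaf of color \<open>j\<close> for
  all centers \<open>x i\<close> with \<open>j < i\<close>; it is not adjacent to the center
  \<open>x j\<close> of the same color.\<close>

lemma chain_witness:
  assumes c: "chain k X x y" and "X \<subseteq> V" shows "\<exists>w. witness k w"
proof
  have m: "A (y j) (x i)" "x i \<noteq> x j" "y i \<noteq> y j" "y i \<noteq> x j" "x i \<noteq> y j" if "j < i" "i < k" for i j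
    using c that unfolding chain_def by blast+
  have v: "x i \<in> V" "y i \<in> V" "\<not> A (y i) (x i)" if "i < k" for i
    using c that \<open>X \<subseteq> V\<close> unfolding chain_def by blast+
  show "witness k (\<lambda>i j. if j < i then y j else x j)"
  proof (rule witness_of_stars)
    fix i i' j j' assume "j < i" "i < k" "j' < i'" "i' < k" "j \<noteq> j'"
    then show "y j \<noteq> y j'" using m(3)[of j j'] m(3)[of j' j] by (cases j j' rule: linorder_cases) auto
  next
    fix i j j' assume "j < i" "i < k" "j' < k" "j' \<noteq> j"
    then show "y j \<noteq> x j'" using m(4)[of j' j] m(5)[of j j'] by (cases j j' rule: linorder_cases) auto
  next
    fix i j assume "i < k" "j < k" "i \<noteq> j"
    then show "x i \<noteq> x j" using m(2)[of i j] m(2)[of j i] by (cases i j rule: linorder_cases) auto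
  next
    fix i j assume "j < i" "i < k"
    then show "A (x i) (y j)" using m(1) symA by blast
  qed (use v irrA m symA in \<open>simp_all | blast\<close>)
qed

lemma homogeneous_subset:
  assumes "\<nexists>w. witness k w" "X \<subseteq> V" "X \<noteq> {}" "0 < e"
  obtains X' where "X' \<subseteq> X" "X' \<noteq> {}" "card X \<le> (2 * e) ^ k * card X'" "homogeneous e X'"
  using homogeneous_or_chain[OF assms(2-4), of k] chain_witness[OF _ assms(2)] assms(1) by blast

end

text \<open>The usual induction on \<open>m + n\<close>: one of the two sides of a vertex
  \<open>a\<close> keeps at least \<open>2 ^ p\<close> elements, where
  \<open>m + n = Suc p\<close>.\<close>

lemma ramsey_two_power:
  assumes "finite S" "2 ^ (m + n) \<le> card S" "\<And>x y. R x y \<Longrightarrow> R y x"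
  shows "(\<exists>T\<subseteq>S. card T = m \<and> (\<forall>x\<in>T. \<forall>y\<in>T. x \<noteq> y \<longrightarrow> R x y)) \<or>
         (\<exists>T\<subseteq>S. card T = n \<and> (\<forall>x\<in>T. \<forall>y\<in>T. x \<noteq> y \<longrightarrow> \<not> R x y))"
  using assms(1,2)
proof (induction "m + n" arbitrary: m n S)
  case 0
  then show ?case by (intro disjI1 exI[of _ "{}"]) auto
next
  case (Suc p)
  show ?case
  proof (cases "m = 0 \<or> n = 0")
    case True
    then show ?thesis by (metis card.empty empty_iff empty_subsetI)
  next
    case False
    then obtain m' n' where mn: "m = Suc m'" "n = Suc n'" by (metis not0_implies_Suc)
    have "S \<noteq> {}" using Suc.prems by auto
    then obtain a where a: "a \<in> S" by blast
    let ?P = "{x \<in> S - {a}. R a x}" and ?Q = "{x \<in> S - {a}. \<not> R a x}"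
    have "card (S - {a}) = card ?P + card ?Q"
      using card_Int_Diff[of "S - {a}" "Collect (R a)"] Suc.prems
      by (simp add: Int_def set_diff_eq conj_assoc)
    moreover have "card (S - {a}) = card S - 1" using a Suc.prems by simp
    moreover have "2 * 2 ^ p \<le> card S" using Suc by (metis power_Suc)
    ultimately consider "2 ^ p \<le> card ?P" | "2 ^ p \<le> card ?Q" by linarith
    then show ?thesis
    proof cases
      case 1
      have p: "p = m' + n" using Suc.hyps(2) mn by simp
      have "(\<exists>T\<subseteq>?P. card T = m' \<and> (\<forall>x\<in>T. \<forall>y\<in>T. x \<noteq> y \<longrightarrow> R x y)) \<or>
         (\<exists>T\<subseteq>?P. card T = n \<and> (\<forall>x\<in>T. \<forall>y\<in>T. x \<noteq> y \<longrightarrow> \<not> R x y))"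
        by (rule Suc.hyps(1)[OF p]) (use Suc.prems 1 p in auto)
      then show ?thesis
      proof (elim disjE exE conjE)
        fix T assume T: "T \<subseteq> ?P" "card T = m'" "\<forall>x\<in>T. \<forall>y\<in>T. x \<noteq> y \<longrightarrow> R x y"
        have "finite T" using T(1) Suc.prems finite_subset[of T S] by auto
        moreover have "a \<notin> T" using T by auto
        ultimately show ?thesis using T a mn
          by (intro disjI1 exI[of _ "insert a T"]) (auto dest: assms(3))
      qed blast
    next
      case 2
      have p: "p = m + n'" using Suc.hyps(2) mn by simp
      have "(\<exists>T\<subseteq>?Q. card T = m \<and> (\<forall>x\<in>T. \<forall>y\<in>T. x \<noteq> y \<longrightarrow> R x y)) \<or>
         (\<exists>T\<subseteq>?Q. card T = n' \<and> (\<forall>x\<in>T. \<forall>y\<in>T. x \<noteq> y \<longrightarrow> \<not> R x y))"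
        by (rule Suc.hyps(1)[OF p]) (use Suc.prems 2 p in auto)
      then show ?thesis
      proof (elim disjE exE conjE)
        fix T assume T: "T \<subseteq> ?Q" "card T = n'" "\<forall>x\<in>T. \<forall>y\<in>T. x \<noteq> y \<longrightarrow> \<not> R x y"
        have "finite T" using T(1) Suc.prems finite_subset[of T S] by auto
        moreover have "a \<notin> T" using T by auto
        ultimately show ?thesis using T a mn
          by (intro disjI2 exI[of _ "insert a T"]) (auto dest: assms(3))
      qed blast
    qed
  qed
qed

section \<open>Bounding separated families of vertices\<close>

context sgraph begin

text \<open>Leaves are chosen greedily, \<open>k\<close> of them from each set, as leaf
  \<open>q\<close> comes from \<open>B (q div k)\<close>. No chosen leaf is complete to any
  \<open>B j\<close>; by homogeneity it therefore spoils only a small part of every set still to be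
  used.\<close>

lemma independent_leaves:
  assumes B: "\<And>i. i < k \<Longrightarrow> B i \<subseteq> V" "\<And>i. i < k \<Longrightarrow> homogeneous (4 * k\<^sup>2) (B i)"
      "\<And>i. i < k \<Longrightarrow> 8 * k\<^sup>2 \<le> card (B i)"
    and nc: "\<And>i j. i < k \<Longrightarrow> j < k \<Longrightarrow> i \<noteq> j \<Longrightarrow> \<exists>b\<in>B i. \<exists>b'\<in>B j. \<not> A b b'"
    and C: "finite C" "card C \<le> k"
  shows "p \<le> k * k \<Longrightarrow> \<exists>u. \<forall>q<p. u q \<in> B (q div k) - C \<and> (\<forall>j<k. \<not> B j \<subseteq> Collect (A (u q))) \<and>
     (\<forall>q'<q. u q \<noteq> u q' \<and> \<not> A (u q) (u q'))"
proof (induction p)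
  case 0
  then show ?case by simp
next
  case (Suc p)
  then obtain u where u: "\<And>q. q < p \<Longrightarrow> u q \<in> B (q div k) - C"
     "\<And>q j. q < p \<Longrightarrow> j < k \<Longrightarrow> \<not> B j \<subseteq> Collect (A (u q))"
     "\<And>q q'. q < p \<Longrightarrow> q' < q \<Longrightarrow> u q \<noteq> u q' \<and> \<not> A (u q) (u q')" by auto
  define i where "i = p div k"
  have k: "0 < k" using Suc.prems by (cases k) auto
  have ik: "i < k" using Suc.prems k unfolding i_def by (simp add: less_mult_imp_div_less)
  have q_lt: "q div k < k" if "q < p" for q
    using that Suc.prems by (simp add: less_mult_imp_div_less)
  define c where "c = card (B i)"
  have finB: "finite (B i)" using B(1)[OF ik] finV finite_subset by blast
  define full where "full j = {b \<in> B i. B j \<subseteq> Collect (A b)}" for j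
  \<comment> \<open>If many vertices of \<open>B i\<close> were complete to \<open>B j\<close>, each
    vertex of \<open>B j\<close> would see too much of \<open>B i\<close> for homogeneity to allow a
    miss, so the two sets would be complete to each other.\<close>
  have full: "4 * k\<^sup>2 * card (full j) \<le> c" if j: "j < k" "j \<noteq> i" for j
  proof (rule ccontr)
    assume "\<not> ?thesis"
    then have gt: "c < 4 * k\<^sup>2 * card (full j)" by simp
    have "B i \<subseteq> Collect (A b')" if b': "b' \<in> B j" for b'
    proof -
      have "full j \<subseteq> B i \<inter> Collect (A b')" using b' symA by (auto simp: full_def)
      then have "card (full j) \<le> card (B i \<inter> Collect (A b'))" using finB by (intro card_mono) auto
      then have "4 * k\<^sup>2 * card (full j) \<le> 4 * k\<^sup>2 * card (B i \<inter> Collect (A b'))" by simp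
      then have "\<not> 4 * k\<^sup>2 * card (B i \<inter> Collect (A b')) < card (B i)" using gt c_def by linarith
      moreover have "b' \<in> V" using B(1)[OF j(1)] b' by blast
      ultimately show ?thesis using B(2)[OF ik] unfolding homogeneous_def by blast
    qed
    then show False using nc[OF ik j(1)] j(2) symA by blast
  qed
  have nb: "4 * k\<^sup>2 * card (B i \<inter> Collect (A (u q))) \<le> c" if "q < p" for q
  proof -
    have "u q \<in> V" using u(1)[OF that] B(1)[OF q_lt[OF that]] by blast
    then show ?thesis using B(2)[OF ik] u(2)[OF that ik] unfolding homogeneous_def c_def by (meson less_imp_le)
  qed
  \<comment> \<open>The forbidden vertices: \<open>C\<close> and the old leaves, the vertices
    complete to another set, and the neighbors of old leaves. Each of these three groups has at most
    \<open>c / 4\<close> members.\<close>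
  define F where "F = C \<union> (\<Union>j\<in>{..<k} - {i}. full j) \<union> u ` {..<p} \<union> (\<Union>q<p. B i \<inter> Collect (A (u q)))"
  have "card F \<le> k + (\<Sum>j\<in>{..<k} - {i}. card (full j)) + p + (\<Sum>q<p. card (B i \<inter> Collect (A (u q))))"
    unfolding F_def
    by (intro order_trans[OF card_Un_le] add_mono C(2) card_UN_le order_trans[OF card_image_le]) auto
  then have "4 * k\<^sup>2 * card F \<le> 4 * k\<^sup>2 * (k + p) + (\<Sum>j\<in>{..<k} - {i}. 4 * k\<^sup>2 * card (full j)) +
      (\<Sum>q<p. 4 * k\<^sup>2 * card (B i \<inter> Collect (A (u q))))"
    unfolding sum_distrib_left[symmetric] distrib_left[symmetric] mult.assoc
    by (intro mult_le_mono) (auto simp: algebra_simps)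
  also have "\<dots> \<le> 4 * k\<^sup>2 * (k + p) + (\<Sum>j\<in>{..<k} - {i}. c) + (\<Sum>q<p. c)"
    by (intro add_mono sum_mono order_refl full nb) auto
  also have "\<dots> \<le> 4 * k\<^sup>2 * (2 * k\<^sup>2) + k\<^sup>2 * c + k\<^sup>2 * c"
  proof (intro add_mono mult_le_mono order_refl)
    have "k \<le> k * k" using k by simp
    then show "k + p \<le> 2 * k\<^sup>2" unfolding power2_eq_square using Suc.prems by linarith
    have "k - 1 \<le> k\<^sup>2" unfolding power2_eq_square using \<open>k \<le> k * k\<close> by linarith
    then show "(\<Sum>j\<in>{..<k} - {i}. c) \<le> k\<^sup>2 * c" using ik by simp
    show "(\<Sum>q<p. c) \<le> k\<^sup>2 * c" using Suc.prems by (simp add: power2_eq_square)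
  qed
  also have "\<dots> \<le> k\<^sup>2 * c + k\<^sup>2 * c + k\<^sup>2 * c"
    using mult_le_mono2[OF B(3)[OF ik], of "k\<^sup>2"] by (simp add: c_def algebra_simps)
  also have "\<dots> < 4 * k\<^sup>2 * c"
    using k B(3)[OF ik] by (cases "c = 0") (auto simp: c_def)
  finally have "card F < card (B i)" using k by (simp add: c_def)
  moreover have "finite F"
  proof -
    have "finite (full j)" for j using finB by (simp add: full_def)
    then show ?thesis using C(1) finB by (auto simp: F_def)
  qed
  ultimately have "\<not> B i \<subseteq> F" using card_mono[of F "B i"] by linarith
  then obtain w where w: "w \<in> B i" "w \<notin> F" by blast
  have w1: "w \<notin> C" "w \<noteq> u q" "\<not> A (u q) w" if "q < p" for q using w that by (auto simp: F_def)
  have w2: "\<not> B j \<subseteq> Collect (A w)" if "j < k" for j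
  proof (cases "j = i")
    case True
    then show ?thesis using w(1) irrA by auto
  next
    case False
    then show ?thesis using w that by (auto simp: F_def full_def)
  qed
  show ?case
  proof (intro exI[of _ "u(p := w)"] allI impI)
    fix q assume q: "q < Suc p"
    show "(u(p := w)) q \<in> B (q div k) - C \<and> (\<forall>j<k. \<not> B j \<subseteq> Collect (A ((u(p := w)) q))) \<and>
      (\<forall>q'<q. (u(p := w)) q \<noteq> (u(p := w)) q' \<and> \<not> A ((u(p := w)) q) ((u(p := w)) q'))"
    proof (cases "q = p")
      case True
      have "w \<notin> C" using w(2) by (auto simp: F_def)
      moreover have "\<not> A w (u q')" if "q' < p" for q' using w1(3)[OF that] symA by blast
      ultimately show ?thesis using True w w1 w2 by (auto simp: i_def)
    next
      case False
      then show ?thesis using q u[of q] by auto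
    qed
  qed
qed

text \<open>The leaf sets are first thinned to homogeneous ones. Ramsey's theorem for the relation
  "complete to each other" then gives either a clique with one leaf from each of \<open>k\<close>
  sets, or \<open>k\<close> stars to which \<open>independent_leaves\<close> applies.\<close>

lemma stars_witness:
  fixes a :: "nat \<Rightarrow> 'a" and B :: "nat \<Rightarrow> 'a set"
  assumes k: "0 < k"
    and B: "\<And>i. i < 2 ^ (k + k) \<Longrightarrow> B i \<subseteq> V" "\<And>i. i < 2 ^ (k + k) \<Longrightarrow> (8 * k\<^sup>2) ^ Suc k \<le> card (B i)"
    and a: "\<And>i. i < 2 ^ (k + k) \<Longrightarrow> a i \<in> V" "\<And>i b. i < 2 ^ (k + k) \<Longrightarrow> b \<in> B i \<Longrightarrow> A (a i) b"
    and sep: "\<And>i j. i < 2 ^ (k + k) \<Longrightarrow> j < i \<Longrightarrow> a i \<noteq> a j"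
      "\<And>i j b. i < 2 ^ (k + k) \<Longrightarrow> j < i \<Longrightarrow> b \<in> B j \<Longrightarrow> \<not> A b (a i)"
  shows "\<exists>w. witness k w"
proof (rule ccontr)
  assume nw: "\<not> ?thesis"
  let ?t = "2 ^ (k + k) :: nat"
  have "\<exists>X\<subseteq>B i. 8 * k\<^sup>2 \<le> card X \<and> homogeneous (4 * k\<^sup>2) X" if i: "i < ?t" for i
  proof -
    have "0 < card (B i)" using B(2)[OF i] k by (auto intro: less_le_trans[rotated])
    then have "B i \<noteq> {}" by auto
    from homogeneous_subset[OF nw B(1)[OF i] this, of "4 * k\<^sup>2"] k obtain X where
      X: "X \<subseteq> B i" "card (B i) \<le> (2 * (4 * k\<^sup>2)) ^ k * card X" "homogeneous (4 * k\<^sup>2) X" by auto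
    have "2 * (4 * k\<^sup>2) = 8 * k\<^sup>2" by simp
    then have "(8 * k\<^sup>2) ^ k * (8 * k\<^sup>2) \<le> (8 * k\<^sup>2) ^ k * card X"
      using order_trans[OF B(2)[OF i] X(2)] by (simp only: power_Suc2)
    then have "8 * k\<^sup>2 \<le> card X" using k by simp
    then show ?thesis using X by blast
  qed
  then obtain B' where B': "\<And>i. i < ?t \<Longrightarrow> B' i \<subseteq> B i" "\<And>i. i < ?t \<Longrightarrow> 8 * k\<^sup>2 \<le> card (B' i)"
    "\<And>i. i < ?t \<Longrightarrow> homogeneous (4 * k\<^sup>2) (B' i)" by metis
  define R where "R i j \<longleftrightarrow> (\<forall>b\<in>B' i. \<forall>b'\<in>B' j. A b b')" for i j
  have "R j i" if "R i j" for i j using that symA unfolding R_def by blast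
  from ramsey_two_power[of "{..<?t}" k k R, OF _ _ this]
  consider T where "T \<subseteq> {..<?t}" "card T = k" "\<forall>x\<in>T. \<forall>y\<in>T. x \<noteq> y \<longrightarrow> R x y"
    | T where "T \<subseteq> {..<?t}" "card T = k" "\<forall>x\<in>T. \<forall>y\<in>T. x \<noteq> y \<longrightarrow> \<not> R x y" by auto
  then show False
  proof cases
    case 1
    have "finite T" using 1(1) finite_subset by blast
    then obtain f where f: "bij_betw f {..<k} T" using ex_bij_betw_nat_finite[of T] 1(2) by (auto simp: atLeast0LessThan)
    have fT: "f i \<in> T" "f i < ?t" if "i < k" for i using f that 1(1) by (auto simp: bij_betw_def)
    have "\<exists>b. b \<in> B' (f i)" if "i < k" for i
      using B'(2)[OF fT(2)[OF that]] k by (metis card.empty ex_in_conv le_zero_eq mult_eq_0_iff power_eq_0_iff not_gr_zero zero_neq_numeral)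
    then obtain w where w: "\<And>i. i < k \<Longrightarrow> w i \<in> B' (f i)" by metis
    have wA: "A (w i) (w j)" if "i < k" "j < k" "i \<noteq> j" for i j
    proof -
      have "f i \<noteq> f j" using f that by (auto simp: bij_betw_def inj_on_def)
      then have "R (f i) (f j)" using 1(3) fT that by blast
      then show ?thesis using w that by (auto simp: R_def)
    qed
    have wV: "w i \<in> V" if "i < k" for i using w[OF that] B' B fT(2)[OF that] by blast
    \<comment> \<open>In a clique each vertex acts both as a center and as a leaf of all later
      centers.\<close>
    have "witness k (\<lambda>i j. if j < i then w j else w j)"
    proof (rule witness_of_stars)
      show "w i \<noteq> w j" if "i < k" "j < k" "i \<noteq> j" for i j using wA[OF that] irrA by metis
      then show "w j \<noteq> w j'" if "j < i" "i < k" "j' < i'" "i' < k" "j \<noteq> j'" for i i' j j'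
        using that by simp
      then show "w j \<noteq> w j'" if "j < i" "i < k" "j' < k" "j' \<noteq> j" for i j j'
        using that \<open>\<And>j i. i < k \<Longrightarrow> j < k \<Longrightarrow> i \<noteq> j \<Longrightarrow> w i \<noteq> w j\<close> by simp
    qed (use wV wA irrA in auto)
    then show False using nw by blast
  next
    case 2
    have finT: "finite T" using 2(1) finite_subset by blast
    \<comment> \<open>The order is reversed: leaves miss only centers of later stars, whereas a leaf
      of color \<open>j\<close> in row \<open>i > j\<close> has to miss the center of row
      \<open>j\<close>.\<close>
    define g where "g i = sorted_list_of_set T ! (k - Suc i)" for i
    have len: "length (sorted_list_of_set T) = k" using 2(2) by simp
    have gT: "g i \<in> T" "g i < ?t" if "i < k" for i
    proof -
      have "g i \<in> set (sorted_list_of_set T)" unfolding g_def using len k by (intro nth_mem) simp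
      then show "g i \<in> T" using finT by simp
      then show "g i < ?t" using 2(1) by blast
    qed
    have gdec: "g i < g j" if "j < i" "i < k" for i j
      unfolding g_def using that len
      by (intro sorted_wrt_nth_less[OF strict_sorted_list_of_set]) auto
    have gneq: "g i \<noteq> g j" if "i < k" "j < k" "i \<noteq> j" for i j
      using gdec[of i j] gdec[of j i] that by (cases i j rule: linorder_cases) auto
    \<comment> \<open>Excluding the centers keeps leaves and centers distinct.\<close>
    define C where "C = (\<lambda>j. a (g j)) ` {..<k}"
    have C: "finite C" "card C \<le> k" unfolding C_def using card_image_le[of "{..<k}"] by auto
    have "\<exists>u. \<forall>q<k * k. u q \<in> B' (g (q div k)) - C \<and> (\<forall>j<k. \<not> B' (g j) \<subseteq> Collect (A (u q))) \<and>
       (\<forall>q'<q. u q \<noteq> u q' \<and> \<not> A (u q) (u q'))"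
    proof (rule independent_leaves[OF _ _ _ _ C])
      show "B' (g i) \<subseteq> V" "homogeneous (4 * k\<^sup>2) (B' (g i))" "8 * k\<^sup>2 \<le> card (B' (g i))" if "i < k" for i
        using gT(2)[OF that] B' B by blast+
      show "\<exists>b\<in>B' (g i). \<exists>b'\<in>B' (g j). \<not> A b b'" if "i < k" "j < k" "i \<noteq> j" for i j
        using 2(3) gT gneq[OF that] that unfolding R_def by blast
    qed simp
    then obtain l where l: "\<And>q. q < k * k \<Longrightarrow> l q \<in> B' (g (q div k)) - C"
      "\<And>q q'. q < k * k \<Longrightarrow> q' < q \<Longrightarrow> l q \<noteq> l q' \<and> \<not> A (l q) (l q')" by blast
    have l2: "l q \<noteq> l q' \<and> \<not> A (l q) (l q')" if "q < k * k" "q' < k * k" "q \<noteq> q'" for q q'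
      using l(2)[of q q'] l(2)[of q' q] that symA[of "l q" "l q'"] by (cases q q' rule: linorder_cases) auto
    \<comment> \<open>Leaf number \<open>i * k + j\<close> belongs to star \<open>i\<close> and
      receives color \<open>j\<close>.\<close>
    let ?u = "\<lambda>i j. l (i * k + j)"
    have ix: "i * k + j < k * k" if "i < k" "j < k" for i j
    proof -
      have "Suc i * k \<le> k * k" using that by (intro mult_le_mono) auto
      then show ?thesis using that by simp
    qed
    have uB: "?u i j \<in> B (g i)" "?u i j \<notin> C" if "i < k" "j < k" for i j
      using l(1)[OF ix[OF that]] that B'(1)[OF gT(2)] by auto
    have "witness k (\<lambda>i j. if j < i then ?u i j else a (g j))"
    proof (rule witness_of_stars)
      show "a (g j) \<in> V" if "j < k" for j using a gT that by blast
      show "?u i j \<in> V" if "j < i" "i < k" for i j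
        using uB(1)[of i j] that B(1)[OF gT(2)[of i]] by auto
      show "a (g i) \<noteq> a (g j)" if "i < k" "j < k" "i \<noteq> j" for i j
        using that sep(1)[OF gT(2), of i "g j"] sep(1)[OF gT(2), of j "g i"] gdec[of i j] gdec[of j i]
        by (cases i j rule: linorder_cases) auto
      show "A (a (g i)) (?u i j)" if "j < i" "i < k" for i j
        using a(2)[OF gT(2)[of i]] uB(1)[of i j] that by simp
      show "\<not> A (?u i j) (?u i' j)" if "j < i" "i < k" "j < i'" "i' < k" for i i' j
      proof (cases "i = i'")
        case True
        then show ?thesis using irrA by simp
      next
        case False
        then show ?thesis using l2[OF ix[of i j] ix[of i' j]] that k by simp
      qed
      show "\<not> A (?u i j) (a (g j))" if "j < i" "i < k" for i j
        using sep(2)[OF gT(2)[of j] gdec[of j i]] uB(1)[of i j] that by simp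
      show "?u i j \<noteq> ?u i' j'" if "j < i" "i < k" "j' < i'" "i' < k" "j \<noteq> j'" for i i' j j'
      proof -
        have "(i * k + j) mod k \<noteq> (i' * k + j') mod k" using that by simp
        then have "i * k + j \<noteq> i' * k + j'" by metis
        then show ?thesis using l2[OF ix[of i j] ix[of i' j']] that by auto
      qed
      show "?u i j \<noteq> a (g j')" if "j < i" "i < k" "j' < k" "j' \<noteq> j" for i j j'
        using uB(2)[of i j] that unfolding C_def by auto
    qed
    then show False using nw by blast
  qed
qed

text \<open>A vertex complete to \<open>R\<close> does not distinguish members of \<open>R\<close>.
  Hence at most one member has fewer than \<open>h\<close> neighbors that are not complete to
  \<open>R\<close>. Leaves are taken among such neighbors; by homogeneity each excludes at most a
  fraction \<open>1 / e\<close> of \<open>R\<close> as later centers, so another center always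
  remains.\<close>

lemma star_family:
  assumes R: "R \<subseteq> V" "homogeneous e R" and e: "4 * (t * h) \<le> e" "0 < e"
    and big: "4 * (1 + t + t * h) \<le> card R"
    and far: "\<And>x y. x \<in> R \<Longrightarrow> y \<in> R \<Longrightarrow> x \<noteq> y \<Longrightarrow> 2 * h \<le> card {w \<in> V. A x w \<noteq> A y w}"
  shows "s \<le> t \<Longrightarrow> \<exists>a B. \<forall>i<s. a i \<in> R \<and> B i \<subseteq> V \<and> card (B i) = h \<and> (\<forall>b\<in>B i. A (a i) b \<and> \<not> R \<subseteq> Collect (A b)) \<and>
     (\<forall>j<i. a i \<noteq> a j \<and> (\<forall>b\<in>B j. \<not> A b (a i)))"
proof (induction s)
  case 0
  then show ?case by simp
next
  case (Suc s)
  then have "s \<le> t" by simp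
  from Suc.IH[OF this] obtain a B where aB0: "\<forall>i<s. a i \<in> R \<and> B i \<subseteq> V \<and> card (B i) = h \<and>
     (\<forall>b\<in>B i. A (a i) b \<and> \<not> R \<subseteq> Collect (A b)) \<and> (\<forall>j<i. a i \<noteq> a j \<and> (\<forall>b\<in>B j. \<not> A b (a i)))" by blast
  then have aB: "\<And>i. i < s \<Longrightarrow> a i \<in> R" "\<And>i. i < s \<Longrightarrow> B i \<subseteq> V" "\<And>i. i < s \<Longrightarrow> card (B i) = h"
    "\<And>i b. i < s \<Longrightarrow> b \<in> B i \<Longrightarrow> A (a i) b \<and> \<not> R \<subseteq> Collect (A b)"
    "\<And>i j. i < s \<Longrightarrow> j < i \<Longrightarrow> a i \<noteq> a j \<and> (\<forall>b\<in>B j. \<not> A b (a i))" by blast+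
  have finR: "finite R" using R finV finite_subset by blast
  have finB: "finite (B i)" if "i < s" for i using aB(2)[OF that] finV finite_subset by blast
  define P where "P x = {w \<in> V. A x w \<and> \<not> R \<subseteq> Collect (A w)}" for x
  have finP: "finite (P x)" for x using finV by (simp add: P_def)
  define Y where "Y = {x \<in> R. card (P x) < h}"
  have "card Y \<le> 1"
  proof -
    have "x = y" if "x \<in> Y" "y \<in> Y" for x y
    proof (rule ccontr)
      assume "x \<noteq> y"
      then have "2 * h \<le> card {w \<in> V. A x w \<noteq> A y w}" using far that by (auto simp: Y_def)
      also have "\<dots> \<le> card (P x \<union> P y)"
      proof (rule card_mono)
        show "{w \<in> V. A x w \<noteq> A y w} \<subseteq> P x \<union> P y"
        proof
          fix w assume "w \<in> {w \<in> V. A x w \<noteq> A y w}"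
          moreover from this have "\<not> R \<subseteq> Collect (A w)" using that symA unfolding Y_def by blast
          ultimately show "w \<in> P x \<union> P y" by (auto simp: P_def)
        qed
      qed (simp add: finP)
      also have "\<dots> \<le> card (P x) + card (P y)" by (rule card_Un_le)
      also have "\<dots> < 2 * h" using that by (auto simp: Y_def)
      finally show False by simp
    qed
    then show ?thesis using card_le_Suc0_iff_eq[of Y] finR by (simp add: Y_def)
  qed
  define F where "F = Y \<union> a ` {..<s} \<union> (\<Union>j<s. \<Union>b\<in>B j. R \<inter> Collect (A b))"
  have nb: "e * card (R \<inter> Collect (A b)) \<le> card R" if "j < s" "b \<in> B j" for j b
  proof -
    have "b \<in> V" using aB(2) that by blast
    then show ?thesis using R(2) aB(4)[OF that] unfolding homogeneous_def by (meson less_imp_le)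
  qed
  have "card F \<le> 1 + s + (\<Sum>j<s. \<Sum>b\<in>B j. card (R \<inter> Collect (A b)))"
    unfolding F_def
    by (intro order_trans[OF card_Un_le] add_mono \<open>card Y \<le> 1\<close> order_trans[OF card_UN_le] sum_mono
        order_trans[OF card_image_le]) (auto simp: finB)
  then have "e * card F \<le> e * (1 + s + (\<Sum>j<s. \<Sum>b\<in>B j. card (R \<inter> Collect (A b))))" by (rule mult_le_mono2)
  also have "\<dots> = e * (1 + s) + (\<Sum>j<s. \<Sum>b\<in>B j. e * card (R \<inter> Collect (A b)))"
    by (simp add: distrib_left sum_distrib_left)
  also have "\<dots> \<le> e * (1 + s) + (\<Sum>j<s. \<Sum>b\<in>B j. card R)"
    by (intro add_mono sum_mono nb) auto
  also have "\<dots> = e * (1 + s) + s * h * card R" using aB(3) by simp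
  also have "\<dots> \<le> e * (1 + t) + t * h * card R" using Suc.prems by (intro add_mono mult_le_mono) auto
  finally have "4 * (e * card F) \<le> e * (4 * (1 + t)) + 4 * (t * h) * card R" by (simp add: algebra_simps)
  also have "\<dots> \<le> e * card R + e * card R" using big e by (intro add_mono mult_le_mono) auto
  also have "\<dots> < 4 * (e * card R)" using big e by simp
  finally have "card F < card R" using e by simp
  moreover have "finite F" using finR finB by (auto simp: F_def Y_def)
  ultimately have "\<not> R \<subseteq> F" using card_mono[of F R] by linarith
  then obtain x where x: "x \<in> R" "x \<notin> F" by blast
  then have "h \<le> card (P x)" by (auto simp: F_def Y_def)
  then obtain D where D: "D \<subseteq> P x" "card D = h" using obtain_subset_with_card_n by metis
  have xF: "x \<noteq> a j" "\<forall>b\<in>B j. \<not> A b x" if "j < s" for j using x that by (auto simp: F_def)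
  show ?case
  proof (intro exI[of _ "a(s := x)"] exI[of _ "B(s := D)"] allI impI)
    fix i assume i: "i < Suc s"
    show "(a(s := x)) i \<in> R \<and> (B(s := D)) i \<subseteq> V \<and> card ((B(s := D)) i) = h \<and>
      (\<forall>b\<in>(B(s := D)) i. A ((a(s := x)) i) b \<and> \<not> R \<subseteq> Collect (A b)) \<and>
      (\<forall>j<i. (a(s := x)) i \<noteq> (a(s := x)) j \<and> (\<forall>b\<in>(B(s := D)) j. \<not> A b ((a(s := x)) i)))"
    proof (cases "i = s")
      case True
      then show ?thesis using x D xF by (auto simp: P_def)
    next
      case False
      then show ?thesis using i aB[of i] by auto
    qed
  qed
qed

theorem separated_family_bound:
  assumes nw: "\<nexists>w. witness k w" and k: "0 < k" and R: "R \<subseteq> V"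
    and far: "\<And>x y. x \<in> R \<Longrightarrow> y \<in> R \<Longrightarrow> x \<noteq> y \<Longrightarrow> 2 ^ (11 * k\<^sup>2) < card {w \<in> V. A x w \<noteq> A y w}"
  shows "card R \<le> 2 ^ (35 * k ^ 3)"
proof (rule ccontr)
  assume "\<not> ?thesis"
  then have gt: "2 ^ (35 * k ^ 3) < card R" by simp
  \<comment> \<open>\<open>t\<close> suffices for Ramsey's theorem and \<open>h\<close> for the leaf
    sets of \<open>stars_witness\<close>; \<open>e\<close> is so large that all \<open>t * h\<close>
    leaves exclude at most a quarter of the family. The exponent \<open>35 * k ^ 3\<close> pays for
    the loss of \<open>(2 * e) ^ k\<close> and leaves at least \<open>2 ^ (20 * k\<^sup>2)\<close>
    vertices.\<close>
  define h e t :: nat where "h = 2 ^ (10 * k\<^sup>2)" and "e = 2 ^ (14 * k\<^sup>2)" and "t = 2 ^ (k + k)"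
  have k2: "k \<le> k\<^sup>2" "1 \<le> k\<^sup>2" using k by (auto simp: power2_eq_square)
  have k3: "k\<^sup>2 \<le> k ^ 3" "k \<le> k ^ 3" "k\<^sup>2 * k = k ^ 3" using k k2 by (auto simp: power2_eq_square power3_eq_cube)
  have "R \<noteq> {}" using gt by auto
  from homogeneous_subset[OF nw R this, of e] obtain R' where
    R': "R' \<subseteq> R" "R' \<noteq> {}" "card R \<le> (2 * e) ^ k * card R'" "homogeneous e R'" by (auto simp: e_def)
  have "(2 * e) ^ k = 2 ^ (14 * k ^ 3 + k)"
  proof -
    have "2 * e = 2 ^ (14 * k\<^sup>2 + 1)" by (simp add: e_def)
    then have "(2 * e) ^ k = 2 ^ ((14 * k\<^sup>2 + 1) * k)" by (simp only: power_mult)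
    also have "(14 * k\<^sup>2 + 1) * k = 14 * k ^ 3 + k" using k3(3) by (simp add: algebra_simps)
    finally show ?thesis .
  qed
  then have "2 ^ (35 * k ^ 3) \<le> 2 ^ (14 * k ^ 3 + k) * card R'" using less_imp_le[OF less_le_trans[OF gt R'(3)]] by simp
  moreover have "(2::nat) ^ (35 * k ^ 3) = 2 ^ (14 * k ^ 3 + k) * 2 ^ (21 * k ^ 3 - k)"
    using k3 by (simp flip: power_add)
  ultimately have "2 ^ (21 * k ^ 3 - k) \<le> card R'" by simp
  moreover have "(2::nat) ^ (20 * k\<^sup>2) \<le> 2 ^ (21 * k ^ 3 - k)" using k3 by (intro power_increasing) auto
  ultimately have cR: "2 ^ (20 * k\<^sup>2) \<le> card R'" by linarith
  have th: "t * h = 2 ^ (k + k + 10 * k\<^sup>2)" unfolding t_def h_def by (simp only: power_add)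
  have "4 * (t * h) = 2 ^ (2 + (k + k + 10 * k\<^sup>2))" unfolding th by (simp add: power_add)
  also have "\<dots> \<le> e" unfolding e_def using k2 by (intro power_increasing) auto
  finally have e1: "4 * (t * h) \<le> e" .
  have "4 * (1 + t + z) \<le> 16 * z" if "t \<le> z" "1 \<le> z" for z using that by simp
  moreover have "t \<le> t * h" by (simp add: h_def)
  moreover have "1 \<le> t * h" by (simp add: th)
  ultimately have "4 * (1 + t + t * h) \<le> 16 * (t * h)" by blast
  also have "\<dots> = 2 ^ (4 + (k + k + 10 * k\<^sup>2))" unfolding th by (simp add: power_add)
  also have "\<dots> \<le> 2 ^ (20 * k\<^sup>2)" using k2 by (intro power_increasing) auto
  finally have big: "4 * (1 + t + t * h) \<le> card R'" using cR by linarith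
  have far': "2 * h \<le> card {w \<in> V. A x w \<noteq> A y w}" if "x \<in> R'" "y \<in> R'" "x \<noteq> y" for x y
  proof -
    have "2 * h = 2 ^ Suc (10 * k\<^sup>2)" by (simp add: h_def)
    also have "\<dots> \<le> 2 ^ (11 * k\<^sup>2)" using k2 by (intro power_increasing) auto
    finally show ?thesis using far[of x y] that R' by fastforce
  qed
  have "R' \<subseteq> V" using R R' by blast
  from star_family[OF this R'(4) e1 _ big far', of t] obtain a B where
    "\<forall>i<t. a i \<in> R' \<and> B i \<subseteq> V \<and> card (B i) = h \<and> (\<forall>b\<in>B i. A (a i) b \<and> \<not> R' \<subseteq> Collect (A b)) \<and>
      (\<forall>j<i. a i \<noteq> a j \<and> (\<forall>b\<in>B j. \<not> A b (a i)))" by (auto simp: e_def)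
  then have aB: "\<And>i. i < t \<Longrightarrow> a i \<in> R'" "\<And>i. i < t \<Longrightarrow> B i \<subseteq> V" "\<And>i. i < t \<Longrightarrow> card (B i) = h"
    "\<And>i b. i < t \<Longrightarrow> b \<in> B i \<Longrightarrow> A (a i) b"
    "\<And>i j. i < t \<Longrightarrow> j < i \<Longrightarrow> a i \<noteq> a j \<and> (\<forall>b\<in>B j. \<not> A b (a i))" by blast+
  have "(8 * k\<^sup>2) ^ Suc k \<le> h"
  proof -
    have "k \<le> 2 ^ k" using less_exp[of k] by simp
    then have "k\<^sup>2 \<le> 2 ^ (k + k)" by (simp only: power_add power2_eq_square mult_le_mono)
    then have "8 * k\<^sup>2 \<le> 2 ^ 3 * 2 ^ (k + k)" by simp
    then have "8 * k\<^sup>2 \<le> 2 ^ (3 + (k + k))" by (simp only: power_add)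
    also have "\<dots> \<le> 2 ^ (5 * k)" using k by (intro power_increasing) auto
    finally have "(8 * k\<^sup>2) ^ Suc k \<le> (2 ^ (5 * k)) ^ Suc k" by (intro power_mono) auto
    also have "\<dots> = 2 ^ (5 * k * Suc k)" by (simp only: power_mult)
    also have "\<dots> \<le> 2 ^ (10 * k\<^sup>2)" using k2 by (intro power_increasing) (auto simp: power2_eq_square algebra_simps)
    finally show ?thesis by (simp add: h_def)
  qed
  then have "\<exists>w. witness k w"
    using aB \<open>R' \<subseteq> V\<close> k
    by (intro stars_witness[of k B a]) (auto simp: t_def)
  then show False using nw by blast
qed

end

section \<open>Balls, and certificates versus colorings\<close>

context sgraph begin

definition dist :: "'a \<Rightarrow> 'a \<Rightarrow> nat" where "dist x y = card {w \<in> V. A x w \<noteq> A y w}"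
definition ball :: "nat \<Rightarrow> 'a \<Rightarrow> 'a set" where "ball d r = {v \<in> V. dist r v \<le> d}"

lemma finite_ball: "finite (ball d r)" using finV by (simp add: ball_def)

lemma dist_commute: "dist x y = dist y x"
  unfolding dist_def by (rule arg_cong[of _ _ card]) auto

lemma ball_deviation: "v \<in> ball d r \<Longrightarrow> S \<subseteq> V \<Longrightarrow> card {u \<in> S. A v u \<noteq> A r u} \<le> d"
  by (rule order_trans[OF card_mono[of "{w \<in> V. A r w \<noteq> A v w}"]]) (auto simp: ball_def dist_def finV)

text \<open>Double counting: in every pair from \<open>X\<close> and \<open>Y\<close> one vertex
  deviates from the center of its ball, and each vertex deviates at most \<open>d\<close> times. So
  \<open>card X * card Y\<close> is at most \<open>d * (card X + card Y)\<close>.\<close>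

lemma discordant_balls:
  assumes X: "X \<subseteq> ball d r" "\<And>v. v \<in> X \<Longrightarrow> A s v = \<beta>" and Y: "Y \<subseteq> ball d s" "\<And>u. u \<in> Y \<Longrightarrow> A r u \<noteq> \<beta>"
  shows "card X \<le> 2 * d \<or> card Y \<le> 2 * d"
proof (rule ccontr)
  assume "\<not> ?thesis"
  then have gt: "2 * d < card X" "2 * d < card Y" by auto
  have fin: "finite X" "finite Y" using X Y finite_ball finite_subset by blast+
  have sub: "X \<subseteq> V" "Y \<subseteq> V" using X Y by (auto simp: ball_def)
  have "X \<times> Y \<subseteq> (SIGMA v:X. {u \<in> Y. A v u \<noteq> A r u}) \<union> (\<lambda>(u, v). (v, u)) ` (SIGMA u:Y. {v \<in> X. A u v \<noteq> A s v})"
  proof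
    fix z assume "z \<in> X \<times> Y"
    then obtain v u where z: "z = (v, u)" "v \<in> X" "u \<in> Y" by auto
    have "A v u = A u v" using symA by blast
    then have "A v u \<noteq> A r u \<or> A u v \<noteq> A s v" using X(2)[OF z(2)] Y(2)[OF z(3)] by auto
    then show "z \<in> (SIGMA v:X. {u \<in> Y. A v u \<noteq> A r u}) \<union> (\<lambda>(u, v). (v, u)) ` (SIGMA u:Y. {v \<in> X. A u v \<noteq> A s v})"
      using z by (auto simp: image_iff)
  qed
  then have "card (X \<times> Y) \<le> card (SIGMA v:X. {u \<in> Y. A v u \<noteq> A r u}) +
      card ((\<lambda>(u, v). (v, u)) ` (SIGMA u:Y. {v \<in> X. A u v \<noteq> A s v}))"
    by (intro order_trans[OF card_mono card_Un_le]) (use fin in auto)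
  also have "\<dots> \<le> (\<Sum>v\<in>X. card {u \<in> Y. A v u \<noteq> A r u}) + (\<Sum>u\<in>Y. card {v \<in> X. A u v \<noteq> A s v})"
    using fin by (intro add_mono order_trans[OF card_image_le]) auto
  also have "\<dots> \<le> (\<Sum>v\<in>X. d) + (\<Sum>u\<in>Y. d)"
    by (intro add_mono sum_mono ball_deviation) (use X Y sub in auto)
  finally have "2 * (card X * card Y) \<le> card X * (2 * d) + card Y * (2 * d)"
    by (simp add: card_cartesian_product algebra_simps)
  also have "\<dots> < card X * card Y + card Y * card X"
    using gt by (intro add_strict_mono mult_strict_left_mono) auto
  finally show False by simp
qed

text \<open>Sort each ball by adjacency to the center of the other. One type exceeds
  \<open>2 * d\<close> in each ball, and \<open>discordant_balls\<close> forces the two types to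
  agree. The opposite type has at most \<open>2 * d\<close> vertices, and the deviation of an
  arbitrary vertex from its center adds \<open>d\<close>.\<close>

lemma ball_pair_regular:
  assumes "4 * d < card (ball d r)" "4 * d < card (ball d s)"
  shows "\<exists>b. (\<forall>v\<in>ball d r. card {u \<in> ball d s. A v u \<noteq> b} \<le> 3 * d) \<and>
             (\<forall>u\<in>ball d s. card {v \<in> ball d r. A u v \<noteq> b} \<le> 3 * d)"
proof -
  define T where "T \<beta> = {v \<in> ball d r. A s v = \<beta>}" for \<beta>
  define U where "U \<beta> = {u \<in> ball d s. A r u = \<beta>}" for \<beta>
  have dis: "card (T \<beta>) \<le> 2 * d \<or> card (U (\<not> \<beta>)) \<le> 2 * d" for \<beta>
    by (rule discordant_balls[of _ d r s \<beta>]) (auto simp: T_def U_def)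
  have "card (ball d r) \<le> card (T True) + card (T False)"
    by (rule order_trans[OF card_mono card_Un_le]) (auto simp: T_def finite_ball)
  moreover have "card (ball d s) \<le> card (U True) + card (U False)"
    by (rule order_trans[OF card_mono card_Un_le]) (auto simp: U_def finite_ball)
  ultimately have "card (T False) \<le> 2 * d \<and> card (U False) \<le> 2 * d \<or> card (T True) \<le> 2 * d \<and> card (U True) \<le> 2 * d"
    using assms dis[of True] dis[of False] by simp linarith
  then obtain b where b: "card (T (\<not> b)) \<le> 2 * d" "card (U (\<not> b)) \<le> 2 * d" by (metis (full_types))
  have "card {u \<in> ball d s. A v u \<noteq> b} \<le> 3 * d" if v: "v \<in> ball d r" for v
  proof -
    have "card {u \<in> ball d s. A v u \<noteq> b} \<le> card (U (\<not> b)) + card {u \<in> ball d s. A v u \<noteq> A r u}"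
      by (rule order_trans[OF card_mono card_Un_le]) (auto simp: U_def finite_ball)
    moreover have "card {u \<in> ball d s. A v u \<noteq> A r u} \<le> d"
      by (rule ball_deviation[OF v]) (auto simp: ball_def)
    ultimately show ?thesis using b by simp
  qed
  moreover have "card {v \<in> ball d r. A u v \<noteq> b} \<le> 3 * d" if u: "u \<in> ball d s" for u
  proof -
    have "card {v \<in> ball d r. A u v \<noteq> b} \<le> card (T (\<not> b)) + card {v \<in> ball d r. A u v \<noteq> A s v}"
      by (rule order_trans[OF card_mono card_Un_le]) (auto simp: T_def finite_ball)
    moreover have "card {v \<in> ball d r. A u v \<noteq> A s v} \<le> d"
      by (rule ball_deviation[OF u]) (auto simp: ball_def)
    ultimately show ?thesis using b by simp
  qed
  ultimately show ?thesis by blast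
qed

end

section \<open>Equivalence of certificates and partial Grundy colorings\<close>

lemma sgraph_of_pair_graph:
  assumes "pair_graph G" shows "sgraph (pverts G) (\<lambda>u v. (u, v) \<in> parcs G)"
proof -
  interpret pair_graph G by fact
  show ?thesis
    by unfold_locales (auto dest: arcs_symmetric no_loops' simp: pair_finite_verts)
qed

lemma witness_of_coloring:
  assumes G: "pair_graph G" and c: "partial_grundy_coloring G k' c" and k: "k \<le> k'"
  shows "\<exists>x. sgraph.witness (pverts G) (\<lambda>u v. (u, v) \<in> parcs G) k x"
proof -
  interpret sgraph "pverts G" "\<lambda>u v. (u, v) \<in> parcs G" by (rule sgraph_of_pair_graph[OF G])
  have "\<forall>i\<in>{1..k'}. \<exists>v\<in>pverts G. c v = i \<and> (\<forall>j\<in>{1..i - 1}. \<exists>u\<in>pverts G. (v, u) \<in> parcs G \<and> c u = j)"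
    and proper: "\<And>u v. (u, v) \<in> parcs G \<Longrightarrow> c u \<noteq> c v"
    using c by (auto simp: partial_grundy_coloring_def)
  then obtain v where v: "\<And>i. i \<in> {1..k'} \<Longrightarrow> v i \<in> pverts G \<and> c (v i) = i \<and>
      (\<forall>j\<in>{1..i - 1}. \<exists>u\<in>pverts G. (v i, u) \<in> parcs G \<and> c u = j)" by metis
  then have "\<forall>i j. \<exists>u. i \<in> {1..k'} \<longrightarrow> j \<in> {1..i - 1} \<longrightarrow> u \<in> pverts G \<and> (v i, u) \<in> parcs G \<and> c u = j" by blast
  then obtain u where u: "\<And>i j. i \<in> {1..k'} \<Longrightarrow> j \<in> {1..i - 1} \<Longrightarrow>
      u i j \<in> pverts G \<and> (v i, u i j) \<in> parcs G \<and> c (u i j) = j" by metis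
  \<comment> \<open>Colors start at 1, columns at 0.\<close>
  define v' where "v' j = v (Suc j)" for j
  define u' where "u' i j = u (Suc i) (Suc j)" for i j
  have v': "v' j \<in> pverts G" "c (v' j) = Suc j" if "j < k" for j
    using v[of "Suc j"] that k by (auto simp: v'_def)
  have u': "u' i j \<in> pverts G" "(v' i, u' i j) \<in> parcs G" "c (u' i j) = Suc j" if "j < i" "i < k" for i j
    using u[of "Suc i" "Suc j"] that k by (auto simp: u'_def v'_def)
  have "witness k (\<lambda>i j. if j < i then u' i j else v' j)"
  proof (rule witness_of_stars)
    show "v' i \<noteq> v' j" if "i < k" "j < k" "i \<noteq> j" for i j
      using v'(2)[of i] v'(2)[of j] that by auto
    show "(u' i j, u' i' j) \<notin> parcs G" if "j < i" "i < k" "j < i'" "i' < k" for i i' j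
      using u'(3)[of j i] u'(3)[of j i'] that proper by metis
    show "(u' i j, v' j) \<notin> parcs G" if "j < i" "i < k" for i j
      using u'(3)[of j i] v'(2)[of j] that proper[of "u' i j" "v' j"] by auto
    show "u' i j \<noteq> u' i' j'" if "j < i" "i < k" "j' < i'" "i' < k" "j \<noteq> j'" for i i' j j'
      using u'(3)[of j i] u'(3)[of j' i'] that by auto
    show "u' i j \<noteq> v' j'" if "j < i" "i < k" "j' < k" "j' \<noteq> j" for i j j'
      using u'(3)[of j i] v'(2)[of j'] that by auto
  qed (use u' v' in auto)
  then show ?thesis by blast
qed

text \<open>Color the certificate by columns and insert the remaining vertices one at a time. A
  vertex gets a color already in use if one is free; otherwise it opens a new color and, seeing all
  old ones, is itself the vertex required for it. The number of colors never drops.\<close>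

lemma admits_of_witness:
  assumes G: "pair_graph G" and w: "sgraph.witness (pverts G) (\<lambda>u v. (u, v) \<in> parcs G) k x" and k: "0 < k"
  shows "admits_partial_grundy G k"
proof -
  interpret sgraph "pverts G" "\<lambda>u v. (u, v) \<in> parcs G" by (rule sgraph_of_pair_graph[OF G])
  interpret pair_graph G by fact
  define good where "good U \<longleftrightarrow> (\<exists>k'\<ge>k. \<exists>c :: 'a \<Rightarrow> nat. (\<forall>v\<in>U. c v \<in> {1..k'}) \<and>
     (\<forall>u\<in>U. \<forall>v\<in>U. (u, v) \<in> parcs G \<longrightarrow> c u \<noteq> c v) \<and>
     (\<forall>i\<in>{1..k'}. \<exists>v\<in>U. c v = i \<and> (\<forall>j\<in>{1..i - 1}. \<exists>u\<in>U. (v, u) \<in> parcs G \<and> c u = j)))" for U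
  define S where "S = (\<Union>i<k. \<Union>j<k. {x i j})"
  have wV: "x i j \<in> pverts G" if "i < k" "j < k" for i j using w that by (auto simp: witness_def)
  have wI: "(x i j, x i' j) \<notin> parcs G" if "i < k" "i' < k" "j < k" for i i' j using w that by (auto simp: witness_def)
  have wD: "x i j \<noteq> x i' j'" if "i < k" "i' < k" "j < k" "j' < k" "j \<noteq> j'" for i i' j j'
    using w that unfolding witness_def by blast
  have wE: "(x i i, x i j) \<in> parcs G" if "j < i" "i < k" for i j using w that by (auto simp: witness_def)
  \<comment> \<open>The choice is unique because different columns share no vertex.\<close>
  define c where "c v = Suc (SOME j. j < k \<and> (\<exists>i<k. v = x i j))" for v
  have c: "c (x i j) = Suc j" if "i < k" "j < k" for i j
  proof -
    have "(SOME j'. j' < k \<and> (\<exists>i'<k. x i j = x i' j')) = j"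
      by (rule some_equality) (use that wD in blast)+
    then show ?thesis by (simp add: c_def)
  qed
  have xS: "x i j \<in> S" if "i < k" "j < k" for i j using that by (auto simp: S_def)
  have "good S"
    unfolding good_def
  proof (intro exI[of _ k] exI[of _ c] conjI ballI impI)
    show "c v \<in> {1..k}" if "v \<in> S" for v using that c by (auto simp: S_def)
    show "c u \<noteq> c v" if "u \<in> S" "v \<in> S" "(u, v) \<in> parcs G" for u v
      using that c wI by (auto simp: S_def)
    fix i assume i: "i \<in> {1..k}"
    show "\<exists>v\<in>S. c v = i \<and> (\<forall>j\<in>{1..i - 1}. \<exists>u\<in>S. (v, u) \<in> parcs G \<and> c u = j)"
    proof (rule bexI[of _ "x (i - 1) (i - 1)"], intro conjI ballI)
      show "c (x (i - 1) (i - 1)) = i" "x (i - 1) (i - 1) \<in> S" using i c xS by auto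
      fix j assume j: "j \<in> {1..i - 1}"
      then show "\<exists>u\<in>S. (x (i - 1) (i - 1), u) \<in> parcs G \<and> c u = j"
        using i c[of "i - 1" "j - 1"] wE[of "j - 1" "i - 1"]
        by (intro bexI[of _ "x (i - 1) (j - 1)"] xS) auto
    qed
  qed simp
  have step: "good (insert v U)" if U: "good U" "v \<notin> U" for v U
  proof -
    obtain k' c where c: "k \<le> k'" "\<forall>v\<in>U. c v \<in> {1..k'}" "\<forall>u\<in>U. \<forall>v\<in>U. (u, v) \<in> parcs G \<longrightarrow> c u \<noteq> c v"
     "\<forall>i\<in>{1..k'}. \<exists>v\<in>U. c v = i \<and> (\<forall>j\<in>{1..i - 1}. \<exists>u\<in>U. (v, u) \<in> parcs G \<and> c u = j)"
      using U(1) unfolding good_def by blast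
    obtain i where i: "i \<in> {1..Suc k'}" "\<forall>u\<in>U. (v, u) \<in> parcs G \<longrightarrow> c u \<noteq> i"
      "i = Suc k' \<longrightarrow> (\<forall>j\<in>{1..k'}. \<exists>u\<in>U. (v, u) \<in> parcs G \<and> c u = j)"
    proof (cases "\<exists>i\<in>{1..k'}. \<forall>u\<in>U. (v, u) \<in> parcs G \<longrightarrow> c u \<noteq> i")
      case True
      then obtain i where "i \<in> {1..k'}" "\<forall>u\<in>U. (v, u) \<in> parcs G \<longrightarrow> c u \<noteq> i" by blast
      then show ?thesis by (intro that[of i]) auto
    next
      case False
      then show ?thesis using c(2) by (intro that[of "Suc k'"]) auto
    qed
    let ?c = "c(v := i)"
    have old: "?c u = c u" if "u \<in> U" for u using that \<open>v \<notin> U\<close> by auto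
    have vv: "(v, v) \<notin> parcs G" using irrA by blast
    have wit: "\<exists>w\<in>insert v U. ?c w = l \<and> (\<forall>j\<in>{1..l - 1}. \<exists>u\<in>insert v U. (w, u) \<in> parcs G \<and> ?c u = j)"
      if l: "l \<in> {1..k'}" for l
    proof -
      obtain w where "w \<in> U" "c w = l" "\<forall>j\<in>{1..l - 1}. \<exists>u\<in>U. (w, u) \<in> parcs G \<and> c u = j" using c(4) l by blast
      then show ?thesis using old by (intro bexI[of _ w]) (auto intro: rev_bexI)
    qed
    show ?thesis
      unfolding good_def
    proof (intro exI[of _ "max k' i"] exI[of _ ?c] conjI ballI impI)
      show "k \<le> max k' i" using c(1) by simp
      show "?c u \<in> {1..max k' i}" if "u \<in> insert v U" for u using that c(2) i(1) by fastforce
      show "?c u \<noteq> ?c w" if "u \<in> insert v U" "w \<in> insert v U" "(u, w) \<in> parcs G" for u w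
      proof -
        have "(w, u) \<in> parcs G" using that(3) symA by blast
        then show ?thesis using that c(3) i(2) vv old by (cases "u = v"; cases "w = v") auto
      qed
      fix l assume l: "l \<in> {1..max k' i}"
      show "\<exists>w\<in>insert v U. ?c w = l \<and> (\<forall>j\<in>{1..l - 1}. \<exists>u\<in>insert v U. (w, u) \<in> parcs G \<and> ?c u = j)"
      proof (cases "l \<le> k'")
        case True
        then show ?thesis using wit l by auto
      next
        case False
        then have "l = i" "i = Suc k'" using l i(1) by auto
        then show ?thesis using i(3) old by (intro bexI[of _ v]) (auto intro: rev_bexI)
      qed
    qed
  qed
  have "good (S \<union> T)" if "finite T" for T
    using that
  proof (induction T)
    case (insert v T)
    then show ?case using step[of "S \<union> T" v] by (cases "v \<in> S") (auto simp: insert_absorb)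
  qed (simp add: \<open>good S\<close>)
  from this[of "pverts G"] have "good (S \<union> pverts G)" using finV by simp
  moreover have "S \<union> pverts G = pverts G" using wV by (auto simp: S_def)
  ultimately obtain k' c where c: "k \<le> k'" "\<forall>v\<in>pverts G. c v \<in> {1..k'}"
     "\<forall>u\<in>pverts G. \<forall>v\<in>pverts G. (u, v) \<in> parcs G \<longrightarrow> c u \<noteq> c v"
     "\<forall>i\<in>{1..k'}. \<exists>v\<in>pverts G. c v = i \<and> (\<forall>j\<in>{1..i - 1}. \<exists>u\<in>pverts G. (v, u) \<in> parcs G \<and> c u = j)"
    unfolding good_def by auto
  have "partial_grundy_coloring G k' c"
    unfolding partial_grundy_coloring_def
    using c k in_arcsD1 in_arcsD2 by auto
  then show ?thesis using c(1) unfolding admits_partial_grundy_def by blast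
qed

lemma admits_iff_witness:
  assumes "pair_graph G" "0 < k"
  shows "admits_partial_grundy G k \<longleftrightarrow> (\<exists>x. sgraph.witness (pverts G) (\<lambda>u v. (u, v) \<in> parcs G) k x)"
  using witness_of_coloring[OF assms(1)] admits_of_witness[OF assms(1) _ assms(2)]
  unfolding admits_partial_grundy_def by blast

section \<open>Search guided by advice\<close>

text \<open>
  \<open>pick n P e\<close> is the element of rank \<open>e\<close> (counted from 0) of \<open>{u. u < n \<and> P u}\<close>, and \<open>n\<close> if there is none.
\<close>

definition rank :: "nat \<Rightarrow> (nat \<Rightarrow> bool) \<Rightarrow> nat \<Rightarrow> nat" where
  "rank n P u = card {w. w < n \<and> (w < u \<and> P w)}"

definition pick :: "nat \<Rightarrow> (nat \<Rightarrow> bool) \<Rightarrow> nat \<Rightarrow> nat" where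
  "pick n P e = card {u. u < n \<and> (\<forall>w<n. w \<le> u \<longrightarrow> \<not> (P w \<and> rank n P w = e))}"

lemma rank_strict: "P u \<Longrightarrow> u < u' \<Longrightarrow> u < n \<Longrightarrow> rank n P u < rank n P u'"
  unfolding rank_def by (rule psubset_card_mono) auto

lemma rank_inj: "P u \<Longrightarrow> P u' \<Longrightarrow> u < n \<Longrightarrow> u' < n \<Longrightarrow> rank n P u = rank n P u' \<Longrightarrow> u = u'"
  using rank_strict[of P u u' n] rank_strict[of P u' u n] by (cases u u' rule: linorder_cases) auto

text \<open>The set counted by \<open>pick\<close> is the initial segment below the sought element,
  so its size is that element.\<close>

lemma pick_eq:
  assumes "u < n" "P u" "rank n P u = e" shows "pick n P e = u"
proof -
  have "{u'. u' < n \<and> (\<forall>w<n. w \<le> u' \<longrightarrow> \<not> (P w \<and> rank n P w = e))} = {..<u}"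
  proof (intro equalityI subsetI)
    fix u' assume "u' \<in> {u'. u' < n \<and> (\<forall>w<n. w \<le> u' \<longrightarrow> \<not> (P w \<and> rank n P w = e))}"
    then have "\<not> u \<le> u'" using assms by blast
    then show "u' \<in> {..<u}" by simp
  next
    fix u' assume u': "u' \<in> {..<u}"
    have "\<not> (P w \<and> rank n P w = e)" if "w < n" "w \<le> u'" for w
      using rank_inj[of P w u n] assms that u' by auto
    then show "u' \<in> {u'. u' < n \<and> (\<forall>w<n. w \<le> u' \<longrightarrow> \<not> (P w \<and> rank n P w = e))}"
      using u' assms by auto
  qed
  then show ?thesis by (simp add: pick_def)
qed

lemma pick_le: "pick n P e \<le> n"
  unfolding pick_def by (rule order_trans[OF card_mono[of "{..<n}"]]) auto

lemma pick_less: assumes "pick n P e < n" shows "P (pick n P e) \<and> rank n P (pick n P e) = e"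
proof -
  have "\<exists>u<n. P u \<and> rank n P u = e"
  proof (rule ccontr)
    assume "\<not> ?thesis"
    then have "{u. u < n \<and> (\<forall>w<n. w \<le> u \<longrightarrow> \<not> (P w \<and> rank n P w = e))} = {..<n}" by auto
    then show False using assms by (simp add: pick_def)
  qed
  then obtain u where "u < n" "P u" "rank n P u = e" by blast
  with pick_eq[of u n P e] show ?thesis by simp
qed

text \<open>
  Advice for the roles \<open>q < m\<close> of a certificate: \<open>cl q\<close> is the class of the vertex for \<open>q\<close>, \<open>rt q\<close> the root of its
  component, \<open>pr q\<close> its parent, \<open>bt q\<close> tells whether it is adjacent to its parent, \<open>ef q\<close> is its index among the vertices of
  its class with this adjacency to the parent, and \<open>ff q\<close> is the index of the parent in the reverse
  direction. A role in a small class has \<open>rt q = pr q = m\<close> and is found by its index in the class. The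
  argument \<open>g\<close> of \<open>sol\<close> gives the index of a root among the valid ones. Parents need not precede
  their children in the numbering of the roles, so \<open>copy\<close> iterates until every depth is reached.
  Capping \<open>v\<close> at \<open>n\<close> makes all entries of a copy fit into \<open>n\<close> bits.
\<close>

locale search =
  fixes n m :: nat and A :: "nat \<Rightarrow> nat \<Rightarrow> bool" and C :: "nat \<Rightarrow> nat \<Rightarrow> bool"
    and con :: "nat \<Rightarrow> nat \<Rightarrow> nat \<Rightarrow> nat \<Rightarrow> bool"
    and cl rt pr bt ef ff :: "nat \<Rightarrow> nat"
begin

definition step :: "nat \<Rightarrow> (nat \<Rightarrow> nat) \<Rightarrow> nat \<Rightarrow> nat" where
  "step v Y q = (if rt q = q then min v n
     else pick n (\<lambda>u. C (cl q) u \<and> (m \<le> pr q \<or> (A (Y (pr q)) u \<longleftrightarrow> bt q = 1))) (ef q))"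

fun iter :: "nat \<Rightarrow> nat \<Rightarrow> nat \<Rightarrow> nat" where
  "iter v 0 q = 0"
| "iter v (Suc i) q = (if q < m then step v (iter v i) q else 0)"

definition copy :: "nat \<Rightarrow> nat \<Rightarrow> nat" where "copy v q = iter v (m * m + 1) q"

definition valid :: "nat \<Rightarrow> nat \<Rightarrow> bool" where
  "valid t v \<longleftrightarrow> C (cl t) v \<and>
     (\<forall>p<m. \<forall>q<m. (rt p = t \<or> rt p = m) \<and> (rt q = t \<or> rt q = m) \<longrightarrow> con p q (copy v p) (copy v q)) \<and>
     (\<forall>q<m. rt q = t \<and> q \<noteq> t \<longrightarrow>
        rank n (\<lambda>u. C (cl (pr q)) u \<and> (A u (copy v q) \<longleftrightarrow> bt q = 1)) (copy v (pr q)) = ff q)"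

definition sol :: "(nat \<Rightarrow> nat) \<Rightarrow> nat \<Rightarrow> nat" where
  "sol g q = copy (pick n (valid (rt q)) (g (rt q))) q"

definition accepts :: "(nat \<Rightarrow> nat) \<Rightarrow> bool" where
  "accepts g \<longleftrightarrow> (\<forall>p<m. \<forall>q<m. con p q (sol g p) (sol g q))"

end

text \<open>
  \<open>Z\<close> marks the roles in small classes, and \<open>bb p q\<close> is the generic adjacency between the classes of \<open>p\<close> and \<open>q\<close>.
\<close>

locale guided = search +
  fixes x :: "nat \<Rightarrow> nat" and bb :: "nat \<Rightarrow> nat \<Rightarrow> bool" and \<Delta> :: nat and Z :: "nat \<Rightarrow> bool" and dep :: "nat \<Rightarrow> nat"
  assumes A_sym: "A u v \<Longrightarrow> A v u" and C_less: "C a v \<Longrightarrow> v < n"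
    and con_less: "con p q y z \<Longrightarrow> y < n \<and> z < n"
    and con_transfer: "con p q y z \<Longrightarrow> A y' z' = A y z \<Longrightarrow> y' \<noteq> z' \<Longrightarrow> y' < n \<Longrightarrow> z' < n \<Longrightarrow> con p q y' z'"
    and rt_Z: "q < m \<Longrightarrow> Z q \<Longrightarrow> rt q = m" and pr_Z: "q < m \<Longrightarrow> Z q \<Longrightarrow> m \<le> pr q"
    and ef_Z: "q < m \<Longrightarrow> Z q \<Longrightarrow> ef q = rank n (C (cl q)) (x q)"
    and rt: "q < m \<Longrightarrow> \<not> Z q \<Longrightarrow> rt q < m \<and> \<not> Z (rt q) \<and> rt (rt q) = rt q"
    and pr: "q < m \<Longrightarrow> \<not> Z q \<Longrightarrow> rt q \<noteq> q \<Longrightarrow> pr q < m \<and> \<not> Z (pr q) \<and> rt (pr q) = rt q \<and> dep (pr q) < dep q"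
    and bt: "q < m \<Longrightarrow> \<not> Z q \<Longrightarrow> rt q \<noteq> q \<Longrightarrow> bt q = 1 \<longleftrightarrow> A (x (pr q)) (x q)"
    and ef: "q < m \<Longrightarrow> \<not> Z q \<Longrightarrow> rt q \<noteq> q \<Longrightarrow>
      ef q = rank n (\<lambda>u. C (cl q) u \<and> (A (x (pr q)) u \<longleftrightarrow> bt q = 1)) (x q)"
    and ff: "q < m \<Longrightarrow> \<not> Z q \<Longrightarrow> rt q \<noteq> q \<Longrightarrow>
      ff q = rank n (\<lambda>u. C (cl (pr q)) u \<and> (A u (x q) \<longleftrightarrow> bt q = 1)) (x (pr q))"
    and dep_le: "q < m \<Longrightarrow> dep q \<le> m * m"
    and base: "p < m \<Longrightarrow> q < m \<Longrightarrow> \<not> Z p \<Longrightarrow> \<not> Z q \<Longrightarrow> rt p \<noteq> rt q \<Longrightarrow> A (x p) (x q) = bb p q"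
    and bb_sym: "bb p q = bb q p"
    and regular: "p < m \<Longrightarrow> q < m \<Longrightarrow> \<not> Z p \<Longrightarrow> \<not> Z q \<Longrightarrow> C (cl p) v \<Longrightarrow>
      card {u. C (cl q) u \<and> A v u \<noteq> bb p q} \<le> \<Delta>"
    and x_C: "q < m \<Longrightarrow> C (cl q) (x q)" and x_con: "p < m \<Longrightarrow> q < m \<Longrightarrow> con p q (x p) (x q)"
begin

lemma A_commute: "A u v = A v u" using A_sym by blast

text \<open>A role reads only the value of its parent, which has smaller depth; roots and roles in
  small classes read no other role. So a value is final after more rounds than its depth.\<close>

lemma iter_stable: "q < m \<Longrightarrow> dep q < i \<Longrightarrow> dep q < j \<Longrightarrow> iter v i q = iter v j q"
proof (induction "dep q" arbitrary: q i j rule: less_induct)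
  case less
  obtain i' j' where ij: "i = Suc i'" "j = Suc j'" using less.prems by (cases i; cases j) auto
  show ?case
  proof (cases "Z q")
    case True
    then show ?thesis using ij rt_Z pr_Z less.prems by (simp add: step_def)
  next
    case False
    show ?thesis
    proof (cases "rt q = q")
      case True
      then show ?thesis using ij by (simp add: step_def)
    next
      case nr: False
      have "iter v i' (pr q) = iter v j' (pr q)"
        using less.hyps[of "pr q" i' j'] pr[OF less.prems(1) False nr] less.prems ij by auto
      then show ?thesis using ij by (simp add: step_def)
    qed
  qed
qed

text \<open>The \<open>m * m + 1\<close> rounds exceed every depth, so the iteration has reached a
  fixed point.\<close>

lemma copy_step: assumes "q < m" shows "copy v q = step v (copy v) q"
proof -
  have "copy v q = step v (iter v (m * m)) q" using assms by (simp add: copy_def)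
  also have "\<dots> = step v (copy v) q"
  proof (cases "Z q \<or> rt q = q")
    case True
    then show ?thesis using rt_Z pr_Z assms by (auto simp: step_def)
  next
    case False
    then have "iter v (m * m) (pr q) = copy v (pr q)"
      unfolding copy_def using pr[of q] dep_le[OF assms] assms by (intro iter_stable) auto
    then show ?thesis by (simp add: step_def)
  qed
  finally show ?thesis .
qed

lemma copy_root: "t < m \<Longrightarrow> rt t = t \<Longrightarrow> v < n \<Longrightarrow> copy v t = v"
  using copy_step[of t v] by (simp add: step_def)

lemma copy_Z: "q < m \<Longrightarrow> Z q \<Longrightarrow> copy v q = x q"
  using copy_step[of q v] rt_Z[of q] pr_Z[of q] ef_Z[of q] x_C[of q] C_less[of "cl q" "x q"]
    pick_eq[of "x q" n "C (cl q)" "ef q"]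
  by (simp add: step_def)

text \<open>The certificates among which the exchange argument moves: they follow the same advice as
  \<open>x\<close>, agree with it in small classes, and have generic adjacency between different
  components.\<close>

definition adm :: "(nat \<Rightarrow> nat) \<Rightarrow> bool" where
  "adm y \<longleftrightarrow> (\<forall>q<m. Z q \<longrightarrow> y q = x q) \<and> (\<forall>q<m. C (cl q) (y q)) \<and> (\<forall>p<m. \<forall>q<m. con p q (y p) (y q)) \<and>
    (\<forall>q<m. \<not> Z q \<and> rt q \<noteq> q \<longrightarrow> (A (y (pr q)) (y q) \<longleftrightarrow> bt q = 1) \<and>
       ef q = rank n (\<lambda>u. C (cl q) u \<and> (A (y (pr q)) u \<longleftrightarrow> bt q = 1)) (y q) \<and>
       ff q = rank n (\<lambda>u. C (cl (pr q)) u \<and> (A u (y q) \<longleftrightarrow> bt q = 1)) (y (pr q))) \<and>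
    (\<forall>p<m. \<forall>q<m. \<not> Z p \<and> \<not> Z q \<and> rt p \<noteq> rt q \<longrightarrow> A (y p) (y q) = bb p q)"

lemma adm_x: "adm x"
  unfolding adm_def using x_C x_con bt ef ff base by simp

lemma copy_adm:
  assumes y: "adm y"
  shows "q < m \<Longrightarrow> \<not> Z q \<Longrightarrow> copy (y (rt q)) q = y q"
proof (induction "dep q" arbitrary: q rule: less_induct)
  case less
  show ?case
  proof (cases "rt q = q")
    case True
    moreover have "y q < n" using y less.prems C_less by (auto simp: adm_def)
    ultimately show ?thesis using copy_root less.prems by simp
  next
    case False
    note p = pr[OF less.prems False]
    have IH: "copy (y (rt q)) (pr q) = y (pr q)" using less.hyps[of "pr q"] p by simp
    have "copy (y (rt q)) q = pick n (\<lambda>u. C (cl q) u \<and> (A (y (pr q)) u \<longleftrightarrow> bt q = 1)) (ef q)"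
      using copy_step[OF less.prems(1)] False p IH by (simp add: step_def)
    also have "\<dots> = y q"
      by (rule pick_eq) (use y less.prems False C_less in \<open>auto simp: adm_def\<close>)
    finally show ?thesis .
  qed
qed

lemma valid_adm:
  assumes y: "adm y" and t: "t < m" "\<not> Z t" "rt t = t"
  shows "valid t (y t)"
proof -
  have c: "copy (y t) q = y q" if "q < m" "rt q = t \<or> rt q = m" for q
  proof (cases "Z q")
    case True
    then show ?thesis using copy_Z that y by (simp add: adm_def)
  next
    case False
    then show ?thesis using copy_adm[OF y that(1)] that rt[of q] by auto
  qed
  show ?thesis
    unfolding valid_def
  proof (intro conjI allI impI)
    show "C (cl t) (y t)" using y t by (simp add: adm_def)
    show "con p q (copy (y t) p) (copy (y t) q)" if "p < m" "q < m"
      "(rt p = t \<or> rt p = m) \<and> (rt q = t \<or> rt q = m)" for p q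
      using that c y by (simp add: adm_def)
    fix q assume q: "q < m" "rt q = t \<and> q \<noteq> t"
    then have nZ: "\<not> Z q" using rt_Z t by auto
    then have "copy (y t) (pr q) = y (pr q)" "copy (y t) q = y q" using c pr[of q] q by auto
    then show "rank n (\<lambda>u. C (cl (pr q)) u \<and> A u (copy (y t) q) = (bt q = 1)) (copy (y t) (pr q)) = ff q"
      using y q nZ unfolding adm_def by auto
  qed
qed

lemma valid_copy:
  assumes v: "valid t v" and t: "t < m" "rt t = t" and q: "q < m" "rt q = t"
  shows "C (cl q) (copy v q)"
    and "q \<noteq> t \<Longrightarrow> (A (copy v (pr q)) (copy v q) \<longleftrightarrow> bt q = 1) \<and>
       ef q = rank n (\<lambda>u. C (cl q) u \<and> (A (copy v (pr q)) u \<longleftrightarrow> bt q = 1)) (copy v q)"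
proof -
  have nZ: "\<not> Z q" using rt_Z q t by auto
  have "(q \<noteq> t \<longrightarrow> (A (copy v (pr q)) (copy v q) \<longleftrightarrow> bt q = 1) \<and>
       ef q = rank n (\<lambda>u. C (cl q) u \<and> (A (copy v (pr q)) u \<longleftrightarrow> bt q = 1)) (copy v q)) \<and> C (cl q) (copy v q)"
  proof (cases "q = t")
    case True
    have "v < n" using v C_less unfolding valid_def by blast
    then show ?thesis using True v copy_root[OF t] by (simp add: valid_def)
  next
    case False
    \<comment> \<open>Compatibility forces the copy below \<open>n\<close>, so \<open>pick\<close>
      has succeeded.\<close>
    have "con q q (copy v q) (copy v q)" using v q unfolding valid_def by blast
    then have lt: "copy v q < n" using con_less by blast
    let ?P = "\<lambda>u. C (cl q) u \<and> (A (copy v (pr q)) u \<longleftrightarrow> bt q = 1)"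
    have "rt q \<noteq> q" using False q by simp
    then have "\<not> m \<le> pr q" using pr[OF q(1) nZ] by simp
    then have eq: "copy v q = pick n ?P (ef q)"
      unfolding copy_step[OF q(1), of v] step_def using \<open>rt q \<noteq> q\<close> by simp
    have "?P (copy v q) \<and> rank n ?P (copy v q) = ef q"
      using pick_less[of n ?P "ef q"] lt unfolding eq[symmetric] by blast
    then show ?thesis by simp
  qed
  then show "C (cl q) (copy v q)"
    and "q \<noteq> t \<Longrightarrow> (A (copy v (pr q)) (copy v q) \<longleftrightarrow> bt q = 1) \<and>
       ef q = rank n (\<lambda>u. C (cl q) u \<and> (A (copy v (pr q)) u \<longleftrightarrow> bt q = 1)) (copy v q)" by blast+
qed

text \<open>Seen from a child, \<open>ff\<close> determines the parent. Two copies that agree at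
  \<open>q\<close> therefore agree along the path to the root, where the copy is \<open>v\<close>
  itself.\<close>

lemma copy_inj:
  assumes t: "t < m" "rt t = t" and v: "valid t v" "valid t v'"
  shows "q < m \<Longrightarrow> rt q = t \<Longrightarrow> copy v q = copy v' q \<Longrightarrow> v = v'"
proof (induction "dep q" arbitrary: q rule: less_induct)
  case less
  show ?case
  proof (cases "q = t")
    case True
    have "v < n" "v' < n" using v C_less unfolding valid_def by blast+
    then show ?thesis using True copy_root[OF t] less.prems by simp
  next
    case False
    have nZ: "\<not> Z q" using rt_Z less.prems t by auto
    have "rt q \<noteq> q" using False less.prems by simp
    note p = pr[OF less.prems(1) nZ this]
    let ?P = "\<lambda>u. C (cl (pr q)) u \<and> (A u (copy v q) \<longleftrightarrow> bt q = 1)"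
    have r: "rank n ?P (copy w (pr q)) = ff q" "?P (copy w (pr q))" "copy w (pr q) < n"
      if "valid t w" "copy w q = copy v q" for w
    proof -
      have "rank n (\<lambda>u. C (cl (pr q)) u \<and> (A u (copy w q) \<longleftrightarrow> bt q = 1)) (copy w (pr q)) = ff q"
        using that(1) less.prems(1,2) False unfolding valid_def by blast
      then show "rank n ?P (copy w (pr q)) = ff q" by (simp add: that(2))
      show "?P (copy w (pr q))"
        using valid_copy(1)[OF that(1) t, of "pr q"] valid_copy(2)[OF that(1) t less.prems(1,2) False] p
          less.prems(2) unfolding that(2) by simp
      then show "copy w (pr q) < n" using C_less by blast
    qed
    note r1 = r[OF v(1) refl] and r2 = r[OF v(2) less.prems(3)[symmetric]]
    have "copy v (pr q) = copy v' (pr q)"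
      by (rule rank_inj[of ?P, OF r1(2) r2(2) r1(3) r2(3)]) (simp only: r1(1) r2(1))
    moreover have "rt (pr q) = t" using p less.prems(2) by simp
    ultimately show ?thesis using less.hyps[of "pr q"] p by blast
  qed
qed

text \<open>
  Among more than \<open>m * m * (\<Delta> + 1)\<close> smaller valid roots, one has a copy that avoids exceptional pairs with the other components.
\<close>

lemma improve:
  assumes y: "adm y" and t: "t < m" "\<not> Z t" "rt t = t" and big: "m * m * (\<Delta> + 1) < rank n (valid t) (y t)"
  shows "\<exists>y'. adm y' \<and> y' t < y t \<and> (\<forall>t'<m. rt t' = t' \<and> t' \<noteq> t \<longrightarrow> y' t' = y t')"
proof -
  define W where "W = {v. v < n \<and> (v < y t \<and> valid t v)}"
  define clash where "clash p q = {v \<in> W. copy v p = y q \<or> A (copy v p) (y q) \<noteq> bb p q}" for p q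
  define PQ where "PQ = {(p, q). p < m \<and> q < m \<and> rt p = t \<and> \<not> Z q \<and> rt q \<noteq> t}"
  have finPQ: "finite PQ" by (rule finite_subset[of _ "{..<m} \<times> {..<m}"]) (auto simp: PQ_def)
  have "card PQ \<le> card ({..<m} \<times> {..<m})" by (rule card_mono) (auto simp: PQ_def)
  then have cPQ: "card PQ \<le> m * m" by (simp add: card_cartesian_product)
  have finW: "finite W" by (simp add: W_def)
  \<comment> \<open>By \<open>copy_inj\<close> different roots give different copies of
    \<open>p\<close>; at most one of these equals \<open>y q\<close>, and at most
    \<open>\<Delta>\<close> are exceptional to it.\<close>
  have cl: "card (clash p q) \<le> \<Delta> + 1" if pq: "(p, q) \<in> PQ" for p q
  proof -
    have pq': "p < m" "q < m" "rt p = t" "\<not> Z q" "rt q \<noteq> t" "\<not> Z p" using pq rt_Z t by (auto simp: PQ_def)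
    let ?S = "insert (y q) {u. C (cl p) u \<and> A (y q) u \<noteq> bb q p}"
    have fin: "finite {u. C (cl p) u \<and> A (y q) u \<noteq> bb q p}"
      by (rule finite_subset[of _ "{..<n}"]) (auto dest: C_less)
    have "inj_on (\<lambda>v. copy v p) (clash p q)"
      using copy_inj[OF t(1,3)] pq' by (auto simp: inj_on_def clash_def W_def)
    then have "card (clash p q) = card ((\<lambda>v. copy v p) ` clash p q)" by (simp add: card_image)
    also have "\<dots> \<le> card ?S"
    proof (rule card_mono)
      show "finite ?S" using fin by simp
      show "(\<lambda>v. copy v p) ` clash p q \<subseteq> ?S"
        using valid_copy(1)[OF _ t(1,3) pq'(1,3)] A_commute[of "y q"] bb_sym[of q p]
        by (auto simp: clash_def W_def)
    qed
    also have "\<dots> \<le> card {u. C (cl p) u \<and> A (y q) u \<noteq> bb q p} + 1"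
      using fin by (simp add: card_insert_if)
    also have "\<dots> \<le> \<Delta> + 1" using regular[OF pq'(2,1,4,6), of "y q"] y pq' by (simp add: adm_def)
    finally show ?thesis .
  qed
  have "card (\<Union>(p, q)\<in>PQ. clash p q) \<le> (\<Sum>z\<in>PQ. card (case z of (p, q) \<Rightarrow> clash p q))"
    by (rule card_UN_le[OF finPQ])
  also have "\<dots> \<le> (\<Sum>z\<in>PQ. \<Delta> + 1)" by (intro sum_mono) (use cl in auto)
  also have "\<dots> \<le> m * m * (\<Delta> + 1)" using mult_le_mono1[OF cPQ, of "\<Delta> + 1"] by simp
  also have "\<dots> < card W" using big by (simp add: rank_def W_def)
  finally have lt: "card (\<Union>(p, q)\<in>PQ. clash p q) < card W" .
  have "finite (\<Union>(p, q)\<in>PQ. clash p q)" using finPQ finW by (auto simp: clash_def)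
  then have "\<not> W \<subseteq> (\<Union>(p, q)\<in>PQ. clash p q)" using lt card_mono[of "\<Union>(p, q)\<in>PQ. clash p q" W] by linarith
  then obtain v where v: "v \<in> W" "\<And>p q. (p, q) \<in> PQ \<Longrightarrow> v \<notin> clash p q" by blast
  have vv: "valid t v" "v < y t" using v by (auto simp: W_def)
  have free: "copy v p \<noteq> y q" "A (copy v p) (y q) = bb p q" if "(p, q) \<in> PQ" for p q
    using v(2)[OF that] v(1) by (auto simp: clash_def)
  define y' where "y' q = (if rt q = t then copy v q else y q)" for q
  have same: "y' q = copy v q" if "q < m" "rt q = t \<or> rt q = m" for q
  proof (cases "Z q")
    case True
    then show ?thesis using that copy_Z y rt_Z by (auto simp: y'_def adm_def)
  next
    case False
    then show ?thesis using that rt[of q] by (auto simp: y'_def)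
  qed
  have "adm y'"
    unfolding adm_def
  proof (intro conjI allI impI)
    show "y' q = x q" if "q < m" "Z q" for q using that y t rt_Z by (auto simp: y'_def adm_def)
    show C': "C (cl q) (y' q)" if "q < m" for q
      using that y valid_copy(1)[OF vv(1) t(1,3)] by (auto simp: y'_def adm_def)
    show b: "A (y' p) (y' q) = bb p q" if "p < m" "q < m" "\<not> Z p \<and> \<not> Z q \<and> rt p \<noteq> rt q" for p q
    proof (cases "rt p = t")
      case True
      then show ?thesis using that free(2)[of p q] by (auto simp: y'_def PQ_def)
    next
      case False
      show ?thesis
      proof (cases "rt q = t")
        case True
        then show ?thesis using that False free(2)[of q p] A_commute bb_sym by (auto simp: y'_def PQ_def)
      next
        case F: False
        then show ?thesis using that False y by (auto simp: y'_def adm_def)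
      qed
    qed
    show "con p q (y' p) (y' q)" if pq: "p < m" "q < m" for p q
    proof -
      have *: "con p q (y p) (y q)" using y pq by (simp add: adm_def)
      have n': "y' p < n" "y' q < n" using C' pq C_less by blast+
      \<comment> \<open>Pairs outside the component are unchanged, and pairs from the component and
        the small classes are covered by \<open>valid\<close>. Mixed pairs are distinct and have
        generic adjacency before and after the exchange, so \<open>con_transfer\<close>
        applies.\<close>
      consider "rt p \<noteq> t" "rt q \<noteq> t" | "(rt p = t \<or> rt p = m) \<and> (rt q = t \<or> rt q = m)"
        | "rt p = t" "\<not> Z q" "rt q \<noteq> t" | "rt q = t" "\<not> Z p" "rt p \<noteq> t"
        using rt_Z pq by blast
      then show ?thesis
      proof cases
        case 1
        then show ?thesis using * by (simp add: y'_def)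
      next
        case 2
        then have "con p q (copy v p) (copy v q)" using vv(1) pq unfolding valid_def by blast
        then show ?thesis using same 2 pq by simp
      next
        case 3
        then have "\<not> Z p" using rt_Z pq t by auto
        then have "A (y' p) (y' q) = A (y p) (y q)" using b[OF pq] y pq 3 by (auto simp: adm_def)
        moreover have "y' p \<noteq> y' q" using free(1)[of p q] 3 pq by (auto simp: y'_def PQ_def)
        ultimately show ?thesis using con_transfer[OF *] n' by blast
      next
        case 4
        then have "\<not> Z q" using rt_Z pq t by auto
        then have "A (y' p) (y' q) = A (y p) (y q)" using b[OF pq] y pq 4 by (auto simp: adm_def)
        moreover have "y' p \<noteq> y' q" using free(1)[of q p] 4 pq by (auto simp: y'_def PQ_def)
        ultimately show ?thesis using con_transfer[OF *] n' by blast
      qed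
    qed
    fix q assume q: "q < m" "\<not> Z q \<and> rt q \<noteq> q"
    note p = pr[OF q(1)]
    have "(A (y' (pr q)) (y' q) \<longleftrightarrow> bt q = 1) \<and>
      ef q = rank n (\<lambda>u. C (cl q) u \<and> (A (y' (pr q)) u \<longleftrightarrow> bt q = 1)) (y' q) \<and>
      ff q = rank n (\<lambda>u. C (cl (pr q)) u \<and> (A u (y' q) \<longleftrightarrow> bt q = 1)) (y' (pr q))"
    proof (cases "rt q = t")
      case True
      then have "y' q = copy v q" "y' (pr q) = copy v (pr q)" "q \<noteq> t" using p q by (auto simp: y'_def)
      moreover have "rank n (\<lambda>u. C (cl (pr q)) u \<and> (A u (copy v q) \<longleftrightarrow> bt q = 1)) (copy v (pr q)) = ff q"
        using vv(1) q True \<open>q \<noteq> t\<close> unfolding valid_def by blast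
      ultimately show ?thesis using valid_copy(2)[OF vv(1) t(1,3) q(1) True] by simp
    next
      case False
      then have "y' q = y q" "y' (pr q) = y (pr q)" using p q by (auto simp: y'_def)
      moreover have "(A (y (pr q)) (y q) \<longleftrightarrow> bt q = 1) \<and>
        ef q = rank n (\<lambda>u. C (cl q) u \<and> (A (y (pr q)) u \<longleftrightarrow> bt q = 1)) (y q) \<and>
        ff q = rank n (\<lambda>u. C (cl (pr q)) u \<and> (A u (y q) \<longleftrightarrow> bt q = 1)) (y (pr q))"
        using y q unfolding adm_def by blast
      ultimately show ?thesis by simp
    qed
    then show "A (y' (pr q)) (y' q) = (bt q = 1)"
      "ef q = rank n (\<lambda>u. C (cl q) u \<and> A (y' (pr q)) u = (bt q = 1)) (y' q)"
      "ff q = rank n (\<lambda>u. C (cl (pr q)) u \<and> A u (y' q) = (bt q = 1)) (y' (pr q))" by blast+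
  qed
  moreover have "v < n" using v(1) by (simp add: W_def)
  then have "y' t < y t" using copy_root[OF t(1,3)] t vv by (simp add: y'_def)
  moreover have "y' t' = y t'" if "rt t' = t'" "t' \<noteq> t" for t' using that by (simp add: y'_def)
  ultimately show ?thesis by blast
qed

text \<open>Take an admissible certificate with the least sum of root vertices. By
  \<open>improve\<close>, each of its roots has small rank among the valid ones, and
  \<open>g\<close> records these ranks.\<close>

theorem accepting_advice: "\<exists>g. accepts g \<and> (\<forall>t. g t \<le> m * m * (\<Delta> + 1)) \<and> (\<forall>t\<ge>m. g t = 0)"
proof -
  define \<mu> where "\<mu> y = (\<Sum>t\<in>{t. t < m \<and> rt t = t}. y t)" for y :: "nat \<Rightarrow> nat"
  obtain y where y: "adm y" "\<And>y'. adm y' \<Longrightarrow> \<mu> y \<le> \<mu> y'"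
    using ex_has_least_nat[of adm x \<mu>] adm_x by auto
  have le: "rank n (valid t) (y t) \<le> m * m * (\<Delta> + 1)" if t: "t < m" "\<not> Z t" "rt t = t" for t
  proof (rule ccontr)
    assume "\<not> ?thesis"
    then obtain y' where y': "adm y'" "y' t < y t" "\<forall>t'<m. rt t' = t' \<and> t' \<noteq> t \<longrightarrow> y' t' = y t'"
      using improve[OF y(1) t] by (auto simp: not_le)
    have "\<mu> y' < \<mu> y"
      unfolding \<mu>_def
    proof (rule sum_strict_mono_ex1)
      show "\<forall>t\<in>{t. t < m \<and> rt t = t}. y' t \<le> y t" 
      proof
        fix t' assume "t' \<in> {t. t < m \<and> rt t = t}"
        then show "y' t' \<le> y t'" using y'(2,3) by (cases "t' = t") auto
      qed
      show "\<exists>t\<in>{t. t < m \<and> rt t = t}. y' t < y t" using y' t by blast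
    qed simp
    then show False using y(2)[OF y'(1)] by simp
  qed
  define g where "g t = (if t < m \<and> \<not> Z t \<and> rt t = t then rank n (valid t) (y t) else 0)" for t
  have "sol g q = y q" if q: "q < m" for q
  proof (cases "Z q")
    case True
    then show ?thesis using copy_Z q y by (simp add: sol_def adm_def)
  next
    case False
    note r = rt[OF q False]
    have "pick n (valid (rt q)) (g (rt q)) = y (rt q)"
      using r valid_adm[OF y(1), of "rt q"] y(1) C_less by (intro pick_eq) (auto simp: g_def adm_def)
    then show ?thesis using copy_adm[OF y(1) q False] by (simp add: sol_def)
  qed
  then have "accepts g" using y(1) by (simp add: accepts_def adm_def)
  moreover have "g t \<le> m * m * (\<Delta> + 1)" for t using le by (auto simp: g_def)
  moreover have "g t = 0" if "m \<le> t" for t using that by (simp add: g_def)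
  ultimately show ?thesis by blast
qed

end

section \<open>Existence of advice\<close>

lemma digits_less:
  fixes \<alpha> :: "nat \<Rightarrow> nat"
  shows "(\<And>i. i < l \<Longrightarrow> \<alpha> i < 2 ^ w) \<Longrightarrow> (\<Sum>i<l. \<alpha> i * 2 ^ (i * w)) < 2 ^ (l * w)"
proof (induction l)
  case (Suc l)
  have "(\<Sum>i<Suc l. \<alpha> i * 2 ^ (i * w)) < 2 ^ (l * w) + \<alpha> l * 2 ^ (l * w)" using Suc by simp
  also have "\<dots> = Suc (\<alpha> l) * 2 ^ (l * w)" by simp
  also have "\<dots> \<le> 2 ^ w * 2 ^ (l * w)" using Suc.prems[of l] by (intro mult_le_mono1) simp
  finally show ?case by (simp add: power_add)
qed simp

lemma digits_nth:
  fixes \<alpha> :: "nat \<Rightarrow> nat"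
  assumes "\<And>i. i < l \<Longrightarrow> \<alpha> i < 2 ^ w"
  shows "(\<Sum>i<l. \<alpha> i * 2 ^ (i * w)) div 2 ^ (j * w) mod 2 ^ w = (if j < l then \<alpha> j else 0)"
  using assms
proof (induction l)
  case 0
  then show ?case by simp
next
  case (Suc l)
  let ?S = "\<Sum>i<l. \<alpha> i * 2 ^ (i * w)"
  have S: "?S < 2 ^ (l * w)" using Suc.prems by (intro digits_less) simp
  have al: "\<alpha> l < 2 ^ w" using Suc.prems by simp
  consider "j < l" | "j = l" | "l < j" by linarith
  then show ?case
  proof cases
    case 1
    have "l * w = j * w + (w + (l - Suc j) * w)"
    proof -
      have "l = j + Suc (l - Suc j)" using 1 by simp
      then have "l * w = (j + Suc (l - Suc j)) * w" by (rule arg_cong)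
      then show ?thesis by (simp add: algebra_simps)
    qed
    then have "\<alpha> l * 2 ^ (l * w) = 2 ^ (j * w) * (2 ^ w * (\<alpha> l * 2 ^ ((l - Suc j) * w)))"
      by (simp add: power_add ac_simps)
    then have e: "(\<Sum>i<Suc l. \<alpha> i * 2 ^ (i * w)) =
        ?S + 2 ^ (j * w) * (2 ^ w * (\<alpha> l * 2 ^ ((l - Suc j) * w)))" by (simp only: sum.lessThan_Suc)
    have "(\<Sum>i<Suc l. \<alpha> i * 2 ^ (i * w)) div 2 ^ (j * w) =
        ?S div 2 ^ (j * w) + 2 ^ w * (\<alpha> l * 2 ^ ((l - Suc j) * w))" unfolding e by simp
    moreover have "?S div 2 ^ (j * w) mod 2 ^ w = \<alpha> j" using Suc.IH Suc.prems 1 by simp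
    ultimately show ?thesis using 1 by (simp only: mod_mult_self2) simp
  next
    case 2
    then show ?thesis using S al by simp
  next
    case 3
    have "(\<Sum>i<Suc l. \<alpha> i * 2 ^ (i * w)) < 2 ^ (Suc l * w)" using Suc.prems by (rule digits_less)
    also have "\<dots> \<le> 2 ^ (j * w)" using 3 by (intro power_increasing mult_le_mono1) auto
    finally show ?thesis using 3 by simp
  qed
qed

text \<open>The root is the least vertex of a component, the depth is the distance from it, and the
  parent is the predecessor on a shortest path.\<close>

lemma spanning_forest:
  fixes Lk :: "(nat \<times> nat) set"
  assumes Lk: "Lk \<subseteq> S \<times> S" "finite S" "sym Lk"
  obtains rt pr dep :: "nat \<Rightarrow> nat" where
    "\<And>q. q \<in> S \<Longrightarrow> rt q \<in> S \<and> rt (rt q) = rt q \<and> dep q \<le> card Lk"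
    "\<And>q. q \<in> S \<Longrightarrow> rt q \<noteq> q \<Longrightarrow> pr q \<in> S \<and> rt (pr q) = rt q \<and> dep (pr q) < dep q \<and> (pr q, q) \<in> Lk"
    "\<And>p q. (p, q) \<in> Lk \<Longrightarrow> rt p = rt q"
proof -
  have finLk: "finite Lk" using Lk finite_subset by blast
  define rt where "rt q = (LEAST p. (p, q) \<in> Lk\<^sup>*)" for q
  have rt1: "(rt q, q) \<in> Lk\<^sup>*" for q unfolding rt_def by (rule LeastI[of _ q]) simp
  have symr: "(q, p) \<in> Lk\<^sup>*" if "(p, q) \<in> Lk\<^sup>*" for p q
    using that sym_rtrancl[OF Lk(3)] by (rule symD[rotated])
  have rt2: "rt p = rt q" if "(p, q) \<in> Lk\<^sup>*" for p q
  proof -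
    have "(r, p) \<in> Lk\<^sup>* \<longleftrightarrow> (r, q) \<in> Lk\<^sup>*" for r using that symr[OF that] by (meson rtrancl_trans)
    then show ?thesis by (simp add: rt_def)
  qed
  have inS: "p \<in> S" if "(p, q) \<in> Lk\<^sup>*" "q \<in> S" for p q
    using that Lk(1) by (cases rule: converse_rtranclE) auto
  define dep where "dep q = (LEAST i. (rt q, q) \<in> Lk ^^ i)" for q
  have ex: "\<exists>i\<le>card Lk. (rt q, q) \<in> Lk ^^ i" for q
    using rt1[of q] rtrancl_finite_eq_relpow[OF finLk] by auto
  have dep1: "(rt q, q) \<in> Lk ^^ dep q" for q unfolding dep_def using ex[of q] by (meson LeastI)
  have dep2: "dep q \<le> card Lk" for q unfolding dep_def using ex[of q] by (meson Least_le order_trans)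
  have "\<exists>p. p \<in> S \<and> rt p = rt q \<and> dep p < dep q \<and> (p, q) \<in> Lk" if q: "q \<in> S" "rt q \<noteq> q" for q
  proof -
    obtain i where i: "dep q = Suc i" using dep1[of q] q(2) by (cases "dep q") auto
    then obtain p where p: "(rt q, p) \<in> Lk ^^ i" "(p, q) \<in> Lk" using dep1[of q] by auto
    have r: "rt p = rt q" using rt2[of p q] p(2) by blast
    have "dep p \<le> i" unfolding dep_def r by (rule Least_le) (rule p(1))
    then show ?thesis using p r i Lk(1) by (intro exI[of _ p]) auto
  qed
  then obtain pr where c1: "\<And>q. q \<in> S \<Longrightarrow> rt q \<noteq> q \<Longrightarrow> pr q \<in> S \<and> rt (pr q) = rt q \<and> dep (pr q) < dep q \<and> (pr q, q) \<in> Lk"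
    by metis
  have c2: "rt q \<in> S \<and> rt (rt q) = rt q \<and> dep q \<le> card Lk" if "q \<in> S" for q
    using inS[OF rt1 that] rt2[OF rt1] dep2 by blast
  have c3: "rt p = rt q" if "(p, q) \<in> Lk" for p q using rt2 that by blast
  show ?thesis by (rule that[OF c2 c1 c3])
qed

lemma rank_le: "(\<And>u. P u \<Longrightarrow> u < n) \<Longrightarrow> rank n P u \<le> card {w. P w}"
  unfolding rank_def by (rule card_mono) (auto intro: finite_subset[of _ "{..<n}"])

text \<open>The advice is read off a spanning forest of the exceptional pairs. All its entries are
  small: indices in small classes are at most \<open>L\<close>, indices among exceptions at most
  \<open>\<Delta>\<close>, and root ranks are bounded by \<open>accepting_advice\<close>.\<close>

theorem search_complete:
  fixes n m L \<Delta> :: nat and A C con and a x :: "nat \<Rightarrow> nat"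
  assumes A_sym: "\<And>u v. A u v \<Longrightarrow> A v u" and C_less: "\<And>a v. C a v \<Longrightarrow> v < n"
    and con_less: "\<And>p q y z. con p q y z \<Longrightarrow> y < n \<and> z < n"
    and con_transfer: "\<And>p q y z y' z'. con p q y z \<Longrightarrow> A y' z' = A y z \<Longrightarrow> y' \<noteq> z' \<Longrightarrow> y' < n \<Longrightarrow> z' < n \<Longrightarrow> con p q y' z'"
    and x_C: "\<And>q. q < m \<Longrightarrow> C (a q) (x q)" and x_con: "\<And>p q. p < m \<Longrightarrow> q < m \<Longrightarrow> con p q (x p) (x q)"
    and reg: "\<And>p q. p < m \<Longrightarrow> q < m \<Longrightarrow> L < card {v. C (a p) v} \<Longrightarrow> L < card {v. C (a q) v} \<Longrightarrow>
      \<exists>b. (\<forall>v. C (a p) v \<longrightarrow> card {u. C (a q) u \<and> A v u \<noteq> b} \<le> \<Delta>) \<and>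
          (\<forall>u. C (a q) u \<longrightarrow> card {v. C (a p) v \<and> A u v \<noteq> b} \<le> \<Delta>)"
    and B: "m \<le> B" "1 \<le> B" "L \<le> B" "\<Delta> \<le> B" "m * m * (\<Delta> + 1) \<le> B" "\<And>q. q < m \<Longrightarrow> a q \<le> B"
  shows "\<exists>\<alpha>. (\<forall>i. \<alpha> i \<le> B) \<and> (\<forall>i\<ge>m * 7. \<alpha> i = 0) \<and>
    search.accepts n m A C con (\<lambda>q. \<alpha> (q * 7)) (\<lambda>q. \<alpha> (q * 7 + 1)) (\<lambda>q. \<alpha> (q * 7 + 2)) (\<lambda>q. \<alpha> (q * 7 + 3))
      (\<lambda>q. \<alpha> (q * 7 + 4)) (\<lambda>q. \<alpha> (q * 7 + 5)) (\<lambda>q. \<alpha> (q * 7 + 6))"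
proof -
  define Z where "Z q \<longleftrightarrow> card {v. C (a q) v} \<le> L" for q
  \<comment> \<open>The generic adjacency is true if this leaves few exceptions in both directions;
    otherwise \<open>reg\<close> shows that false does. Requiring both directions makes it
    symmetric.\<close>
  define bb where "bb p q \<longleftrightarrow> (\<forall>v. C (a p) v \<longrightarrow> card {u. C (a q) u \<and> A v u \<noteq> True} \<le> \<Delta>) \<and>
          (\<forall>u. C (a q) u \<longrightarrow> card {v. C (a p) v \<and> A u v \<noteq> True} \<le> \<Delta>)" for p q
  have bb_sym: "bb p q = bb q p" for p q unfolding bb_def by blast
  have A_comm: "A u v = A v u" for u v using A_sym by blast
  have regular: "card {u. C (a q) u \<and> A v u \<noteq> bb p q} \<le> \<Delta>"
    if pq: "p < m" "q < m" "\<not> Z p" "\<not> Z q" "C (a p) v" for p q v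
  proof (cases "bb p q")
    case True
    then show ?thesis using pq by (simp add: bb_def)
  next
    case False
    obtain b where b: "\<forall>v. C (a p) v \<longrightarrow> card {u. C (a q) u \<and> A v u \<noteq> b} \<le> \<Delta>"
      "\<forall>u. C (a q) u \<longrightarrow> card {v. C (a p) v \<and> A u v \<noteq> b} \<le> \<Delta>"
      using reg[OF pq(1,2)] pq(3,4) unfolding Z_def not_le by blast
    have "\<not> b"
    proof
      assume b
      then have "bb p q" using b unfolding bb_def by simp
      then show False using False by blast
    qed
    then show ?thesis using b(1) pq(5) False by simp
  qed
  define S where "S = {q. q < m \<and> \<not> Z q}"
  define Lk where "Lk = {(p, q). p \<in> S \<and> q \<in> S \<and> A (x p) (x q) \<noteq> bb p q}"
  have finS: "finite S" by (simp add: S_def)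
  have symLk: "sym Lk" using A_comm bb_sym by (auto simp: sym_def Lk_def)
  have subLk: "Lk \<subseteq> S \<times> S" by (auto simp: Lk_def)
  obtain rt0 pr0 dep0 :: "nat \<Rightarrow> nat" where
    F: "\<And>q. q \<in> S \<Longrightarrow> rt0 q \<in> S \<and> rt0 (rt0 q) = rt0 q \<and> dep0 q \<le> card Lk"
    "\<And>q. q \<in> S \<Longrightarrow> rt0 q \<noteq> q \<Longrightarrow> pr0 q \<in> S \<and> rt0 (pr0 q) = rt0 q \<and> dep0 (pr0 q) < dep0 q \<and> (pr0 q, q) \<in> Lk"
    "\<And>p q. (p, q) \<in> Lk \<Longrightarrow> rt0 p = rt0 q"
    by (rule spanning_forest[OF subLk finS symLk]) (rule that; assumption)
  have "card Lk \<le> card ({..<m} \<times> {..<m})" by (rule card_mono) (auto simp: Lk_def S_def)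
  then have cLk: "card Lk \<le> m * m" by (simp add: card_cartesian_product)
  define nr where "nr q \<longleftrightarrow> q \<in> S \<and> rt0 q \<noteq> q" for q
  \<comment> \<open>Everything is 0 from \<open>m\<close> on, so that the packed advice vanishes
    beyond its last digit; below \<open>m\<close>, the value \<open>rt q = m\<close> marks small
    classes.\<close>
  define cl where "cl q = (if q < m then a q else 0)" for q
  define rt where "rt q = (if q \<in> S then rt0 q else if q < m then m else 0)" for q
  define pr where "pr q = (if nr q then pr0 q else if q < m then m else 0)" for q
  define bt where "bt q = (if nr q then of_bool (A (x (pr q)) (x q)) else 0 :: nat)" for q
  define ef where "ef q = (if nr q then rank n (\<lambda>u. C (cl q) u \<and> (A (x (pr q)) u \<longleftrightarrow> bt q = 1)) (x q)
     else if q < m \<and> Z q then rank n (C (cl q)) (x q) else 0)" for q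
  define ff where "ff q = (if nr q then rank n (\<lambda>u. C (cl (pr q)) u \<and> (A u (x q) \<longleftrightarrow> bt q = 1)) (x (pr q)) else 0)" for q
  define dep where "dep q = (if q \<in> S then dep0 q else 0)" for q
  have S_iff: "q \<in> S \<longleftrightarrow> q < m \<and> \<not> Z q" for q by (simp add: S_def)
  have nrE: "nr q \<longleftrightarrow> q < m \<and> \<not> Z q \<and> rt q \<noteq> q" for q by (auto simp: nr_def rt_def S_iff)
  have link: "pr q \<in> S" "q \<in> S" "A (x (pr q)) (x q) \<noteq> bb (pr q) q" "rt (pr q) = rt q" "dep (pr q) < dep q" if "nr q" for q
    using F(2)[of q] that by (auto simp: nr_def pr_def rt_def dep_def Lk_def)
  interpret guided n m A C con cl rt pr bt ef ff x bb \<Delta> Z dep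
  proof
    show "rt q < m \<and> \<not> Z (rt q) \<and> rt (rt q) = rt q" if "q < m" "\<not> Z q" for q
      using F(1)[of q] that by (auto simp: rt_def S_iff)
    show "pr q < m \<and> \<not> Z (pr q) \<and> rt (pr q) = rt q \<and> dep (pr q) < dep q" if "q < m" "\<not> Z q" "rt q \<noteq> q" for q
      using link[of q] that nrE by (auto simp: S_iff)
    show "dep q \<le> m * m" if "q < m" for q using F(1)[of q] cLk by (auto simp: dep_def)
    show "A (x p) (x q) = bb p q" if "p < m" "q < m" "\<not> Z p" "\<not> Z q" "rt p \<noteq> rt q" for p q
      using F(3)[of p q] that by (auto simp: rt_def S_iff Lk_def)
    show "card {u. C (cl q) u \<and> A v u \<noteq> bb p q} \<le> \<Delta>"
      if "p < m" "q < m" "\<not> Z p" "\<not> Z q" "C (cl p) v" for p q v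
      using regular[of p q v] that by (simp add: cl_def)
    show "(bt q = 1) = A (x (pr q)) (x q)" if "q < m" "\<not> Z q" "rt q \<noteq> q" for q
      using that nrE by (simp add: bt_def)
    show "ef q = rank n (\<lambda>u. C (cl q) u \<and> A (x (pr q)) u = (bt q = 1)) (x q)" if "q < m" "\<not> Z q" "rt q \<noteq> q" for q
      using that nrE by (simp add: ef_def)
    show "ff q = rank n (\<lambda>u. C (cl (pr q)) u \<and> A u (x q) = (bt q = 1)) (x (pr q))" if "q < m" "\<not> Z q" "rt q \<noteq> q" for q
      using that nrE by (simp add: ff_def)
    show "rt q = m" "m \<le> pr q" "ef q = rank n (C (cl q)) (x q)" if "q < m" "Z q" for q
      using that nrE by (auto simp: rt_def pr_def ef_def S_iff)
    show "A v u" if "A u v" for u v by (rule A_sym[OF that])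
    show "v < n" if "C c v" for c v by (rule C_less[OF that])
    show "y < n \<and> z < n" if "con p q y z" for p q y z by (rule con_less[OF that])
    show "con p q y' z'" if "con p q y z" "A y' z' = A y z" "y' \<noteq> z'" "y' < n" "z' < n" for p q y z y' z'
      by (rule con_transfer[OF that])
    show "bb p q = bb q p" for p q by (rule bb_sym)
    show "C (cl q) (x q)" if "q < m" for q using x_C[OF that] that by (simp add: cl_def)
    show "con p q (x p) (x q)" if "p < m" "q < m" for p q by (rule x_con[OF that])
  qed
  obtain g0 where g0: "accepts g0" "\<And>t. g0 t \<le> m * m * (\<Delta> + 1)" "\<And>t. m \<le> t \<Longrightarrow> g0 t = 0"
    using accepting_advice by blast
  \<comment> \<open>The seven numbers of a role are interleaved: function \<open>j\<close> at role
    \<open>q\<close> becomes entry \<open>q * 7 + j\<close>.\<close>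
  define fs where "fs = [cl, rt, pr, bt, ef, ff, g0]"
  define \<alpha> where "\<alpha> i = (if i < m * 7 then (fs ! (i mod 7)) (i div 7) else 0)" for i
  have zero: "\<forall>f\<in>set fs. \<forall>q\<ge>m. f q = 0"
    using g0(3) by (auto simp: fs_def cl_def rt_def pr_def bt_def ef_def ff_def nr_def S_iff)
  have digit: "\<alpha> (q * 7 + j) = (fs ! j) q" if "j < 7" for q j
  proof (cases "q < m")
    case True
    have "Suc q * 7 \<le> m * 7" using True by (intro mult_le_mono1) simp
    then show ?thesis using that by (simp add: \<alpha>_def)
  next
    case False
    have "fs ! j \<in> set fs" using that by (intro nth_mem) (simp add: fs_def)
    then have "(fs ! j) q = 0" using zero False by simp
    then show ?thesis using False by (simp add: \<alpha>_def)
  qed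
  have acc: "search.accepts n m A C con (\<lambda>q. \<alpha> (q * 7)) (\<lambda>q. \<alpha> (q * 7 + 1)) (\<lambda>q. \<alpha> (q * 7 + 2)) (\<lambda>q. \<alpha> (q * 7 + 3))
      (\<lambda>q. \<alpha> (q * 7 + 4)) (\<lambda>q. \<alpha> (q * 7 + 5)) (\<lambda>q. \<alpha> (q * 7 + 6))"
    using g0(1) digit[of 0] digit[of 1] digit[of 2] digit[of 3] digit[of 4] digit[of 5] digit[of 6]
    by (simp add: fs_def numeral_eq_Suc)
  \<comment> \<open>A linked pair is exceptional, so the recorded bit is the opposite of the generic
    adjacency and few candidates share it.\<close>
  have dev: "card {u. C (cl q) u \<and> (A (x (pr q)) u \<longleftrightarrow> bt q = 1)} \<le> \<Delta>"
    "card {u. C (cl (pr q)) u \<and> (A u (x q) \<longleftrightarrow> bt q = 1)} \<le> \<Delta>" if q: "nr q" for q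
  proof -
    note l = link[OF q]
    have b: "(bt q = 1) = (\<not> bb (pr q) q)" using l(3) q by (simp add: bt_def)
    have pq: "pr q < m" "q < m" "\<not> Z (pr q)" "\<not> Z q" using l by (auto simp: S_iff)
    show "card {u. C (cl q) u \<and> (A (x (pr q)) u \<longleftrightarrow> bt q = 1)} \<le> \<Delta>"
      unfolding b using regular[OF pq x_C[OF pq(1)]] pq by (simp add: cl_def)
    show "card {u. C (cl (pr q)) u \<and> (A u (x q) \<longleftrightarrow> bt q = 1)} \<le> \<Delta>"
      unfolding b A_comm[of _ "x q"] bb_sym[of _ q] using regular[OF pq(2,1,4,3) x_C[OF pq(2)]] pq by (simp add: cl_def)
  qed
  have "(fs ! j) q \<le> B" if "j < 7" "q < m" for q j
  proof -
    have "rt q \<le> m" using F(1)[of q] that by (auto simp: rt_def S_iff)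
    moreover have "pr q \<le> m" using link(1)[of q] that by (auto simp: pr_def S_iff split: if_splits)
    moreover have "ef q \<le> max L \<Delta>"
    proof (cases "nr q")
      case True
      have "ef q \<le> card {u. C (cl q) u \<and> (A (x (pr q)) u \<longleftrightarrow> bt q = 1)}"
        unfolding ef_def using True C_less by (auto intro!: rank_le)
      then show ?thesis using dev(1)[OF True] by simp
    next
      case False
      show ?thesis
      proof (cases "Z q")
        case True
        have "ef q \<le> card {v. C (cl q) v}" unfolding ef_def using True False that C_less by (auto intro!: rank_le)
        then show ?thesis using True that by (simp add: Z_def cl_def)
      qed (simp add: ef_def False)
    qed
    moreover have "ff q \<le> \<Delta>"
    proof (cases "nr q")
      case True
      have "ff q \<le> card {u. C (cl (pr q)) u \<and> (A u (x q) \<longleftrightarrow> bt q = 1)}"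
        unfolding ff_def using True C_less by (auto intro!: rank_le)
      then show ?thesis using dev(2)[OF True] by simp
    qed (simp add: ff_def)
    moreover have "bt q \<le> 1" by (simp add: bt_def)
    moreover have "cl q \<le> B" using B(6) that by (simp add: cl_def)
    moreover have "j \<in> {0, 1, 2, 3, 4, 5, 6}" using that by auto
    ultimately show ?thesis using B g0(2)[of q] by (auto simp: fs_def)
  qed
  then have "\<alpha> i \<le> B" for i
    using less_mult_imp_div_less[of i m 7] by (simp add: \<alpha>_def)
  then show ?thesis using acc by (intro exI[of _ \<alpha>]) (auto simp: \<alpha>_def)
qed

section \<open>The algorithm\<close>

definition adjacent :: "inst \<Rightarrow> nat \<Rightarrow> nat \<Rightarrow> bool" where
  "adjacent I u v \<longleftrightarrow> u < order_of I \<and> v < order_of I \<and> \<not> matrix_of I (u * order_of I + v) = 0"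

definition ndist :: "inst \<Rightarrow> nat \<Rightarrow> nat \<Rightarrow> nat" where
  "ndist I u v = card {w. w < order_of I \<and> \<not> (adjacent I u w \<longleftrightarrow> adjacent I v w)}"

definition radius :: "inst \<Rightarrow> nat" where "radius I = shl I 1 (colors_of I ^ 2 * 11)"

text \<open>A greedy maximal separated family, held as a bit set in one number.\<close>

definition reps :: "inst \<Rightarrow> nat" where
  "reps I = rec_nat 0 (\<lambda>v S. if \<exists>u<order_of I. u < v \<and> slice I S u 1 = 1 \<and> ndist I u v \<le> radius I
     then S else S + shl I 1 v) (order_of I)"

definition is_rep :: "inst \<Rightarrow> nat \<Rightarrow> bool" where "is_rep I u \<longleftrightarrow> slice I (reps I) u 1 = 1"

text \<open>Classes are the full balls around representatives, which may overlap, numbered by the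
  ranks of their centers.\<close>

definition in_class :: "inst \<Rightarrow> nat \<Rightarrow> nat \<Rightarrow> bool" where
  "in_class I a v \<longleftrightarrow> v < order_of I \<and>
     (\<exists>u<order_of I. is_rep I u \<and> rank (order_of I) (is_rep I) u = a \<and> ndist I u v \<le> radius I)"

text \<open>Quantifying over rows and columns decodes role numbers without division. The range
  conditions reject the value \<open>order_of I\<close> of a failed \<open>pick\<close>.\<close>

definition compatible :: "inst \<Rightarrow> nat \<Rightarrow> nat \<Rightarrow> nat \<Rightarrow> nat \<Rightarrow> bool" where
  "compatible I p q y z \<longleftrightarrow> y < order_of I \<and> z < order_of I \<and>
     (\<forall>i<colors_of I. \<forall>j<colors_of I. \<forall>i'<colors_of I. \<forall>j'<colors_of I.
        p = i * colors_of I + j \<and> q = i' * colors_of I + j' \<longrightarrow>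
        (j = j' \<longrightarrow> \<not> adjacent I y z) \<and> (\<not> j = j' \<longrightarrow> \<not> y = z) \<and>
        (i = i' \<and> j = i \<and> j' < i \<longrightarrow> adjacent I y z))"

text \<open>Seven digits of \<open>40 * k ^ 3\<close> bits for each of the \<open>k\<^sup>2\<close>
  roles make up the \<open>280 * k ^ 5\<close> bits that are enumerated.\<close>

definition digit :: "inst \<Rightarrow> nat \<Rightarrow> nat \<Rightarrow> nat" where
  "digit I N i = slice I N (i * (colors_of I ^ 3 * 40)) (colors_of I ^ 3 * 40)"

abbreviation roles :: "inst \<Rightarrow> nat" where "roles I \<equiv> colors_of I ^ 2"

definition step_of where
  "step_of I N = search.step (order_of I) (roles I) (adjacent I) (in_class I)
     (\<lambda>q. digit I N (q * 7)) (\<lambda>q. digit I N (q * 7 + 1)) (\<lambda>q. digit I N (q * 7 + 2))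
     (\<lambda>q. digit I N (q * 7 + 3)) (\<lambda>q. digit I N (q * 7 + 4))"

definition iter_of where
  "iter_of I N = search.iter (order_of I) (roles I) (adjacent I) (in_class I)
     (\<lambda>q. digit I N (q * 7)) (\<lambda>q. digit I N (q * 7 + 1)) (\<lambda>q. digit I N (q * 7 + 2))
     (\<lambda>q. digit I N (q * 7 + 3)) (\<lambda>q. digit I N (q * 7 + 4))"

definition copy_of where
  "copy_of I N = search.copy (order_of I) (roles I) (adjacent I) (in_class I)
     (\<lambda>q. digit I N (q * 7)) (\<lambda>q. digit I N (q * 7 + 1)) (\<lambda>q. digit I N (q * 7 + 2))
     (\<lambda>q. digit I N (q * 7 + 3)) (\<lambda>q. digit I N (q * 7 + 4))"

definition valid_of where
  "valid_of I N = search.valid (order_of I) (roles I) (adjacent I) (in_class I) (compatible I)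
     (\<lambda>q. digit I N (q * 7)) (\<lambda>q. digit I N (q * 7 + 1)) (\<lambda>q. digit I N (q * 7 + 2))
     (\<lambda>q. digit I N (q * 7 + 3)) (\<lambda>q. digit I N (q * 7 + 4)) (\<lambda>q. digit I N (q * 7 + 5))"

definition accept_of where
  "accept_of I N = search.accepts (order_of I) (roles I) (adjacent I) (in_class I) (compatible I)
     (\<lambda>q. digit I N (q * 7)) (\<lambda>q. digit I N (q * 7 + 1)) (\<lambda>q. digit I N (q * 7 + 2))
     (\<lambda>q. digit I N (q * 7 + 3)) (\<lambda>q. digit I N (q * 7 + 4)) (\<lambda>q. digit I N (q * 7 + 5))
     (\<lambda>q. digit I N (q * 7 + 6))"

definition entry :: "inst \<Rightarrow> nat \<Rightarrow> nat \<Rightarrow> nat" where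
  "entry I Y q = slice I Y (q * order_of I) (order_of I)"

text \<open>One round of \<open>iter\<close> for all roles at once, packed into a single number,
  because the recursion of \<open>ptime_rec\<close> carries just one number.\<close>

definition vec :: "inst \<Rightarrow> nat \<Rightarrow> nat \<Rightarrow> nat \<Rightarrow> nat" where
  "vec I N v = rec_nat 0 (\<lambda>i Y. \<Sum>q<roles I. shl I (step_of I N v (entry I Y) q) (q * order_of I))"

text \<open>Too many representatives mean yes by \<open>separated_family_bound\<close>; otherwise
  class numbers are small enough to be part of the advice.\<close>

definition answer :: "inst \<Rightarrow> bool" where
  "answer I \<longleftrightarrow> shl I 1 (colors_of I ^ 3 * 35) < card {u. u < order_of I \<and> is_rep I u} \<or>
     (\<exists>N<2 ^ (280 * colors_of I ^ 5). accept_of I N)"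

lemma step_of_eq:
  "step_of I N v Y q = (if digit I N (q * 7 + 1) = q then min v (order_of I)
     else pick (order_of I) (\<lambda>u. in_class I (digit I N (q * 7)) u \<and> (roles I \<le> digit I N (q * 7 + 2) \<or>
       (adjacent I (Y (digit I N (q * 7 + 2))) u \<longleftrightarrow> digit I N (q * 7 + 3) = 1))) (digit I N (q * 7 + 4)))"
  unfolding step_of_def search.step_def ..

lemma iter_of_eq:
  "iter_of I N v 0 q = 0"
  "iter_of I N v (Suc i) q = (if q < roles I then step_of I N v (iter_of I N v i) q else 0)"
  unfolding step_of_def iter_of_def by (rule search.iter.simps)+

lemma copy_of_eq: "copy_of I N v q = iter_of I N v (roles I * roles I + 1) q"
  unfolding copy_of_def iter_of_def search.copy_def ..

lemma valid_of_eq: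
  "valid_of I N t v \<longleftrightarrow> in_class I (digit I N (t * 7)) v \<and>
     (\<forall>p<roles I. \<forall>q<roles I. (digit I N (p * 7 + 1) = t \<or> digit I N (p * 7 + 1) = roles I) \<and>
        (digit I N (q * 7 + 1) = t \<or> digit I N (q * 7 + 1) = roles I) \<longrightarrow>
        compatible I p q (copy_of I N v p) (copy_of I N v q)) \<and>
     (\<forall>q<roles I. digit I N (q * 7 + 1) = t \<and> \<not> q = t \<longrightarrow>
        rank (order_of I) (\<lambda>u. in_class I (digit I N (digit I N (q * 7 + 2) * 7)) u \<and>
          (adjacent I u (copy_of I N v q) \<longleftrightarrow> digit I N (q * 7 + 3) = 1)) (copy_of I N v (digit I N (q * 7 + 2)))
        = digit I N (q * 7 + 5))"
  unfolding valid_of_def copy_of_def search.valid_def ..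

definition sol_of :: "inst \<Rightarrow> nat \<Rightarrow> nat \<Rightarrow> nat" where
  "sol_of I N q = copy_of I N (pick (order_of I) (valid_of I N (digit I N (q * 7 + 1)))
     (digit I N (digit I N (q * 7 + 1) * 7 + 6))) q"

lemma accept_of_eq: "accept_of I N \<longleftrightarrow> (\<forall>p<roles I. \<forall>q<roles I. compatible I p q (sol_of I N p) (sol_of I N q))"
  unfolding accept_of_def sol_of_def copy_of_def valid_of_def search.accepts_def search.sol_def ..

lemma shl_exact: "j \<le> bits I \<Longrightarrow> shl I y j = y * 2 ^ j" by (simp add: shl_def)

text \<open>Every entry is at most \<open>order_of I\<close>, hence below
  \<open>2 ^ order_of I\<close>, and all entries together fit into \<open>bits I\<close> digits; so
  packing loses nothing.\<close>

lemma entry_vec: "entry I (vec I N v i) q = iter_of I N v i q"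
proof (induction i arbitrary: q)
  case 0
  have "entry I 0 q = 0" by (simp add: entry_def slice_def shr_def)
  then show ?case by (simp add: vec_def iter_of_eq)
next
  case (Suc i)
  define \<beta> where "\<beta> q = step_of I N v (iter_of I N v i) q" for q
  let ?n = "order_of I" and ?m = "roles I"
  have IH: "entry I (vec I N v i) = iter_of I N v i" using Suc.IH by (rule ext)
  have le: "q * ?n \<le> bits I" if "q \<le> ?m" for q
    unfolding bits_def using mult_le_mono1[OF that, of ?n] by linarith
  have \<beta>: "\<beta> q < 2 ^ ?n" for q
  proof -
    have "\<beta> q \<le> ?n" unfolding \<beta>_def step_of_eq using pick_le by simp
    then show ?thesis using less_exp[of ?n] by (rule le_less_trans)
  qed
  have "vec I N v (Suc i) = (\<Sum>q<?m. shl I (step_of I N v (entry I (vec I N v i)) q) (q * ?n))"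
    by (simp add: vec_def)
  also have "\<dots> = (\<Sum>q<?m. \<beta> q * 2 ^ (q * ?n))"
    unfolding IH \<beta>_def using le by (intro sum.cong refl shl_exact) simp
  finally have v: "vec I N v (Suc i) = (\<Sum>q<?m. \<beta> q * 2 ^ (q * ?n))" .
  have "vec I N v (Suc i) < 2 ^ (?m * ?n)" unfolding v by (rule digits_less) (rule \<beta>)
  also have "\<dots> \<le> 2 ^ bits I" using le[of ?m] by (intro power_increasing) auto
  finally have "entry I (vec I N v (Suc i)) q = vec I N v (Suc i) div 2 ^ (q * ?n) mod 2 ^ ?n"
    unfolding entry_def by (intro slice_eq) (auto simp: bits_def)
  also have "\<dots> = (if q < ?m then \<beta> q else 0)" unfolding v by (rule digits_nth) (rule \<beta>)
  finally show ?case by (simp add: iter_of_eq \<beta>_def)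
qed

lemma copy_of_vec: "copy_of I N v q = entry I (vec I N v (roles I * roles I + 1)) q"
  by (simp only: copy_of_eq entry_vec)

section \<open>Polynomial time for the components of the algorithm\<close>

lemma ptime_last: "ptime \<iota> (ext_ctx es) snd"
  by (rule ptime_var) simp

lemma ptime_shift2: "ptime (\<lambda>y. \<iota> (fst y)) (ext_ctx es) (\<lambda>y. f (fst y) (snd y)) \<Longrightarrow>
   ptime (\<lambda>y. \<iota> (fst (fst y))) (ext_ctx (ext_ctx es)) (\<lambda>y. f (fst (fst y)) (snd y))"
  using ptime_subset[OF ptime_pullback[of "\<lambda>y. \<iota> (fst y)" "ext_ctx es" "\<lambda>y. f (fst y) (snd y)" "\<lambda>y. (fst (fst y), snd y)"],
      of "ext_ctx (ext_ctx es)"]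
  by auto

lemma ptest_shift2: "ptest (\<lambda>y. \<iota> (fst y)) (ext_ctx es) (\<lambda>y. f (fst y) (snd y)) \<Longrightarrow>
   ptest (\<lambda>y. \<iota> (fst (fst y))) (ext_ctx (ext_ctx es)) (\<lambda>y. f (fst (fst y)) (snd y))"
  unfolding ptest_def by (rule ptime_shift2)

text \<open>\<open>ptime_rec\<close> with counter and accumulator as two nested context extensions,
  so that the rules for \<open>ext_ctx\<close> apply to the body.\<close>

lemma ptime_rec2:
  assumes "ptime \<iota> es (\<lambda>x. N (\<iota> x))" "poly_bounded N" "ptime \<iota> es f"
    and g: "ptime (\<lambda>y. \<iota> (fst (fst y))) (ext_ctx (ext_ctx es)) (\<lambda>y. g (fst (fst y)) (snd (fst y)) (snd y))"
  shows "ptime \<iota> es (\<lambda>x. rec_nat (f x) (g x) (N (\<iota> x)))"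
proof (rule ptime_rec[OF assms(1-3)])
  show "ptime (\<lambda>y. \<iota> (fst y)) ((\<lambda>y. fst (snd y)) # (\<lambda>y. snd (snd y)) # map (\<lambda>e y. e (fst y)) es)
      (\<lambda>y. g (fst y) (fst (snd y)) (snd (snd y)))"
    using ptime_subset[OF ptime_pullback[OF g, of "\<lambda>y. ((fst y, fst (snd y)), snd (snd y))"],
      of "(\<lambda>y. fst (snd y)) # (\<lambda>y. snd (snd y)) # map (\<lambda>e y. e (fst y)) es"] by auto
qed

lemmas ptime_times_order = ptime_times[where N = order_of, OF _ ptime_order poly_bounded_order]
lemmas ptime_times_colors = ptime_times[where N = colors_of, OF _ ptime_colors poly_bounded_colors]
lemmas ptime_times_const = ptime_times[where N = "\<lambda>_. c" for c, OF _ ptime_const poly_bounded_const]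
lemmas ptest_all_order = ptest_all[where N = order_of, OF ptime_order poly_bounded_order]
lemmas ptest_ex_order = ptest_ex[where N = order_of, OF ptime_order poly_bounded_order]
lemmas ptest_all_colors = ptest_all[where N = colors_of, OF ptime_colors poly_bounded_colors]
lemmas ptime_card_order = ptime_card[where N = order_of, OF ptime_order poly_bounded_order]
lemmas ptest_all_roles = ptest_all[where N = roles, OF ptime_colors_power poly_bounded_power[OF poly_bounded_colors]]
lemmas ptime_sum_roles = ptime_sum[where N = roles, OF ptime_colors_power poly_bounded_power[OF poly_bounded_colors]]

lemma ptime_times_width: "ptime \<iota> es f \<Longrightarrow> ptime \<iota> es (\<lambda>x. f x * (colors_of (\<iota> x) ^ 3 * 40))"
  by (rule ptime_times[where N = "\<lambda>I. colors_of I ^ 3 * 40"])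
    (assumption, intro ptime_times_const ptime_colors_power, intro poly_bounded_intros)

lemmas ptime_base = ptime_last ptime_const ptime_order ptime_colors ptime_colors_power ptime_plus ptime_minus ptime_times_order ptime_times_colors
  ptime_times_width ptime_times_const ptime_ite ptime_shl ptime_slice ptime_matrix ptest_not ptest_conj ptest_disj ptest_imp ptest_less ptest_le ptest_eq ptest_iff
  ptest_all_order ptest_ex_order ptest_all_colors ptest_all_roles ptime_card_order ptime_sum_roles

lemma ptest_adjacent: "ptime \<iota> es f \<Longrightarrow> ptime \<iota> es g \<Longrightarrow> ptest \<iota> es (\<lambda>x. adjacent (\<iota> x) (f x) (g x))"
  unfolding adjacent_def by (intro ptime_base)

lemma ptime_ndist: "ptime \<iota> es f \<Longrightarrow> ptime \<iota> es g \<Longrightarrow> ptime \<iota> es (\<lambda>x. ndist (\<iota> x) (f x) (g x))"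
  unfolding ndist_def by (intro ptime_base ptest_adjacent ptime_extend)

lemma ptime_radius: "ptime \<iota> es (\<lambda>x. radius (\<iota> x))"
  unfolding radius_def by (intro ptime_base)

lemma ptime_reps: "ptime \<iota> es (\<lambda>x. reps (\<iota> x))"
  unfolding reps_def
  by (rule ptime_rec2[where N = order_of]) (intro ptime_base ptime_ndist ptime_radius ptime_extend poly_bounded_order)+

lemma ptest_is_rep: "ptime \<iota> es f \<Longrightarrow> ptest \<iota> es (\<lambda>x. is_rep (\<iota> x) (f x))"
  unfolding is_rep_def by (intro ptime_base ptime_reps)

lemma ptime_rank:
  "ptest (\<lambda>y. \<iota> (fst y)) (ext_ctx es) (\<lambda>y. P (fst y) (snd y)) \<Longrightarrow> ptime \<iota> es u \<Longrightarrow>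
   ptime \<iota> es (\<lambda>x. rank (order_of (\<iota> x)) (P x) (u x))"
  unfolding rank_def by (intro ptime_card_order ptest_conj ptest_less ptime_last ptime_extend)

lemma ptime_pick:
  "ptest (\<lambda>y. \<iota> (fst y)) (ext_ctx es) (\<lambda>y. P (fst y) (snd y)) \<Longrightarrow> ptime \<iota> es e \<Longrightarrow>
   ptime \<iota> es (\<lambda>x. pick (order_of (\<iota> x)) (P x) (e x))"
proof -
  assume P: "ptest (\<lambda>y. \<iota> (fst y)) (ext_ctx es) (\<lambda>y. P (fst y) (snd y))" and e: "ptime \<iota> es e"
  \<comment> \<open>In \<open>pick\<close> the predicate stands under two binders, and inside
    \<open>rank\<close> under three.\<close>
  note P2 = ptest_shift2[OF P]
  note P3 = ptest_shift2[OF P2]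
  show ?thesis
    unfolding pick_def
    by (intro ptime_card_order ptest_all_order ptest_imp ptest_le ptest_not ptest_conj ptest_eq ptime_rank ptime_last P2
        P3 ptime_extend e)
qed

lemma ptest_in_class: "ptime \<iota> es f \<Longrightarrow> ptime \<iota> es g \<Longrightarrow> ptest \<iota> es (\<lambda>x. in_class (\<iota> x) (f x) (g x))"
  unfolding in_class_def by (intro ptime_base ptest_is_rep ptime_rank ptime_ndist ptime_radius ptime_extend)

lemma ptest_compatible:
  "ptime \<iota> es f \<Longrightarrow> ptime \<iota> es g \<Longrightarrow> ptime \<iota> es h \<Longrightarrow> ptime \<iota> es l \<Longrightarrow>
   ptest \<iota> es (\<lambda>x. compatible (\<iota> x) (f x) (g x) (h x) (l x))"
  unfolding compatible_def by (intro ptime_base ptest_adjacent ptime_extend)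

lemma ptime_digit: "ptime \<iota> es f \<Longrightarrow> ptime \<iota> es g \<Longrightarrow> ptime \<iota> es (\<lambda>x. digit (\<iota> x) (f x) (g x))"
  unfolding digit_def by (intro ptime_base)

lemma ptime_entry: "ptime \<iota> es f \<Longrightarrow> ptime \<iota> es g \<Longrightarrow> ptime \<iota> es (\<lambda>x. entry (\<iota> x) (f x) (g x))"
  unfolding entry_def by (intro ptime_base)

lemma ptime_min: "ptime \<iota> es f \<Longrightarrow> ptime \<iota> es g \<Longrightarrow> ptime \<iota> es (\<lambda>x. min (f x) (g x))"
  unfolding min_def by (intro ptime_ite ptest_le)

lemma ptime_step_of:
  "ptime \<iota> es N \<Longrightarrow> ptime \<iota> es v \<Longrightarrow> ptime \<iota> es Y \<Longrightarrow> ptime \<iota> es q \<Longrightarrow>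
   ptime \<iota> es (\<lambda>x. step_of (\<iota> x) (N x) (v x) (entry (\<iota> x) (Y x)) (q x))"
  unfolding step_of_eq by (intro ptime_base ptime_min ptime_digit ptime_pick ptest_in_class ptest_adjacent ptime_entry ptime_extend)

lemma ptime_vec:
  "ptime \<iota> es N \<Longrightarrow> ptime \<iota> es v \<Longrightarrow> ptime \<iota> es (\<lambda>x. vec (\<iota> x) (N x) (v x) (roles (\<iota> x) * roles (\<iota> x) + 1))"
  unfolding vec_def
proof (rule ptime_rec2[where N = "\<lambda>I. roles I * roles I + 1"])
  show "ptime \<iota> es (\<lambda>x. roles (\<iota> x) * roles (\<iota> x) + 1)"
    by (intro ptime_plus ptime_const ptime_times[where N = roles] ptime_colors_power poly_bounded_intros)
qed (intro ptime_base ptime_step_of ptime_extend poly_bounded_intros | assumption)+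

lemma ptime_copy_of:
  "ptime \<iota> es N \<Longrightarrow> ptime \<iota> es v \<Longrightarrow> ptime \<iota> es q \<Longrightarrow> ptime \<iota> es (\<lambda>x. copy_of (\<iota> x) (N x) (v x) (q x))"
  unfolding copy_of_vec by (intro ptime_entry ptime_vec)

lemma ptest_valid_of:
  "ptime \<iota> es N \<Longrightarrow> ptime \<iota> es t \<Longrightarrow> ptime \<iota> es v \<Longrightarrow> ptest \<iota> es (\<lambda>x. valid_of (\<iota> x) (N x) (t x) (v x))"
  unfolding valid_of_eq
  by (intro ptime_base ptime_digit ptest_in_class ptest_compatible ptime_copy_of ptime_rank ptest_adjacent ptime_extend)

lemma ptime_sol_of: "ptime \<iota> es N \<Longrightarrow> ptime \<iota> es q \<Longrightarrow> ptime \<iota> es (\<lambda>x. sol_of (\<iota> x) (N x) (q x))"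
  unfolding sol_of_def by (intro ptime_base ptime_copy_of ptime_pick ptest_valid_of ptime_digit ptime_extend)

lemma ptest_accept_of: "ptime \<iota> es N \<Longrightarrow> ptest \<iota> es (\<lambda>x. accept_of (\<iota> x) (N x))"
  unfolding accept_of_eq by (intro ptime_base ptest_compatible ptime_sol_of ptime_extend)

lemma ptest_answer: "ptest \<iota> es (\<lambda>x. answer (\<iota> x))"
  unfolding answer_def
proof (intro ptest_disj ptest_less ptime_shl ptime_const ptime_times_const ptime_colors_power ptime_card_order ptest_is_rep ptime_last
    ptest_ex[where N = "\<lambda>I. 2 ^ (280 * colors_of I ^ 5)"] poly_bounded_pow2 ptest_accept_of)
  have "ptime \<iota> es (\<lambda>x. shl (\<iota> x) 1 (colors_of (\<iota> x) ^ 5 * 280))"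
    by (intro ptime_shl ptime_const ptime_times_const ptime_colors_power)
  moreover have "shl I 1 (colors_of I ^ 5 * 280) = 2 ^ (280 * colors_of I ^ 5)" for I
    by (subst shl_exact) (auto simp: bits_def mult.commute)
  ultimately show "ptime \<iota> es (\<lambda>x. 2 ^ (280 * colors_of (\<iota> x) ^ 5))" by simp
qed

theorem answer_program:
  "\<exists>P c. \<forall>I s. 0 < colors_of I \<and> fst s ''n'' = order_of I \<and> fst s ''k'' = colors_of I \<and> snd s ''adj'' = matrix_of I \<longrightarrow>
     (\<exists>s'. runs P I c s s' \<and> fst s' ''result'' = of_bool (answer I))"
proof -
  have "ptime (\<lambda>I. I) [] (\<lambda>I. of_bool (answer I))" using ptest_answer[of "\<lambda>I. I" "[]"] unfolding ptest_def .
  moreover have "\<forall>p\<in>set []. p < (0::nat)" by simp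
  ultimately obtain P c where P: "\<And>I s. loaded (\<lambda>I. I) [] [] I s \<Longrightarrow>
    \<exists>s'. runs P I c s s' \<and> fst s' (reg 0) = of_bool (answer I) \<and> preserved 0 s s'" using ptime_E by blast
  show ?thesis
  proof (intro exI[of _ "Seq P (Assign ''result'' (Var (reg 0)))"] exI[of _ "Suc (max c (1 + acost (Var (reg 0))))"] allI impI)
    fix I s assume "0 < colors_of I \<and> fst s ''n'' = order_of I \<and> fst s ''k'' = colors_of I \<and> snd s ''adj'' = matrix_of I"
    then have "loaded (\<lambda>I. I) [] [] I s" by (simp add: loaded_def)
    then obtain s' where s': "runs P I c s s'" "fst s' (reg 0) = of_bool (answer I)" using P by blast
    show "\<exists>s'. runs (Seq P (Assign ''result'' (Var (reg 0)))) I (Suc (max c (1 + acost (Var (reg 0))))) s s' \<and>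
        fst s' ''result'' = of_bool (answer I)"
      using runs_Seq[OF s'(1) runs_Assign[of "''result''" "Var (reg 0)" I s']] s'(2)
      by (intro exI[of _ "((fst s')(''result'' := aval (Var (reg 0)) s'), snd s')"]) simp
  qed
qed

section \<open>Correctness\<close>

text \<open>Invariant of the scan: the set coded so far is separated, and each vertex scanned is
  within the radius of a member. A vertex is added only if it is far from all members, by symmetry
  in both directions.\<close>

lemma reps_greedy:
  assumes dsym: "\<And>u v. ndist I u v = ndist I v u" and dself: "\<And>u. ndist I u u = 0"
  shows "\<exists>R\<subseteq>{..<order_of I}. (\<forall>u. is_rep I u \<longleftrightarrow> u \<in> R) \<and>
    (\<forall>x\<in>R. \<forall>y\<in>R. x \<noteq> y \<longrightarrow> radius I < ndist I x y) \<and> (\<forall>w<order_of I. \<exists>u\<in>R. ndist I u w \<le> radius I)"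
proof -
  let ?n = "order_of I"
  define S where "S = rec_nat 0 (\<lambda>v S. if \<exists>u<order_of I. u < v \<and> slice I S u 1 = 1 \<and> ndist I u v \<le> radius I
     then S else S + shl I 1 v)"
  have S_Suc: "S (Suc v) = (if \<exists>u<order_of I. u < v \<and> slice I (S v) u 1 = 1 \<and> ndist I u v \<le> radius I
     then S v else S v + shl I 1 v)" for v by (simp only: S_def nat.rec)
  define code where "code v R = (\<Sum>u<v. of_bool (u \<in> R) * 2 ^ (u * 1) :: nat)" for v and R :: "nat set"
  have slice_code: "slice I (code v R) u 1 = (if u < v then of_bool (u \<in> R) else 0)" if "v \<le> ?n" "0 < ?n" for v R u
  proof -
    have "code v R < 2 ^ (v * 1)" unfolding code_def by (rule digits_less) simp
    also have "\<dots> \<le> 2 ^ bits I" using that by (intro power_increasing) (auto simp: bits_def)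
    finally have "slice I (code v R) u 1 = code v R div 2 ^ u mod 2 ^ 1"
      using that by (intro slice_eq) (auto simp: bits_def)
    then show ?thesis using digits_nth[of v "\<lambda>u. of_bool (u \<in> R)" 1 u] by (simp add: code_def)
  qed
  have "\<exists>R\<subseteq>{..<v}. S v = code v R \<and> (\<forall>x\<in>R. \<forall>y\<in>R. x \<noteq> y \<longrightarrow> radius I < ndist I x y) \<and>
      (\<forall>w<v. \<exists>u\<in>R. ndist I u w \<le> radius I)" if "v \<le> ?n" for v
    using that
  proof (induction v)
    case 0
    then show ?case by (simp add: S_def code_def)
  next
    case (Suc v)
    then obtain R where R: "R \<subseteq> {..<v}" "S v = code v R" "\<forall>x\<in>R. \<forall>y\<in>R. x \<noteq> y \<longrightarrow> radius I < ndist I x y"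
      "\<forall>w<v. \<exists>u\<in>R. ndist I u w \<le> radius I" by auto
    have n0: "0 < ?n" "v \<le> ?n" using Suc.prems by auto
    have vR: "v \<notin> R" using R(1) by auto
    let ?c = "\<exists>u\<in>R. ndist I u v \<le> radius I"
    have c: "(\<exists>u<?n. u < v \<and> slice I (S v) u 1 = 1 \<and> ndist I u v \<le> radius I) \<longleftrightarrow> ?c"
      using R(1) n0 slice_code[OF n0(2,1)] unfolding R(2) by (auto simp: subset_eq)
    have Sv: "S (Suc v) = (if ?c then code v R else code v R + shl I 1 v)"
      unfolding S_Suc[of v] c unfolding R(2) ..
    have "shl I 1 v = 2 ^ v" using n0 by (subst shl_exact) (auto simp: bits_def)
    moreover have "code (Suc v) R = code v R" using vR by (simp add: code_def)
    moreover have "code (Suc v) (insert v R) = code v R + 2 ^ v"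
    proof -
      have "(\<Sum>u<v. of_bool (u \<in> insert v R) * 2 ^ (u * 1) :: nat) = (\<Sum>u<v. of_bool (u \<in> R) * 2 ^ (u * 1))"
        by (intro sum.cong) auto
      then show ?thesis by (simp add: code_def)
    qed
    ultimately have S': "S (Suc v) = code (Suc v) (if ?c then R else insert v R)" using Sv by simp
    show ?case
    proof (cases ?c)
      case True
      then show ?thesis using R S' by (intro exI[of _ R]) (auto simp: less_Suc_eq)
    next
      case False
      then have "\<forall>x\<in>R. radius I < ndist I x v \<and> radius I < ndist I v x" using dsym by (auto simp: not_le)
      then show ?thesis using False R S' dself by (intro exI[of _ "insert v R"]) (auto simp: less_Suc_eq)
    qed
  qed
  from this[of ?n] obtain R where R: "R \<subseteq> {..<?n}" "S ?n = code ?n R"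
    "\<forall>x\<in>R. \<forall>y\<in>R. x \<noteq> y \<longrightarrow> radius I < ndist I x y" "\<forall>w<?n. \<exists>u\<in>R. ndist I u w \<le> radius I" by auto
  have "is_rep I u \<longleftrightarrow> u \<in> R" for u
  proof (cases "?n = 0")
    case True
    then have "reps I = 0" by (simp add: reps_def)
    then show ?thesis using True R(1) by (auto simp: is_rep_def slice_def shr_def)
  next
    case False
    have "reps I = code ?n R" using R(2) by (simp add: reps_def S_def)
    then show ?thesis using slice_code[of ?n R u] False R(1) by (auto simp: is_rep_def)
  qed
  then show ?thesis using R by (intro exI[of _ R]) auto
qed

theorem answer_correct:
  assumes G: "pair_graph G" and V: "pverts G = {..<n}" and k: "0 < k"
  defines "I \<equiv> (n, k, \<lambda>i. if i < n * n \<and> (i div n, i mod n) \<in> parcs G then 1 else 0)"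
  shows "answer I \<longleftrightarrow> admits_partial_grundy G k"
proof -
  have [simp]: "order_of I = n" "colors_of I = k" by (simp_all add: I_def order_of_def colors_of_def)
  have ends: "u < n" "v < n" if "(u, v) \<in> parcs G" for u v
  proof -
    interpret pair_graph G by fact
    show "u < n" "v < n" using in_arcsD1[OF that] in_arcsD2[OF that] V by auto
  qed
  have adj: "adjacent I = (\<lambda>u v. (u, v) \<in> parcs G)"
  proof (intro ext)
    fix u v
    have "u * n + v < n * n" if "u < n" "v < n"
    proof -
      have "Suc u * n \<le> n * n" using that by (intro mult_le_mono1) simp
      then show ?thesis using that by simp
    qed
    then show "adjacent I u v = ((u, v) \<in> parcs G)"
      using ends[of u v] by (auto simp: adjacent_def matrix_of_def I_def order_of_def)
  qed
  interpret sgraph "{..<n}" "adjacent I" using sgraph_of_pair_graph[OF G] unfolding V adj .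
  have adm: "admits_partial_grundy G k \<longleftrightarrow> (\<exists>x. witness k x)"
    using admits_iff_witness[OF G k] unfolding V adj .
  have k1: "1 \<le> k ^ j" "k ^ i \<le> k ^ j" if "i \<le> j" for i j using k that by (auto intro: power_increasing)
  have rad: "radius I = 2 ^ (11 * k\<^sup>2)"
    unfolding radius_def using k1(2)[of 2 5] by (subst shl_exact) (auto simp: bits_def mult.commute)
  have nd: "ndist I u v = dist u v" for u v
    unfolding ndist_def dist_def by (rule arg_cong[of _ _ card]) auto
  obtain R where R: "R \<subseteq> {..<n}" "\<And>u. is_rep I u \<longleftrightarrow> u \<in> R"
    "\<And>x y. x \<in> R \<Longrightarrow> y \<in> R \<Longrightarrow> x \<noteq> y \<Longrightarrow> 2 ^ (11 * k\<^sup>2) < dist x y"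
    "\<And>w. w < n \<Longrightarrow> \<exists>u\<in>R. dist u w \<le> 2 ^ (11 * k\<^sup>2)"
  proof -
    have "dist u u = 0" for u by (simp add: dist_def)
    then show ?thesis using that reps_greedy[of I] dist_commute by (auto simp: nd rad)
  qed
  have cardR: "card {u. u < n \<and> is_rep I u} = card R" using R(1,2) by (intro arg_cong[of _ _ card]) auto
  have M: "shl I 1 (k ^ 3 * 35) = 2 ^ (35 * k ^ 3)"
    using k1(2)[of 3 5] by (subst shl_exact) (auto simp: bits_def mult.commute)
  have ans: "answer I \<longleftrightarrow> 2 ^ (35 * k ^ 3) < card R \<or> (\<exists>N<2 ^ (280 * k ^ 5). accept_of I N)"
    unfolding answer_def by (simp only: \<open>order_of I = n\<close> \<open>colors_of I = k\<close> cardR M)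
  let ?d = "2 ^ (11 * k\<^sup>2) :: nat"
  have rep: "is_rep I = (\<lambda>u. u \<in> R)" using R(2) by (intro ext)
  have cls: "in_class I a v \<longleftrightarrow> (\<exists>u\<in>R. rank n (\<lambda>u. u \<in> R) u = a \<and> v \<in> ball ?d u)" for a v
    using R(1) unfolding in_class_def ball_def nd rad rep by (auto simp: subset_eq)
  have ball_of: "{v. in_class I (rank n (\<lambda>u. u \<in> R) u) v} = ball ?d u" if "u \<in> R" for u
  proof -
    have "u' = u" if "u' \<in> R" "rank n (\<lambda>u. u \<in> R) u' = rank n (\<lambda>u. u \<in> R) u" for u'
      using rank_inj[of "\<lambda>u. u \<in> R" u' u n] that \<open>u \<in> R\<close> R(1) by auto
    then show ?thesis using that unfolding cls by blast
  qed
  have ix: "i * k + j < k\<^sup>2" "(i * k + j) div k = i" "(i * k + j) mod k = j" if "i < k" "j < k" for i j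
  proof -
    have "Suc i * k \<le> k * k" using that by (intro mult_le_mono1) simp
    then show "i * k + j < k\<^sup>2" "(i * k + j) div k = i" "(i * k + j) mod k = j"
      using that by (simp_all add: power2_eq_square)
  qed
  show ?thesis
    unfolding adm
  proof
    assume "answer I"
    then consider "2 ^ (35 * k ^ 3) < card R" | N where "accept_of I N"
      unfolding ans by blast
    then show "\<exists>x. witness k x"
    proof cases
      case 1
      show ?thesis
      proof (rule ccontr)
        assume "\<not> ?thesis"
        from separated_family_bound[OF this k R(1)] R(3) have "card R \<le> 2 ^ (35 * k ^ 3)"
          by (simp add: dist_def)
        then show False using 1 by simp
      qed
    next
      case 2
      define x where "x i j = sol_of I N (i * k + j)" for i j
      have c: "compatible I (i * k + j) (i' * k + j') (x i j) (x i' j')"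
        if "i < k" "j < k" "i' < k" "j' < k" for i j i' j'
        using 2 ix that unfolding accept_of_eq x_def by simp
      have "x i j < n \<and> (j = j' \<longrightarrow> \<not> adjacent I (x i j) (x i' j')) \<and> (\<not> j = j' \<longrightarrow> \<not> x i j = x i' j') \<and>
          (i = i' \<and> j = i \<and> j' < i \<longrightarrow> adjacent I (x i j) (x i' j'))"
        if "i < k" "j < k" "i' < k" "j' < k" for i j i' j'
        using c[OF that] that unfolding compatible_def by (simp only: \<open>order_of I = n\<close> \<open>colors_of I = k\<close>) blast
      then have "witness k x" unfolding witness_def by (auto dest: less_trans)
      then show ?thesis by blast
    qed
  next
    assume "\<exists>x. witness k x"
    then obtain x where x: "witness k x" by blast
    show "answer I"
    proof (cases "2 ^ (35 * k ^ 3) < card R")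
      case True
      then show ?thesis by (simp add: ans)
    next
      case False
      then have cR: "card R \<le> 2 ^ (35 * k ^ 3)" by simp
      define X where "X p = x (p div k) (p mod k)" for p
      have pk: "p div k < k" "p mod k < k" if "p < k\<^sup>2" for p
        using that k by (simp_all add: power2_eq_square less_mult_imp_div_less)
      have Xn: "X p < n" if "p < k\<^sup>2" for p using x pk[OF that] by (auto simp: witness_def X_def)
      have "\<exists>u. u \<in> R \<and> X p \<in> ball ?d u" if "p < k\<^sup>2" for p
        using R(4)[OF Xn[OF that]] Xn[OF that] by (auto simp: ball_def)
      then obtain r where r: "\<And>p. p < k\<^sup>2 \<Longrightarrow> r p \<in> R \<and> X p \<in> ball ?d (r p)" by metis
      define a where "a p = rank n (\<lambda>u. u \<in> R) (r p)" for p
      define w where "w = k ^ 3 * 40"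
      have "\<exists>\<alpha>. (\<forall>i. \<alpha> i \<le> 2 ^ w - 1) \<and> (\<forall>i\<ge>k\<^sup>2 * 7. \<alpha> i = 0) \<and>
        search.accepts n (k\<^sup>2) (adjacent I) (in_class I) (compatible I) (\<lambda>q. \<alpha> (q * 7)) (\<lambda>q. \<alpha> (q * 7 + 1))
          (\<lambda>q. \<alpha> (q * 7 + 2)) (\<lambda>q. \<alpha> (q * 7 + 3)) (\<lambda>q. \<alpha> (q * 7 + 4)) (\<lambda>q. \<alpha> (q * 7 + 5)) (\<lambda>q. \<alpha> (q * 7 + 6))"
      \<comment> \<open>\<open>L\<close> and \<open>\<Delta>\<close> are the constants of
        \<open>ball_pair_regular\<close>; \<open>2 ^ w - 1\<close> is the largest number that a
        digit can hold.\<close>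
      proof (rule search_complete[where L = "4 * ?d" and \<Delta> = "3 * ?d" and a = a and x = X])
        show "adjacent I v u" if "adjacent I u v" for u v by (rule symA[OF that])
        show "v < n" if "in_class I c v" for c v using that by (simp add: in_class_def)
        show "y < n \<and> z < n" if "compatible I p q y z" for p q y z using that by (simp add: compatible_def)
        show "compatible I p q y' z'" if "compatible I p q y z" "adjacent I y' z' = adjacent I y z" "y' \<noteq> z'" "y' < n" "z' < n"
          for p q y z y' z' using that unfolding compatible_def by simp
        show "in_class I (a q) (X q)" if "q < k\<^sup>2" for q
          using r[OF that] ball_of[of "r q"] by (auto simp: a_def)
        show "compatible I p q (X p) (X q)" if "p < k\<^sup>2" "q < k\<^sup>2" for p q
        proof -
          have "(j = j' \<longrightarrow> \<not> adjacent I (X p) (X q)) \<and> (\<not> j = j' \<longrightarrow> \<not> X p = X q) \<and>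
              (i = i' \<and> j = i \<and> j' < i \<longrightarrow> adjacent I (X p) (X q))"
            if "i < k" "j < k" "i' < k" "j' < k" "p = i * k + j" "q = i' * k + j'" for i j i' j'
            using x that ix[of i j] ix[of i' j'] unfolding witness_def X_def by auto
          then show ?thesis using Xn that unfolding compatible_def by simp
        qed
        show "\<exists>b. (\<forall>v. in_class I (a p) v \<longrightarrow> card {u. in_class I (a q) u \<and> adjacent I v u \<noteq> b} \<le> 3 * ?d) \<and>
            (\<forall>u. in_class I (a q) u \<longrightarrow> card {v. in_class I (a p) v \<and> adjacent I u v \<noteq> b} \<le> 3 * ?d)"
          if "p < k\<^sup>2" "q < k\<^sup>2" "4 * ?d < card {v. in_class I (a p) v}" "4 * ?d < card {v. in_class I (a q) v}" for p q
        proof -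
          have e: "{v. in_class I (a p) v} = ball ?d (r p)" "{v. in_class I (a q) v} = ball ?d (r q)"
            using ball_of r that by (simp_all add: a_def)
          then have e': "in_class I (a p) v \<longleftrightarrow> v \<in> ball ?d (r p)" "in_class I (a q) v \<longleftrightarrow> v \<in> ball ?d (r q)" for v
            by auto
          have "4 * ?d < card (ball ?d (r p))" "4 * ?d < card (ball ?d (r q))" using that(3,4) unfolding e .
          from ball_pair_regular[OF this] show ?thesis unfolding e' by blast
        qed
        have d: "?d \<le> 2 ^ (11 * k ^ 3)" using k1(2)[of 2 3] by (intro power_increasing) auto
        \<comment> \<open>The exponent 39 instead of 40 yields the strict inequality.\<close>
        have lt: "y \<le> 2 ^ w - 1" if "y \<le> 2 ^ (k ^ 3 * 39)" for y :: nat
        proof -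
          have "y < 2 ^ w"
            by (rule le_less_trans[OF that]) (use k in \<open>simp add: w_def\<close>)
          then show ?thesis by simp
        qed
        have kk: "k ^ j \<le> 2 ^ (j * k ^ 3)" for j
        proof -
          have "k \<le> k ^ 3" using k1(2)[of 1 3] by simp
          also have "\<dots> \<le> 2 ^ k ^ 3" by (rule less_imp_le[OF less_exp])
          finally have "k \<le> 2 ^ k ^ 3" .
          from power_mono[OF this, of j] show ?thesis by (simp add: power_mult mult.commute[of j])
        qed
        have "k\<^sup>2 \<le> 2 ^ (k ^ 3 * 39)" by (rule order_trans[OF kk]) (auto intro!: power_increasing)
        then show "k\<^sup>2 \<le> 2 ^ w - 1" by (rule lt)
        show "1 \<le> 2 ^ w - (1::nat)" by (rule lt) simp
        have four: "4 * ?d \<le> 2 ^ (13 * k ^ 3)"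
        proof -
          have "4 * ?d \<le> 2 ^ (2 + 11 * k ^ 3)" using d by (simp add: power_add)
          also have "\<dots> \<le> 2 ^ (13 * k ^ 3)" using k1(1)[of 0 3] by (intro power_increasing) auto
          finally show ?thesis .
        qed
        also have "(2::nat) ^ (13 * k ^ 3) \<le> 2 ^ (k ^ 3 * 39)" by (intro power_increasing) auto
        finally have "4 * ?d \<le> 2 ^ (k ^ 3 * 39)" .
        then show l4: "4 * ?d \<le> 2 ^ w - 1" by (rule lt)
        show "3 * ?d \<le> 2 ^ w - 1" by (rule order_trans[OF _ l4]) simp
        have "k\<^sup>2 * k\<^sup>2 * (3 * ?d + 1) \<le> k ^ 4 * (4 * ?d)"
          by (intro mult_le_mono) (auto simp flip: power_add)
        also have "\<dots> \<le> 2 ^ (4 * k ^ 3) * 2 ^ (13 * k ^ 3)" by (intro mult_le_mono kk four)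
        also have "\<dots> = 2 ^ (17 * k ^ 3)" by (simp flip: power_add)
        also have "\<dots> \<le> 2 ^ (k ^ 3 * 39)" by (intro power_increasing) auto
        finally show "k\<^sup>2 * k\<^sup>2 * (3 * ?d + 1) \<le> 2 ^ w - 1" by (rule lt)
        show "a q \<le> 2 ^ w - 1" if "q < k\<^sup>2" for q
        proof (rule lt)
          have "a q \<le> card {u. u \<in> R}" unfolding a_def using R(1) by (intro rank_le) auto
          also have "\<dots> \<le> 2 ^ (35 * k ^ 3)" using cR by simp
          also have "\<dots> \<le> 2 ^ (k ^ 3 * 39)" by (intro power_increasing) auto
          finally show "a q \<le> 2 ^ (k ^ 3 * 39)" .
        qed
      qed
      then obtain \<alpha> where \<alpha>: "\<And>i. \<alpha> i \<le> 2 ^ w - 1" "\<And>i. k\<^sup>2 * 7 \<le> i \<Longrightarrow> \<alpha> i = 0"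
        "search.accepts n (k\<^sup>2) (adjacent I) (in_class I) (compatible I) (\<lambda>q. \<alpha> (q * 7)) (\<lambda>q. \<alpha> (q * 7 + 1))
          (\<lambda>q. \<alpha> (q * 7 + 2)) (\<lambda>q. \<alpha> (q * 7 + 3)) (\<lambda>q. \<alpha> (q * 7 + 4)) (\<lambda>q. \<alpha> (q * 7 + 5)) (\<lambda>q. \<alpha> (q * 7 + 6))"
        by blast
      define N where "N = (\<Sum>i<k\<^sup>2 * 7. \<alpha> i * 2 ^ (i * w))"
      have small: "\<alpha> i < 2 ^ w" for i
        using le_less_trans[OF \<alpha>(1)[of i], of "2 ^ w"] by simp
      have e: "k\<^sup>2 * 7 * w = 280 * k ^ 5" by (simp add: w_def power_add[of k 2 3, simplified])
      have "N < 2 ^ (k\<^sup>2 * 7 * w)" unfolding N_def by (rule digits_less) (rule small)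
      then have N: "N < 2 ^ (280 * k ^ 5)" unfolding e .
      have "digit I N i = \<alpha> i" for i
      proof -
        have "N < 2 ^ bits I" by (rule less_le_trans[OF N]) (auto intro!: power_increasing simp: bits_def)
        moreover have "w \<le> bits I" using k1(2)[of 3 5] by (simp add: w_def bits_def)
        ultimately have "digit I N i = N div 2 ^ (i * w) mod 2 ^ w" unfolding digit_def by (simp add: slice_eq w_def)
        also have "\<dots> = (if i < k\<^sup>2 * 7 then \<alpha> i else 0)" unfolding N_def by (rule digits_nth) (rule small)
        finally show ?thesis using \<alpha>(2)[of i] by simp
      qed
      then have "accept_of I N" using \<alpha>(3) by (simp add: accept_of_def)
      then show ?thesis using N by (auto simp: ans)
    qed
  qed
qed

theorem theorem1:
  shows "\<exists>P a b. decides_partial_grundy_within P (\<lambda>n k. 2 ^ (a * k ^ 5) * max 1 n ^ b)"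
proof -
  obtain P c where P: "\<And>I s. 0 < colors_of I \<Longrightarrow> fst s ''n'' = order_of I \<Longrightarrow> fst s ''k'' = colors_of I \<Longrightarrow>
      snd s ''adj'' = matrix_of I \<Longrightarrow> \<exists>s'. runs P I c s s' \<and> fst s' ''result'' = of_bool (answer I)"
    using answer_program by blast
  have "decides_partial_grundy_within P (\<lambda>n k. 2 ^ (3 * c * k ^ 5) * max 1 n ^ c)"
    unfolding decides_partial_grundy_within_def
  proof (intro allI impI)
    fix G :: "nat pair_pre_digraph" and n k :: nat
    assume G: "pair_graph G" "pverts G = {..<n}" "0 < k"
    define I :: inst where "I = (n, k, \<lambda>i. if i < n * n \<and> (i div n, i mod n) \<in> parcs G then 1 else 0)"
    have I: "order_of I = n" "colors_of I = k" by (simp_all add: I_def order_of_def colors_of_def)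
    obtain s' t where s': "exec P (input_state G n k) t s'" "t \<le> budget I ^ c" "fst s' ''result'' = of_bool (answer I)"
      using P[of I "input_state G n k"] G(3) I
      by (auto simp: input_state_def I_def matrix_of_def runs_def)
    \<comment> \<open>The budget contains one factor \<open>2 ^ k ^ 5\<close>; two more absorb the
      passage from \<open>n + 2\<close> to \<open>max 1 n\<close>, which stays positive for the
      empty graph.\<close>
    have "budget I \<le> 2 ^ (3 * k ^ 5) * max 1 n"
    proof -
      have "(4::nat) \<le> 2 ^ (2 * k ^ 5)" using power_increasing[of 2 "2 * k ^ 5" "2::nat"] G(3) by simp
      then have "4 * max 1 n \<le> 2 ^ (2 * k ^ 5) * max 1 n" by (rule mult_le_mono1)
      moreover have "n + 2 \<le> 4 * max 1 n" by simp
      ultimately have "n + 2 \<le> 2 ^ (2 * k ^ 5) * max 1 n" by linarith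
      then have "budget I \<le> 2 ^ k ^ 5 * (2 ^ (2 * k ^ 5) * max 1 n)"
        unfolding budget_def I by (rule mult_le_mono2)
      also have "\<dots> = 2 ^ (k ^ 5 + 2 * k ^ 5) * max 1 n" by (simp only: power_add mult.assoc)
      finally show ?thesis by simp
    qed
    from power_mono[OF this, of c] have "budget I ^ c \<le> 2 ^ (3 * c * k ^ 5) * max 1 n ^ c"
      by (simp add: power_mult_distrib ac_simps flip: power_mult)
    moreover have "answer I \<longleftrightarrow> admits_partial_grundy G k"
      unfolding I_def by (rule answer_correct[OF G])
    ultimately show "\<exists>t s'. exec P (input_state G n k) t s' \<and> t \<le> 2 ^ (3 * c * k ^ 5) * max 1 n ^ c \<and>
        (if admits_partial_grundy G k then accepting s' else rejecting s')"
      using s' by (intro exI[of _ t] exI[of _ s']) (auto simp: accepting_def rejecting_def)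
  qed
  then show ?thesis by blast
qed

end
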